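(* Let $\mathsf{C}$ be a category with covers (satisfying the axioms (A1)–(A4) of the context) in which Godemont's Theorem (axiom (A5) of the context) holds, and let $n\ge 0$ be an integer. If $p\colon E_\bullet\to U_\bullet$ is a local $n$-bundle and $f\colon U_\bullet\to X_\bullet$ is an $(n+1)$-hypercover, then the $n$-strictification $$\tau_n(fp)\colon \tau_n(E,fp)_\bullet\to X_\bullet$$ of the composite $fp\colon E_\bullet\to X_\bullet$ exists.
   Context: **Categories with covers.** $\mathsf{C}$ is a category with a subcategory of morphisms called covers such that: (A1) $\mathsf{C}$ has a terminal object $\ast$ and $X\to\ast$ is a cover for every $X$; (A2) pullbacks of covers along arbitrary maps exist and are covers; (A3) if $g,f$ are composable and $f\circ g$ and $g$ are covers, then $f$ is a cover; (A4) every cover $X\to Y$ is an effective epimorphism, i.e. the coequalizer of its kernel pair $X\times_Y X\rightrightarrows X$. **Simplicial notation.** $\mathsf{sC}$ is the category of simplicial objects in $\mathsf{C}$; objects of $\mathsf{C}$ are viewed as constant simplicial objects. For $X_\bullet\in\mathsf{sC}$ and a simplicial set $S$, $\hom(S,X):=\lim_{\Delta^k\to S}X_k$, if it exists. Expressions such as $\hom(S,X)\times_{\hom(S,Y)}\hom(T,Y)$ denote a single limit in $\mathsf{C}$ (the object, if it exists, representing the corresponding functor of points; the individual factors need not exist). $\Lambda^k_i\subset\partial\Delta^k$ is the horn omitting the $i$-th face. For $f\colon X_\bullet\to Y_\bullet$ put $M_k(f)=\hom(\partial\Delta^k,X)\times_{\hom(\partial\Delta^k,Y)}Y_k$ and $\Lambda^k_i(f)=\hom(\Lambda^k_i,X)\times_{\hom(\Lambda^k_i,Y)}Y_k$,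 with induced maps $\mu_k(f)\colon X_k\to M_k(f)$ and $\lambda^k_i(f)\colon X_k\to\Lambda^k_i(f)$. When $Y=\ast$ write $M_k(X),\Lambda^k_i(X),\mu_k(X),\lambda^k_i(X)$. **Lie groupoids, hypercovers, stacks.** For $m\in\mathbb N\cup\{\infty\}$: a Lie $m$-groupoid is $X_\bullet\in\mathsf{sC}$ such that for all $k>0$, $0\le i\le k$, $\Lambda^k_i(X)$ exists and $\lambda^k_i(X)$ is a cover, and is an isomorphism for $k>m$. A map $f$ of Lie $\infty$-groupoids is an $m$-hypercover if for all $k\ge0$ $M_k(f)$ exists and $\mu_k(f)$ is a cover, and is an isomorphism for $k\ge m$. A map $f$ of Lie $\infty$-groupoids is an $m$-stack if for all $k>0$, $0\le i\le k$, $\Lambda^k_i(f)$ exists and $\lambda^k_i(f)$ is a cover, and is an isomorphism for $k>m$. **Orbit space.** The orbit space $\pi_0(Z)$ of a Lie $\infty$-groupoid $Z_\bullet$ is (if it exists) a cover $Z_0\to\pi_0(Z)$ which is the coequalizer of $d_0,d_1\colon Z_1\rightrightarrows Z_0$. **Local $n$-bundles.** A map $p\colon E_\bullet\to X_\bullet$ in $\mathsf{sC}$ is a twisted Cartesian product if there exist $Y_\bullet\in\mathsf{sC}$ and isomorphisms $\varphi_k\colon E_k\to X_k\times Y_k$ over $X_k$ for all $k$ such that $\varphi_{k-1}d_i^E=(d_i^X\times d_i^Y)\varphi_k$ for $i<k$ and $\varphi_{k+1}s_i^E=(s_i^X\times s_i^Y)\varphi_k$ for all $i$. A local $n$-bundle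 is a twisted Cartesian product which is also an $n$-stack. **Axiom (A5) (Godemont's Theorem).** The graph of $h\colon X\to Y$ is $\Gamma_h=(1,h)\colon X\cong X\times_Y Y\to X\times Y$. Regular embeddings are the smallest subcategory of $\mathsf{C}$ closed under pullback along covers and containing all graphs. A Lie $m$-groupoid $Z_\bullet$ is regular if $\mu_1(Z)=(d_0,d_1)\colon Z_1\to Z_0\times Z_0$ is a regular embedding. (A5) says: for every $m$ and every regular Lie $m$-groupoid $Z_\bullet$, the orbit space $\pi_0(Z)$ exists. **Higher morphism spaces.** $S\star T$ is the join of simplicial sets ($\Delta^a\star\Delta^b=\Delta^{a+b+1}$, $\emptyset\star T=T$). For a finite simplicial set $S$, $X^{S\star}_\bullet$ has $\ell$-simplices $\hom(S\star\Delta^\ell,X)$; e.g. $X^{\Delta^{k-1}\star}_\ell=X_{k+\ell}$. For an $\infty$-stack $g\colon X_\bullet\to Y_\bullet$ and $k>0$, the $0$-simplices of $B_\bullet:=X_\bullet^{\partial\Delta^{k-1}\star}\times_{Y_\bullet^{\partial\Delta^{k-1}\star}}Y_\bullet^{\Delta^{k-1}\star}$ are $\Lambda^k_k(g)$, and $P^{\ge k}(g)_\bullet$ is the pullback of the natural map $X^{\Delta^{k-1}\star}_\bullet\to B_\bullet$ along the map $\Lambda^k_k(g)\to B_\bullet$ from the constant simplicial object on the vertices of $B_\bullet$ given by iterated degeneracies. For $k=0$, $P^{\ge 0}(g)_\bullet:=X_\bullet\times_{Y_\bullet}Y_0$, the pullback of $g$ along the map $Y_0\to Y_\bullet$ from the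 constant simplicial object given by iterated degeneracies. So for all $k\ge0$, $P^{\ge k}(g)_0=X_k$, and $P^{\ge k}(g)_1$ is the subobject of those $x\in X_{k+1}$ with $g(x)=s_kd_kg(x)$ and $d_ix=s_{k-1}d_{k-1}d_ix$ for $i<k$, with faces $d_0,d_1$ given by $d_k,d_{k+1}$. **Strictification.** Let $g\colon X_\bullet\to Y_\bullet$ be an $\infty$-stack and $n\ge0$. The $n$-strictification of $g$ exists when the orbit space $\pi_0(P^{\ge n}(g))$ exists. It is then constructed as follows. Let $q\colon X_n\to\pi_0(P^{\ge n}(g))$ be the orbit cover. The $n$-truncated object $\mathrm{tr}_n\tau_n(X,g)$ has $k$-simplices $X_k$ for $k<n$ and $n$-simplices $\pi_0(P^{\ge n}(g))$, with structure maps induced from $X_\bullet$, and maps to $\mathrm{tr}_nY$ by the maps induced by $g$. Put $\Lambda^{n+1}_i(\tau_n(g))=\hom(\Lambda^{n+1}_i,\tau_n(X,g))\times_{\hom(\Lambda^{n+1}_i,Y)}Y_{n+1}$. The composite $qd_i$ of $d_i\colon X_{n+1}\to X_n$ with $q$ factors uniquely through the cover $X_{n+1}\to\Lambda^{n+1}_i(\tau_n(g))$, giving a missing face map $d_i\colon\Lambda^{n+1}_i(\tau_n(g))\to\pi_0(P^{\ge n}(g))$. The $(n+1)$-simplices are $\Lambda^{n+1}_1(\tau_n(g))$, with $d_1$ the missing face map and the other faces the projections (degeneracies induced from $X_\bullet$); finally $\tau_n(X,g)_\bullet=\mathrm{cosk}_{n+1}\mathrm{tr}_{n+1}\tau_n(X,g)\times_{\mathrm{Cosk}_{n+1}Y}Y_\bullet$,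 where $\mathrm{cosk}_{n+1}$ is right adjoint to truncation and $\mathrm{Cosk}_{n+1}=\mathrm{cosk}_{n+1}\mathrm{tr}_{n+1}$. The map $\tau_n(g)$ is the projection to $Y_\bullet$. *)

theory Defs
  imports Main "HOL-Library.Extended_Nat"
begin

section \<open>Categories with covers\<close>

record ('o, 'm) cov_cat =
  Obj :: "'o set"
  Arr :: "'m set"
  Dom :: "'m \<Rightarrow> 'o"
  Cod :: "'m \<Rightarrow> 'o"
  Id :: "'o \<Rightarrow> 'm"
  Comp :: "'m \<Rightarrow> 'm \<Rightarrow> 'm"  (infixr "\<cdot>\<index>" 70)
  Cov :: "'m set"

definition hom :: "('o, 'm) cov_cat \<Rightarrow> 'o \<Rightarrow> 'o \<Rightarrow> 'm set" where
  "hom C a b = {f \<in> Arr C. Dom C f = a \<and> Cod C f = b}"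

definition category :: "('o, 'm) cov_cat \<Rightarrow> bool" where
  "category C \<longleftrightarrow>
     (\<forall>f\<in>Arr C. Dom C f \<in> Obj C \<and> Cod C f \<in> Obj C) \<and>
     (\<forall>a\<in>Obj C. Id C a \<in> hom C a a) \<and>
     (\<forall>f\<in>Arr C. \<forall>g\<in>Arr C. Cod C f = Dom C g \<longrightarrow> g \<cdot>\<^bsub>C\<^esub> f \<in> hom C (Dom C f) (Cod C g)) \<and>
     (\<forall>f\<in>Arr C. f \<cdot>\<^bsub>C\<^esub> Id C (Dom C f) = f \<and> Id C (Cod C f) \<cdot>\<^bsub>C\<^esub> f = f) \<and>
     (\<forall>f\<in>Arr C. \<forall>g\<in>Arr C. \<forall>h\<in>Arr C. Cod C f = Dom C g \<and> Cod C g = Dom C h \<longrightarrow>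
        h \<cdot>\<^bsub>C\<^esub> (g \<cdot>\<^bsub>C\<^esub> f) = (h \<cdot>\<^bsub>C\<^esub> g) \<cdot>\<^bsub>C\<^esub> f)"

definition is_iso :: "('o, 'm) cov_cat \<Rightarrow> 'm \<Rightarrow> bool" where
  "is_iso C f \<longleftrightarrow> f \<in> Arr C \<and>
     (\<exists>g\<in>hom C (Cod C f) (Dom C f). g \<cdot>\<^bsub>C\<^esub> f = Id C (Dom C f) \<and> f \<cdot>\<^bsub>C\<^esub> g = Id C (Cod C f))"

definition is_terminal :: "('o, 'm) cov_cat \<Rightarrow> 'o \<Rightarrow> bool" where
  "is_terminal C t \<longleftrightarrow> t \<in> Obj C \<and> (\<forall>a\<in>Obj C. \<exists>!f. f \<in> hom C a t)"

definition is_product :: "('o, 'm) cov_cat \<Rightarrow> 'o \<Rightarrow> 'o \<Rightarrow> 'o \<Rightarrow> 'm \<Rightarrow> 'm \<Rightarrow> bool" where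
  "is_product C a b P p q \<longleftrightarrow> p \<in> hom C P a \<and> q \<in> hom C P b \<and>
     (\<forall>t\<in>Obj C. \<forall>x\<in>hom C t a. \<forall>y\<in>hom C t b.
        \<exists>!h. h \<in> hom C t P \<and> p \<cdot>\<^bsub>C\<^esub> h = x \<and> q \<cdot>\<^bsub>C\<^esub> h = y)"

text \<open>The cospan is \<open>f, g\<close>; \<open>p\<close> lies over the domain of \<open>f\<close> and \<open>q\<close> over the domain of \<open>g\<close>,
  so that \<open>q\<close> is the pullback of \<open>f\<close> along \<open>g\<close>.\<close>

definition is_pullback :: "('o, 'm) cov_cat \<Rightarrow> 'm \<Rightarrow> 'm \<Rightarrow> 'm \<Rightarrow> 'm \<Rightarrow> bool" where
  "is_pullback C f g p q \<longleftrightarrow>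
     f \<in> Arr C \<and> g \<in> Arr C \<and> Cod C f = Cod C g \<and>
     p \<in> hom C (Dom C p) (Dom C f) \<and> q \<in> hom C (Dom C p) (Dom C g) \<and>
     f \<cdot>\<^bsub>C\<^esub> p = g \<cdot>\<^bsub>C\<^esub> q \<and>
     (\<forall>t\<in>Obj C. \<forall>x\<in>hom C t (Dom C f). \<forall>y\<in>hom C t (Dom C g). f \<cdot>\<^bsub>C\<^esub> x = g \<cdot>\<^bsub>C\<^esub> y \<longrightarrow>
        (\<exists>!h. h \<in> hom C t (Dom C p) \<and> p \<cdot>\<^bsub>C\<^esub> h = x \<and> q \<cdot>\<^bsub>C\<^esub> h = y))"

definition is_coequalizer :: "('o, 'm) cov_cat \<Rightarrow> 'm \<Rightarrow> 'm \<Rightarrow> 'm \<Rightarrow> bool" where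
  "is_coequalizer C d e q \<longleftrightarrow>
     d \<in> Arr C \<and> e \<in> hom C (Dom C d) (Cod C d) \<and> q \<in> hom C (Cod C d) (Cod C q) \<and>
     q \<cdot>\<^bsub>C\<^esub> d = q \<cdot>\<^bsub>C\<^esub> e \<and>
     (\<forall>r\<in>Arr C. Dom C r = Cod C d \<and> r \<cdot>\<^bsub>C\<^esub> d = r \<cdot>\<^bsub>C\<^esub> e \<longrightarrow>
        (\<exists>!h. h \<in> hom C (Cod C q) (Cod C r) \<and> h \<cdot>\<^bsub>C\<^esub> q = r))"

definition effective_epi :: "('o, 'm) cov_cat \<Rightarrow> 'm \<Rightarrow> bool" where
  "effective_epi C f \<longleftrightarrow> (\<exists>p q. is_pullback C f f p q \<and> is_coequalizer C p q f)"

text \<open>The last four conjuncts are (A1)--(A4). By (A1) every object is the domain of a cover, so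
  the subcategory of covers contains all identities.\<close>

definition category_with_covers :: "('o, 'm) cov_cat \<Rightarrow> bool" where
  "category_with_covers C \<longleftrightarrow>
     category C \<and>
     Cov C \<subseteq> Arr C \<and>
     (\<forall>a\<in>Obj C. Id C a \<in> Cov C) \<and>
     (\<forall>f\<in>Cov C. \<forall>g\<in>Cov C. Cod C f = Dom C g \<longrightarrow> g \<cdot>\<^bsub>C\<^esub> f \<in> Cov C) \<and>
     (\<exists>t. is_terminal C t \<and> (\<forall>a\<in>Obj C. hom C a t \<subseteq> Cov C)) \<and>
     (\<forall>f\<in>Cov C. \<forall>g\<in>Arr C. Cod C g = Cod C f \<longrightarrow>
        (\<exists>p q. is_pullback C f g p q) \<and> (\<forall>p q. is_pullback C f g p q \<longrightarrow> q \<in> Cov C)) \<and>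
     (\<forall>g\<in>Arr C. \<forall>f\<in>Arr C. Cod C g = Dom C f \<and> f \<cdot>\<^bsub>C\<^esub> g \<in> Cov C \<and> g \<in> Cov C \<longrightarrow> f \<in> Cov C) \<and>
     (\<forall>f\<in>Cov C. effective_epi C f)"

section \<open>Simplicial objects\<close>

text \<open>A monotone map \<open>[l] \<rightarrow> [m]\<close> is the sorted list of its \<open>l + 1\<close> values.\<close>

definition mono_maps :: "nat \<Rightarrow> nat \<Rightarrow> nat list set" where
  "mono_maps l m = {\<alpha>. length \<alpha> = Suc l \<and> sorted \<alpha> \<and> set \<alpha> \<subseteq> {0..m}}"

definition mcomp :: "nat list \<Rightarrow> nat list \<Rightarrow> nat list" where
  "mcomp \<beta> \<alpha> = map ((!) \<beta>) \<alpha>"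

definition coface :: "nat \<Rightarrow> nat \<Rightarrow> nat list" where
  "coface k i = map (\<lambda>j. if j < i then j else Suc j) [0..<k]"

definition codegen :: "nat \<Rightarrow> nat \<Rightarrow> nat list" where
  "codegen k i = map (\<lambda>j. if j \<le> i then j else j - 1) [0..<k + 2]"

text \<open>\<open>Op X m \<alpha> : X\<^sub>m \<rightarrow> X\<^sub>l\<close> is the action of \<open>\<alpha> : [l] \<rightarrow> [m]\<close>; the list \<open>\<alpha>\<close> determines \<open>l\<close>
  but not \<open>m\<close>.\<close>

record ('o, 'm) sobj =
  Ob :: "nat \<Rightarrow> 'o"
  Op :: "nat \<Rightarrow> nat list \<Rightarrow> 'm"

definition simplicial_object :: "('o, 'm) cov_cat \<Rightarrow> ('o, 'm) sobj \<Rightarrow> bool" where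
  "simplicial_object C X \<longleftrightarrow>
     (\<forall>k. Ob X k \<in> Obj C) \<and>
     (\<forall>l m. \<forall>\<alpha>\<in>mono_maps l m. Op X m \<alpha> \<in> hom C (Ob X m) (Ob X l)) \<and>
     (\<forall>m. Op X m [0..<Suc m] = Id C (Ob X m)) \<and>
     (\<forall>l m r. \<forall>\<alpha>\<in>mono_maps l m. \<forall>\<beta>\<in>mono_maps m r. Op X r (mcomp \<beta> \<alpha>) = Op X m \<alpha> \<cdot>\<^bsub>C\<^esub> Op X r \<beta>)"

definition face :: "('o, 'm) sobj \<Rightarrow> nat \<Rightarrow> nat \<Rightarrow> 'm" where
  "face X k i = Op X k (coface k i)"

definition degen :: "('o, 'm) sobj \<Rightarrow> nat \<Rightarrow> nat \<Rightarrow> 'm" where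
  "degen X k i = Op X k (codegen k i)"

definition simplicial_map ::
    "('o, 'm) cov_cat \<Rightarrow> ('o, 'm) sobj \<Rightarrow> ('o, 'm) sobj \<Rightarrow> (nat \<Rightarrow> 'm) \<Rightarrow> bool" where
  "simplicial_map C X Y f \<longleftrightarrow>
     simplicial_object C X \<and> simplicial_object C Y \<and>
     (\<forall>k. f k \<in> hom C (Ob X k) (Ob Y k)) \<and>
     (\<forall>l m. \<forall>\<alpha>\<in>mono_maps l m. f l \<cdot>\<^bsub>C\<^esub> Op X m \<alpha> = Op Y m \<alpha> \<cdot>\<^bsub>C\<^esub> f m)"

definition const_sobj :: "('o, 'm) cov_cat \<Rightarrow> 'o \<Rightarrow> ('o, 'm) sobj" where
  "const_sobj C a = \<lparr>Ob = \<lambda>_. a, Op = \<lambda>_ _. Id C a\<rparr>"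

text \<open>Limits in simplicial objects are taken degreewise. The map \<open>i\<close> goes to \<open>A\<close> and \<open>b\<close> to \<open>D\<close>.\<close>

definition is_simplicial_pullback ::
    "('o, 'm) cov_cat \<Rightarrow> ('o, 'm) sobj \<Rightarrow> ('o, 'm) sobj \<Rightarrow> ('o, 'm) sobj \<Rightarrow> (nat \<Rightarrow> 'm) \<Rightarrow> (nat \<Rightarrow> 'm) \<Rightarrow>
     ('o, 'm) sobj \<Rightarrow> (nat \<Rightarrow> 'm) \<Rightarrow> (nat \<Rightarrow> 'm) \<Rightarrow> bool" where
  "is_simplicial_pullback C A D B r c Z i b \<longleftrightarrow>
     simplicial_map C A B r \<and> simplicial_map C D B c \<and>
     simplicial_map C Z A i \<and> simplicial_map C Z D b \<and>
     (\<forall>l. is_pullback C (r l) (c l) (i l) (b l))"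

text \<open>The map \<open>X\<^sub>0 \<rightarrow> X\<close> from the constant object on the vertices, by iterated degeneracies.\<close>

definition vertex_incl :: "('o, 'm) sobj \<Rightarrow> nat \<Rightarrow> 'm" where
  "vertex_incl X l = Op X 0 (replicate (Suc l) 0)"

section \<open>Simplicial sets and matching objects\<close>

text \<open>All simplicial sets needed are simplicial subsets of standard simplices; an \<open>m\<close>-simplex of
  \<open>\<Delta>\<^sup>N\<close> is a monotone map \<open>[m] \<rightarrow> [N]\<close>, given by its list of values.\<close>

abbreviation dim :: "nat list \<Rightarrow> nat" where
  "dim \<sigma> \<equiv> length \<sigma> - 1"

definition simplex :: "nat \<Rightarrow> nat list set" where
  "simplex N = (\<Union>m. mono_maps m N)"

definition boundary :: "nat \<Rightarrow> nat list set" where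
  "boundary N = {\<sigma> \<in> simplex N. \<not> {0..N} \<subseteq> set \<sigma>}"

definition horn :: "nat \<Rightarrow> nat \<Rightarrow> nat list set" where
  "horn N i = {\<sigma> \<in> simplex N. \<not> {0..N} - {i} \<subseteq> set \<sigma>}"

text \<open>For \<open>S\<close> inside \<open>\<Delta>\<^sup>a\<close> and \<open>T\<close> inside \<open>\<Delta>\<^sup>b\<close>, the join inside \<open>\<Delta>\<^sup>a \<star> \<Delta>\<^sup>b = \<Delta>\<^sup>a\<^sup>+\<^sup>b\<^sup>+\<^sup>1\<close>. The empty list
  is the augmentation, i.e. the absent part of a simplex lying in one of the two factors.\<close>

definition sjoin :: "nat \<Rightarrow> nat list set \<Rightarrow> nat list set \<Rightarrow> nat list set" where
  "sjoin a S T = {s @ map ((+) (Suc a)) t | s t. s \<in> insert [] S \<and> t \<in> insert [] T \<and> (s, t) \<noteq> ([], [])}"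

text \<open>The \<open>T\<close>-points of \<open>hom(S, X)\<close>: cones with apex \<open>T\<close> on the diagram of the simplices of \<open>S\<close>.\<close>

definition hom_pt ::
    "('o, 'm) cov_cat \<Rightarrow> ('o, 'm) sobj \<Rightarrow> nat list set \<Rightarrow> 'o \<Rightarrow> (nat list \<Rightarrow> 'm) \<Rightarrow> bool" where
  "hom_pt C X S T x \<longleftrightarrow>
     (\<forall>\<sigma>\<in>S. x \<sigma> \<in> hom C T (Ob X (dim \<sigma>))) \<and>
     (\<forall>\<sigma>\<in>S. \<forall>l. \<forall>\<alpha>\<in>mono_maps l (dim \<sigma>). x (mcomp \<sigma> \<alpha>) = Op X (dim \<sigma>) \<alpha> \<cdot>\<^bsub>C\<^esub> x \<sigma>)"

definition is_hom_obj ::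
    "('o, 'm) cov_cat \<Rightarrow> ('o, 'm) sobj \<Rightarrow> nat list set \<Rightarrow> 'o \<Rightarrow> (nat list \<Rightarrow> 'm) \<Rightarrow> bool" where
  "is_hom_obj C X S L u \<longleftrightarrow>
     L \<in> Obj C \<and> hom_pt C X S L u \<and>
     (\<forall>T\<in>Obj C. \<forall>x. hom_pt C X S T x \<longrightarrow>
        (\<exists>!h. h \<in> hom C T L \<and> (\<forall>\<sigma>\<in>S. u \<sigma> \<cdot>\<^bsub>C\<^esub> h = x \<sigma>)))"

text \<open>For \<open>S\<close> inside \<open>\<Delta>\<^sup>N\<close> and \<open>f : X \<rightarrow> Y\<close>, the \<open>T\<close>-points of
  \<open>hom(S, X) \<times>\<^bsub>hom(S, Y)\<^esub> Y\<^sub>N\<close>, and the object representing them as a single limit.\<close>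

definition rel_hom_pt ::
    "('o, 'm) cov_cat \<Rightarrow> ('o, 'm) sobj \<Rightarrow> ('o, 'm) sobj \<Rightarrow> (nat \<Rightarrow> 'm) \<Rightarrow> nat \<Rightarrow> nat list set \<Rightarrow>
     'o \<Rightarrow> (nat list \<Rightarrow> 'm) \<Rightarrow> 'm \<Rightarrow> bool" where
  "rel_hom_pt C X Y f N S T x y \<longleftrightarrow>
     hom_pt C X S T x \<and> y \<in> hom C T (Ob Y N) \<and>
     (\<forall>\<sigma>\<in>S. f (dim \<sigma>) \<cdot>\<^bsub>C\<^esub> x \<sigma> = Op Y N \<sigma> \<cdot>\<^bsub>C\<^esub> y)"

definition is_rel_hom_obj ::
    "('o, 'm) cov_cat \<Rightarrow> ('o, 'm) sobj \<Rightarrow> ('o, 'm) sobj \<Rightarrow> (nat \<Rightarrow> 'm) \<Rightarrow> nat \<Rightarrow> nat list set \<Rightarrow>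
     'o \<Rightarrow> (nat list \<Rightarrow> 'm) \<Rightarrow> 'm \<Rightarrow> bool" where
  "is_rel_hom_obj C X Y f N S L u v \<longleftrightarrow>
     L \<in> Obj C \<and> rel_hom_pt C X Y f N S L u v \<and>
     (\<forall>T\<in>Obj C. \<forall>x y. rel_hom_pt C X Y f N S T x y \<longrightarrow>
        (\<exists>!h. h \<in> hom C T L \<and> (\<forall>\<sigma>\<in>S. u \<sigma> \<cdot>\<^bsub>C\<^esub> h = x \<sigma>) \<and> v \<cdot>\<^bsub>C\<^esub> h = y))"

text \<open>The natural map \<open>X\<^sub>N \<rightarrow> hom(S, X) \<times>\<^bsub>hom(S, Y)\<^esub> Y\<^sub>N\<close>.\<close>

definition is_rel_restr ::
    "('o, 'm) cov_cat \<Rightarrow> ('o, 'm) sobj \<Rightarrow> (nat \<Rightarrow> 'm) \<Rightarrow> nat \<Rightarrow> nat list set \<Rightarrow>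
     'o \<Rightarrow> (nat list \<Rightarrow> 'm) \<Rightarrow> 'm \<Rightarrow> 'm \<Rightarrow> bool" where
  "is_rel_restr C X f N S L u v h \<longleftrightarrow>
     h \<in> hom C (Ob X N) L \<and> (\<forall>\<sigma>\<in>S. u \<sigma> \<cdot>\<^bsub>C\<^esub> h = Op X N \<sigma>) \<and> v \<cdot>\<^bsub>C\<^esub> h = f N"

section \<open>Lie groupoids, hypercovers, stacks\<close>

text \<open>For \<open>Y = *\<close> the limit \<open>hom(\<Lambda>, X) \<times>\<^bsub>hom(\<Lambda>, *)\<^esub> *\<close> is \<open>hom(\<Lambda>, X)\<close>.\<close>

definition lie_groupoid :: "('o, 'm) cov_cat \<Rightarrow> enat \<Rightarrow> ('o, 'm) sobj \<Rightarrow> bool" where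
  "lie_groupoid C m X \<longleftrightarrow>
     simplicial_object C X \<and>
     (\<forall>k>0. \<forall>i\<le>k. \<exists>L u h.
        is_hom_obj C X (horn k i) L u \<and>
        h \<in> hom C (Ob X k) L \<and> (\<forall>\<sigma>\<in>horn k i. u \<sigma> \<cdot>\<^bsub>C\<^esub> h = Op X k \<sigma>) \<and>
        h \<in> Cov C \<and> (enat k > m \<longrightarrow> is_iso C h))"

definition hypercover ::
    "('o, 'm) cov_cat \<Rightarrow> enat \<Rightarrow> ('o, 'm) sobj \<Rightarrow> ('o, 'm) sobj \<Rightarrow> (nat \<Rightarrow> 'm) \<Rightarrow> bool" where
  "hypercover C m X Y f \<longleftrightarrow>
     lie_groupoid C \<infinity> X \<and> lie_groupoid C \<infinity> Y \<and> simplicial_map C X Y f \<and>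
     (\<forall>k. \<exists>L u v h.
        is_rel_hom_obj C X Y f k (boundary k) L u v \<and>
        is_rel_restr C X f k (boundary k) L u v h \<and>
        h \<in> Cov C \<and> (enat k \<ge> m \<longrightarrow> is_iso C h))"

definition stack ::
    "('o, 'm) cov_cat \<Rightarrow> enat \<Rightarrow> ('o, 'm) sobj \<Rightarrow> ('o, 'm) sobj \<Rightarrow> (nat \<Rightarrow> 'm) \<Rightarrow> bool" where
  "stack C m X Y f \<longleftrightarrow>
     lie_groupoid C \<infinity> X \<and> lie_groupoid C \<infinity> Y \<and> simplicial_map C X Y f \<and>
     (\<forall>k>0. \<forall>i\<le>k. \<exists>L u v h.
        is_rel_hom_obj C X Y f k (horn k i) L u v \<and>
        is_rel_restr C X f k (horn k i) L u v h \<and>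
        h \<in> Cov C \<and> (enat k > m \<longrightarrow> is_iso C h))"

text \<open>\<open>pr1 k\<close>, \<open>pr2 k\<close> are the projections of \<open>X\<^sub>k \<times> Y\<^sub>k\<close>; the compatibilities of \<open>\<phi>\<close> with
  \<open>d\<^sub>i \<times> d\<^sub>i\<close> and \<open>s\<^sub>i \<times> s\<^sub>i\<close> are stated componentwise. The last face \<open>d\<^sub>k\<close> is deliberately
  unconstrained.\<close>

definition twisted_cartesian_product ::
    "('o, 'm) cov_cat \<Rightarrow> ('o, 'm) sobj \<Rightarrow> ('o, 'm) sobj \<Rightarrow> (nat \<Rightarrow> 'm) \<Rightarrow> bool" where
  "twisted_cartesian_product C E X p \<longleftrightarrow>
     simplicial_map C E X p \<and>
     (\<exists>Y Q pr1 pr2 \<phi>.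
        simplicial_object C Y \<and>
        (\<forall>k. is_product C (Ob X k) (Ob Y k) (Q k) (pr1 k) (pr2 k)) \<and>
        (\<forall>k. \<phi> k \<in> hom C (Ob E k) (Q k) \<and> is_iso C (\<phi> k) \<and> pr1 k \<cdot>\<^bsub>C\<^esub> \<phi> k = p k) \<and>
        (\<forall>k. \<forall>i<k.
           pr1 (k - 1) \<cdot>\<^bsub>C\<^esub> \<phi> (k - 1) \<cdot>\<^bsub>C\<^esub> face E k i = face X k i \<cdot>\<^bsub>C\<^esub> pr1 k \<cdot>\<^bsub>C\<^esub> \<phi> k \<and>
           pr2 (k - 1) \<cdot>\<^bsub>C\<^esub> \<phi> (k - 1) \<cdot>\<^bsub>C\<^esub> face E k i = face Y k i \<cdot>\<^bsub>C\<^esub> pr2 k \<cdot>\<^bsub>C\<^esub> \<phi> k) \<and>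
        (\<forall>k. \<forall>i\<le>k.
           pr1 (Suc k) \<cdot>\<^bsub>C\<^esub> \<phi> (Suc k) \<cdot>\<^bsub>C\<^esub> degen E k i = degen X k i \<cdot>\<^bsub>C\<^esub> pr1 k \<cdot>\<^bsub>C\<^esub> \<phi> k \<and>
           pr2 (Suc k) \<cdot>\<^bsub>C\<^esub> \<phi> (Suc k) \<cdot>\<^bsub>C\<^esub> degen E k i = degen Y k i \<cdot>\<^bsub>C\<^esub> pr2 k \<cdot>\<^bsub>C\<^esub> \<phi> k))"

definition local_bundle ::
    "('o, 'm) cov_cat \<Rightarrow> nat \<Rightarrow> ('o, 'm) sobj \<Rightarrow> ('o, 'm) sobj \<Rightarrow> (nat \<Rightarrow> 'm) \<Rightarrow> bool" where
  "local_bundle C n E X p \<longleftrightarrow> twisted_cartesian_product C E X p \<and> stack C (enat n) E X p"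

section \<open>Orbit spaces and Godement's theorem\<close>

definition is_orbit_space :: "('o, 'm) cov_cat \<Rightarrow> ('o, 'm) sobj \<Rightarrow> 'm \<Rightarrow> bool" where
  "is_orbit_space C Z q \<longleftrightarrow>
     lie_groupoid C \<infinity> Z \<and> q \<in> Cov C \<and> is_coequalizer C (face Z 1 0) (face Z 1 1) q"

text \<open>Graphs are formed with respect to an arbitrary choice of product.\<close>

inductive regular_embedding :: "('o, 'm) cov_cat \<Rightarrow> 'm \<Rightarrow> bool" for C :: "('o, 'm) cov_cat" where
  graph: "\<lbrakk>h \<in> hom C a b; is_product C a b P p q; \<gamma> \<in> hom C a P;
           p \<cdot>\<^bsub>C\<^esub> \<gamma> = Id C a; q \<cdot>\<^bsub>C\<^esub> \<gamma> = h\<rbrakk> \<Longrightarrow> regular_embedding C \<gamma>"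
| ident: "a \<in> Obj C \<Longrightarrow> regular_embedding C (Id C a)"
| comp: "\<lbrakk>regular_embedding C f; regular_embedding C g; Cod C f = Dom C g\<rbrakk>
           \<Longrightarrow> regular_embedding C (g \<cdot>\<^bsub>C\<^esub> f)"
| pullback: "\<lbrakk>regular_embedding C f; g \<in> Cov C; is_pullback C f g p q\<rbrakk> \<Longrightarrow> regular_embedding C q"

definition regular :: "('o, 'm) cov_cat \<Rightarrow> ('o, 'm) sobj \<Rightarrow> bool" where
  "regular C Z \<longleftrightarrow>
     (\<exists>P p q \<mu>. is_product C (Ob Z 0) (Ob Z 0) P p q \<and> \<mu> \<in> hom C (Ob Z 1) P \<and>
        p \<cdot>\<^bsub>C\<^esub> \<mu> = face Z 1 0 \<and> q \<cdot>\<^bsub>C\<^esub> \<mu> = face Z 1 1 \<and> regular_embedding C \<mu>)"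

definition godement :: "('o, 'm) cov_cat \<Rightarrow> bool" where
  "godement C \<longleftrightarrow> (\<forall>m Z. lie_groupoid C m Z \<and> regular C Z \<longrightarrow> (\<exists>q. is_orbit_space C Z q))"

section \<open>Higher morphism spaces and strictification\<close>

text \<open>The operator \<open>id \<star> \<alpha> : \<Delta>\<^sup>k\<^sup>-\<^sup>1 \<star> \<Delta>\<^sup>l \<rightarrow> \<Delta>\<^sup>k\<^sup>-\<^sup>1 \<star> \<Delta>\<^sup>m\<close> for \<open>\<alpha> : [l] \<rightarrow> [m]\<close>.\<close>

definition id_join :: "nat \<Rightarrow> nat list \<Rightarrow> nat list" where
  "id_join k \<alpha> = [0..<k] @ map ((+) k) \<alpha>"

text \<open>\<open>X\<close> raised to \<open>\<Delta>\<^sup>k\<^sup>-\<^sup>1 \<star>\<close>, whose \<open>l\<close>-simplices are \<open>hom(\<Delta>\<^sup>k\<^sup>-\<^sup>1 \<star> \<Delta>\<^sup>l, X) = X\<^sub>k\<^sub>+\<^sub>l\<close>.\<close>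

definition simplex_slice :: "nat \<Rightarrow> ('o, 'm) sobj \<Rightarrow> ('o, 'm) sobj" where
  "simplex_slice k X = \<lparr>Ob = \<lambda>l. Ob X (k + l), Op = \<lambda>m \<alpha>. Op X (k + m) (id_join k \<alpha>)\<rparr>"

definition bdry_join :: "nat \<Rightarrow> nat \<Rightarrow> nat list set" where
  "bdry_join k l = sjoin (k - 1) (boundary (k - 1)) (simplex l)"

text \<open>The simplicial object
  \<open>B = X\<^bsup>\<partial>\<Delta>\<^sup>k\<^sup>-\<^sup>1 \<star>\<^esup> \<times> Y\<^bsup>\<Delta>\<^sup>k\<^sup>-\<^sup>1 \<star>\<^esup>\<close>, the product being over \<open>Y\<^bsup>\<partial>\<Delta>\<^sup>k\<^sup>-\<^sup>1 \<star>\<^esup>\<close>, for \<open>k > 0\<close>, with the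
  universal points \<open>u l\<close>, \<open>v l\<close> of its degree \<open>l\<close> part; an operator \<open>\<alpha>\<close> acts by precomposition
  with \<open>id \<star> \<alpha>\<close>.\<close>

definition is_bdry_slice ::
    "('o, 'm) cov_cat \<Rightarrow> nat \<Rightarrow> ('o, 'm) sobj \<Rightarrow> ('o, 'm) sobj \<Rightarrow> (nat \<Rightarrow> 'm) \<Rightarrow>
     ('o, 'm) sobj \<Rightarrow> (nat \<Rightarrow> nat list \<Rightarrow> 'm) \<Rightarrow> (nat \<Rightarrow> 'm) \<Rightarrow> bool" where
  "is_bdry_slice C k X Y g B u v \<longleftrightarrow>
     simplicial_object C B \<and>
     (\<forall>l. is_rel_hom_obj C X Y g (k + l) (bdry_join k l) (Ob B l) (u l) (v l)) \<and>
     (\<forall>l m. \<forall>\<alpha>\<in>mono_maps l m.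
        (\<forall>\<sigma>\<in>bdry_join k l. u l \<sigma> \<cdot>\<^bsub>C\<^esub> Op B m \<alpha> = u m (mcomp (id_join k \<alpha>) \<sigma>)) \<and>
        v l \<cdot>\<^bsub>C\<^esub> Op B m \<alpha> = Op Y (k + m) (id_join k \<alpha>) \<cdot>\<^bsub>C\<^esub> v m)"

text \<open>\<open>Z\<close> is the higher morphism space of \<open>g\<close> in degrees at least \<open>k\<close>. For \<open>k > 0\<close>, the object
  \<open>Ob B 0\<close> represents \<open>\<Lambda>\<^sup>k\<^sub>k(g)\<close>, since \<open>bdry_join k 0 = horn k k\<close>.\<close>

definition is_higher_mor ::
    "('o, 'm) cov_cat \<Rightarrow> nat \<Rightarrow> ('o, 'm) sobj \<Rightarrow> ('o, 'm) sobj \<Rightarrow> (nat \<Rightarrow> 'm) \<Rightarrow> ('o, 'm) sobj \<Rightarrow> bool" where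
  "is_higher_mor C k X Y g Z \<longleftrightarrow>
     (if k = 0 then
        (\<exists>i b. is_simplicial_pullback C X (const_sobj C (Ob Y 0)) Y g (vertex_incl Y) Z i b)
      else
        (\<exists>B u v r i b.
           is_bdry_slice C k X Y g B u v \<and>
           (\<forall>l. is_rel_restr C X g (k + l) (bdry_join k l) (Ob B l) (u l) (v l) (r l)) \<and>
           is_simplicial_pullback C (simplex_slice k X) (const_sobj C (Ob B 0)) B r (vertex_incl B) Z i b))"

text \<open>By definition, the \<open>n\<close>-strictification of an \<open>\<infinity>\<close>-stack \<open>g\<close> exists when the orbit space of its
  higher morphism space in degrees at least \<open>n\<close> exists. It is formed from the quotient map \<open>q\<close>.\<close>

definition strictification_exists ::
    "('o, 'm) cov_cat \<Rightarrow> nat \<Rightarrow> ('o, 'm) sobj \<Rightarrow> ('o, 'm) sobj \<Rightarrow> (nat \<Rightarrow> 'm) \<Rightarrow> bool" where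
  "strictification_exists C n X Y g \<longleftrightarrow>
     stack C \<infinity> X Y g \<and> (\<exists>Z q. is_higher_mor C n X Y g Z \<and> is_orbit_space C Z q)"

end

theory Submission
  imports Defs
begin

text \<open>Write \<open>g = f p\<close>. The strictification exists once the higher morphism space \<open>Z\<close> of \<open>g\<close> exists, is a Lie
  groupoid and is regular, because Godement's theorem then provides its orbit space.

  Existence and the Lie condition come from one statement about \<open>g\<close>: for every horn, including the
  empty horn of a vertex, the map from \<open>k\<close>-simplices of \<open>E\<close> to the relative horn object is a cover. Such
  maps are called fibrations here. Hypercovers are fibrations, since a horn becomes a boundary by gluing
  in the missing face; \<open>p\<close> is one, since \<open>p\<^sub>0\<close> is the projection of a product; and fibrations compose.
  If \<open>K \<subseteq> K'\<close> are subcomplexes of a simplex and the faces of \<open>K'\<close> outside \<open>K\<close> are paired off by adding or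
  removing a fixed vertex, then \<open>K'\<close> arises from \<open>K\<close> by gluing simplices along horns, so restriction from
  \<open>K'\<close> to \<open>K\<close> is a representable cover (\<open>extends_collapse\<close>). This is formulated with functors of points, as
  the limits involved are not known to exist beforehand; their existence is a consequence. All joins that
  occur in the definition of \<open>Z\<close> are handled by a suitable vertex. For the Lie condition one observes that
  a horn \<open>\<Lambda>\<^sup>m\<^sub>j \<rightarrow> Z\<close> is the same thing as a relative horn \<open>\<Lambda>\<^sup>n\<^sup>+\<^sup>m\<^sub>n\<^sub>+\<^sub>j\<close> in \<open>E\<close> whose restriction to the part
  prescribed by the vertex of \<open>B\<close> is degenerate (\<open>horn_point\<close>), and that filling one is filling the other
  (\<open>horn_restriction_cover\<close>).

  Regularity uses the truncation conditions and the product structure of the bundle. Let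
  \<open>h : U\<^sub>n \<rightarrow> M\<^sub>n(f)\<close> be the matching cover. An element of \<open>Z\<^sub>1\<close> is a simplex \<open>e \<in> E\<^sub>n\<^sub>+\<^sub>1\<close> with degenerate image
  in \<open>X\<close> whose faces are prescribed degenerate simplices, apart from \<open>e\<^sub>0 = d\<^sub>n e\<close> and \<open>e\<^sub>1 = d\<^sub>n\<^sub>+\<^sub>1 e\<close>. In degree \<open>n + 1\<close> the
  hypercover determines \<open>p(e)\<close> by its boundary and the \<open>n\<close>-stack \<open>p\<close> determines \<open>e\<close> by \<open>p(e)\<close> and a horn, so
  \<open>e\<close> is determined by \<open>e\<^sub>1\<close> and \<open>p(e\<^sub>0)\<close>, which may be any pair with the same image in \<open>M\<^sub>n(f)\<close>. Hence
  \<open>Z\<^sub>1 = E\<^sub>n \<times> U\<^sub>n\<close>, the product being over \<open>M\<^sub>n(f)\<close> (\<open>mor_space_pullback\<close>). As \<open>E\<^sub>n\<close> is a product \<open>U\<^sub>n \<times> F\<close>,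
  the map \<open>(d\<^sub>0, d\<^sub>1) : Z\<^sub>1 \<rightarrow> E\<^sub>n \<times> E\<^sub>n = (U\<^sub>n \<times> E\<^sub>n) \<times> F\<close> is the graph of a map \<open>Z\<^sub>1 \<rightarrow> F\<close> followed by a pullback
  of \<open>Z\<^sub>1 \<rightarrow> U\<^sub>n \<times> E\<^sub>n\<close>, and the latter is a pullback of the diagonal of \<open>M\<^sub>n(f)\<close> along a cover
  (\<open>regular_embedding_of_pullback\<close>).\<close>

section \<open>Categories with covers\<close>

locale covers =
  fixes C :: "('o, 'm) cov_cat" (structure)
  assumes cwc: "category_with_covers C"
begin

lemma cat: "category C" using cwc by (simp add: category_with_covers_def)

lemma hom_iff [simp]: "f \<in> hom C a b \<longleftrightarrow> f \<in> Arr C \<and> Dom C f = a \<and> Cod C f = b"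
  by (simp add: hom_def)

lemma Dom_Obj [simp]: "f \<in> Arr C \<Longrightarrow> Dom C f \<in> Obj C"
  and Cod_Obj [simp]: "f \<in> Arr C \<Longrightarrow> Cod C f \<in> Obj C"
  using cat by (simp_all add: category_def)

lemma Id_simps [simp]:
  assumes "a \<in> Obj C"
  shows "Id C a \<in> Arr C" "Dom C (Id C a) = a" "Cod C (Id C a) = a"
  using cat assms by (simp_all add: category_def)

lemma comp_simps [simp]:
  assumes "f \<in> Arr C" "g \<in> Arr C" "Cod C f = Dom C g"
  shows "g \<cdot> f \<in> Arr C" "Dom C (g \<cdot> f) = Dom C f" "Cod C (g \<cdot> f) = Cod C g"
  using cat assms by (simp_all add: category_def)

lemma comp_Id [simp]: "f \<in> Arr C \<Longrightarrow> Dom C f = a \<Longrightarrow> f \<cdot> Id C a = f"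
  and Id_comp [simp]: "f \<in> Arr C \<Longrightarrow> Cod C f = a \<Longrightarrow> Id C a \<cdot> f = f"
  using cat by (auto simp add: category_def)

lemma assoc [simp]:
  assumes "f \<in> Arr C" "g \<in> Arr C" "h \<in> Arr C" "Cod C f = Dom C g" "Cod C g = Dom C h"
  shows "(h \<cdot> g) \<cdot> f = h \<cdot> g \<cdot> f"
  using cat assms by (simp add: category_def)

text \<open>Composites are kept associated to the right. In this form an equation \<open>g \<cdot> f = k\<close> applies to the head of
  a longer composite.\<close>

lemma comp_reduce:
  assumes "g \<cdot> f = k" "f \<in> Arr C" "g \<in> Arr C" "Cod C f = Dom C g" "x \<in> Arr C" "Cod C x = Dom C f"
  shows "g \<cdot> f \<cdot> x = k \<cdot> x"
  using assms assoc[of x f g] by simp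

lemma Cov_Arr [simp]: "f \<in> Cov C \<Longrightarrow> f \<in> Arr C"
  using cwc by (auto simp add: category_with_covers_def)

lemma Id_Cov [simp]: "a \<in> Obj C \<Longrightarrow> Id C a \<in> Cov C"
proof -
  have "\<forall>a\<in>Obj C. Id C a \<in> Cov C"
    using cwc unfolding category_with_covers_def by (elim conjE)
  then show "a \<in> Obj C \<Longrightarrow> Id C a \<in> Cov C" by blast
qed

lemma comp_Cov:
  assumes "f \<in> Cov C" "g \<in> Cov C" "Cod C f = Dom C g"
  shows "g \<cdot> f \<in> Cov C"
proof -
  have "\<forall>f\<in>Cov C. \<forall>g\<in>Cov C. Cod C f = Dom C g \<longrightarrow> g \<cdot> f \<in> Cov C"
    using cwc unfolding category_with_covers_def by (elim conjE)
  with assms show ?thesis by blast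
qed

lemma terminal_ex: "\<exists>t. is_terminal C t \<and> (\<forall>a\<in>Obj C. hom C a t \<subseteq> Cov C)"
  using cwc unfolding category_with_covers_def by (elim conjE)

lemma pullback_axiom: "\<forall>f\<in>Cov C. \<forall>g\<in>Arr C. Cod C g = Cod C f \<longrightarrow>
        (\<exists>p q. is_pullback C f g p q) \<and> (\<forall>p q. is_pullback C f g p q \<longrightarrow> q \<in> Cov C)"
  using cwc unfolding category_with_covers_def by (elim conjE)

lemma pullback_ex:
  assumes "f \<in> Cov C" "g \<in> Arr C" "Cod C g = Cod C f"
  obtains p q where "is_pullback C f g p q"
proof -
  have "\<exists>p q. is_pullback C f g p q"
    using pullback_axiom assms by blast
  with that show ?thesis by blast
qed

lemma pullback_Cov:
  assumes "f \<in> Cov C" "is_pullback C f g p q"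
  shows "q \<in> Cov C"
proof -
  have "g \<in> Arr C" "Cod C g = Cod C f" using assms(2) by (auto simp: is_pullback_def)
  with assms pullback_axiom show ?thesis by blast
qed

lemma pullbackD:
  assumes "is_pullback C f g p q"
  shows "f \<in> Arr C" "g \<in> Arr C" "Cod C f = Cod C g" "p \<in> Arr C" "q \<in> Arr C"
    "Dom C q = Dom C p" "Cod C p = Dom C f" "Cod C q = Dom C g" "f \<cdot> p = g \<cdot> q"
  using assms by (simp_all add: is_pullback_def)

lemma pullback_lift:
  assumes "is_pullback C f g p q" "x \<in> Arr C" "y \<in> Arr C" "Cod C x = Dom C f" "Cod C y = Dom C g"
    "Dom C x = Dom C y" "f \<cdot> x = g \<cdot> y"
  obtains h where "h \<in> Arr C" "Dom C h = Dom C x" "Cod C h = Dom C p" "p \<cdot> h = x" "q \<cdot> h = y"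
proof -
  have "\<exists>!h. h \<in> hom C (Dom C x) (Dom C p) \<and> p \<cdot> h = x \<and> q \<cdot> h = y"
    using assms unfolding is_pullback_def by simp
  with that show ?thesis by auto
qed

lemma pullback_eq:
  assumes "is_pullback C f g p q" "h \<in> Arr C" "h' \<in> Arr C" "Cod C h = Dom C p" "Cod C h' = Dom C p"
    "Dom C h = Dom C h'" "p \<cdot> h = p \<cdot> h'" "q \<cdot> h = q \<cdot> h'"
  shows "h = h'"
proof -
  note D = pullbackD[OF assms(1)]
  have "\<exists>!k. k \<in> hom C (Dom C h) (Dom C p) \<and> p \<cdot> k = p \<cdot> h \<and> q \<cdot> k = q \<cdot> h"
    using assms D comp_reduce[OF D(9)] unfolding is_pullback_def by simp
  with assms show ?thesis by auto
qed

text \<open>Uniqueness in the universal property is stated as joint monicity of the two projections, which is the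
  form in which it is established for limits.\<close>

lemma pullbackI:
  assumes "f \<in> Arr C" "g \<in> Arr C" "Cod C f = Cod C g" "p \<in> Arr C" "q \<in> Arr C"
    "Dom C q = Dom C p" "Cod C p = Dom C f" "Cod C q = Dom C g" "f \<cdot> p = g \<cdot> q"
    and ex: "\<And>x y. \<lbrakk>x \<in> Arr C; y \<in> Arr C; Dom C x = Dom C y; Cod C x = Dom C f; Cod C y = Dom C g; f \<cdot> x = g \<cdot> y\<rbrakk>
       \<Longrightarrow> \<exists>h. h \<in> Arr C \<and> Dom C h = Dom C y \<and> Cod C h = Dom C p \<and> p \<cdot> h = x \<and> q \<cdot> h = y"
    and un: "\<And>h h'. \<lbrakk>h \<in> Arr C; h' \<in> Arr C; Dom C h = Dom C h'; Cod C h = Dom C p; Cod C h' = Dom C p;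
       p \<cdot> h = p \<cdot> h'; q \<cdot> h = q \<cdot> h'\<rbrakk> \<Longrightarrow> h = h'"
  shows "is_pullback C f g p q"
  unfolding is_pullback_def
proof (intro conjI ballI impI)
  fix t x y assume a: "t \<in> Obj C" "x \<in> hom C t (Dom C f)" "y \<in> hom C t (Dom C g)" "f \<cdot> x = g \<cdot> y"
  then obtain h where "h \<in> Arr C" "Dom C h = t" "Cod C h = Dom C p" "p \<cdot> h = x" "q \<cdot> h = y"
    using ex[of x y] by auto
  then show "\<exists>!h. h \<in> hom C t (Dom C p) \<and> p \<cdot> h = x \<and> q \<cdot> h = y"
    by (intro ex1I[of _ h]) (auto intro!: un)
qed (use assms in simp_all)

lemma productD:
  assumes "is_product C a b P p q"
  shows "p \<in> Arr C" "q \<in> Arr C" "Dom C p = P" "Dom C q = P" "Cod C p = a" "Cod C q = b"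
    "a \<in> Obj C" "b \<in> Obj C" "P \<in> Obj C"
  using assms unfolding is_product_def by auto

lemma product_lift:
  assumes "is_product C a b P p q" "x \<in> Arr C" "y \<in> Arr C" "Cod C x = a" "Cod C y = b"
    "Dom C x = Dom C y"
  obtains h where "h \<in> Arr C" "Dom C h = Dom C x" "Cod C h = P" "p \<cdot> h = x" "q \<cdot> h = y"
proof -
  have "\<exists>!h. h \<in> hom C (Dom C x) P \<and> p \<cdot> h = x \<and> q \<cdot> h = y"
    using assms unfolding is_product_def by simp
  with that show ?thesis by auto
qed

lemma product_eq:
  assumes "is_product C a b P p q" "h \<in> Arr C" "h' \<in> Arr C" "Cod C h = P" "Cod C h' = P"
    "Dom C h = Dom C h'" "p \<cdot> h = p \<cdot> h'" "q \<cdot> h = q \<cdot> h'"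
  shows "h = h'"
proof -
  note D = productD[OF assms(1)]
  have "\<exists>!k. k \<in> hom C (Dom C h) P \<and> p \<cdot> k = p \<cdot> h \<and> q \<cdot> k = q \<cdot> h"
    using assms D unfolding is_product_def by simp
  with assms show ?thesis by auto
qed

lemma productI:
  assumes "p \<in> Arr C" "q \<in> Arr C" "Dom C p = P" "Dom C q = P" "Cod C p = a" "Cod C q = b"
    and ex: "\<And>x y. \<lbrakk>x \<in> Arr C; y \<in> Arr C; Dom C x = Dom C y; Cod C x = a; Cod C y = b\<rbrakk>
       \<Longrightarrow> \<exists>h. h \<in> Arr C \<and> Dom C h = Dom C y \<and> Cod C h = P \<and> p \<cdot> h = x \<and> q \<cdot> h = y"
    and un: "\<And>h h'. \<lbrakk>h \<in> Arr C; h' \<in> Arr C; Dom C h = Dom C h'; Cod C h = P; Cod C h' = P;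
       p \<cdot> h = p \<cdot> h'; q \<cdot> h = q \<cdot> h'\<rbrakk> \<Longrightarrow> h = h'"
  shows "is_product C a b P p q"
  unfolding is_product_def
proof (intro conjI ballI)
  fix t x y assume a: "t \<in> Obj C" "x \<in> hom C t a" "y \<in> hom C t b"
  then obtain h where "h \<in> Arr C" "Dom C h = t" "Cod C h = P" "p \<cdot> h = x" "q \<cdot> h = y"
    using ex[of x y] by auto
  then show "\<exists>!h. h \<in> hom C t P \<and> p \<cdot> h = x \<and> q \<cdot> h = y"
    by (intro ex1I[of _ h]) (auto intro!: un)
qed (use assms in simp_all)

text \<open>An isomorphism is a pullback of the identity of its codomain along that same identity.\<close>

lemma iso_Cov:
  assumes "s \<in> Arr C" "w \<in> Arr C" "Dom C w = Cod C s" "Cod C w = Dom C s"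
    "w \<cdot> s = Id C (Dom C s)" "s \<cdot> w = Id C (Cod C s)"
  shows "s \<in> Cov C"
proof -
  have "is_pullback C (Id C (Cod C s)) (Id C (Cod C s)) s s"
  proof (rule pullbackI)
    fix x y assume "x \<in> Arr C" "y \<in> Arr C" "Dom C x = Dom C y" "Cod C x = Dom C (Id C (Cod C s))"
      "Id C (Cod C s) \<cdot> x = Id C (Cod C s) \<cdot> y"
      "Cod C y = Dom C (Id C (Cod C s))"
    then show "\<exists>h. h \<in> Arr C \<and> Dom C h = Dom C y \<and> Cod C h = Dom C s \<and> s \<cdot> h = x \<and> s \<cdot> h = y"
      using assms comp_reduce[OF assms(6)] by (intro exI[of _ "w \<cdot> x"]) simp
  next
    fix h h' assume a: "h \<in> Arr C" "h' \<in> Arr C" "Cod C h = Dom C s" "Cod C h' = Dom C s" "s \<cdot> h = s \<cdot> h'"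
    have "w \<cdot> s \<cdot> h = w \<cdot> s \<cdot> h'" using a(5) by simp
    then show "h = h'" using a(1-4) assms by (simp add: comp_reduce[OF assms(5)])
  qed (use assms in simp_all)
  then show ?thesis using pullback_Cov[of "Id C (Cod C s)"] assms by simp
qed

lemma terminal_cover:
  obtains t where "\<And>a. a \<in> Obj C \<Longrightarrow> \<exists>x. x \<in> Cov C \<and> Dom C x = a \<and> Cod C x = t"
    and "\<And>f g. \<lbrakk>f \<in> Arr C; g \<in> Arr C; Dom C f = Dom C g; Cod C f = t; Cod C g = t\<rbrakk> \<Longrightarrow> f = g"
proof -
  obtain t where t: "is_terminal C t" "\<forall>a\<in>Obj C. hom C a t \<subseteq> Cov C" using terminal_ex by blast
  have u: "\<exists>!x. x \<in> hom C a t" if "a \<in> Obj C" for a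
    using t(1) that unfolding is_terminal_def by blast
  show ?thesis
  proof (rule that[of t])
    fix a assume a: "a \<in> Obj C"
    then obtain x where x: "x \<in> hom C a t" using u by blast
    then have "x \<in> Cov C" using t(2) a by blast
    with x show "\<exists>x. x \<in> Cov C \<and> Dom C x = a \<and> Cod C x = t" by auto
  next
    fix f g assume fg: "f \<in> Arr C" "g \<in> Arr C" "Dom C f = Dom C g" "Cod C f = t" "Cod C g = t"
    then have "f \<in> hom C (Dom C f) t" "g \<in> hom C (Dom C f) t" by simp_all
    then show "f = g" using u[OF Dom_Obj[OF fg(1)]] by blast
  qed
qed

text \<open>Products are pullbacks over the terminal object, and every map to the terminal object is a cover.\<close>

lemma product_ex:
  assumes "a \<in> Obj C" "b \<in> Obj C"
  obtains P p q where "is_product C a b P p q"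
proof -
  obtain t where t: "\<And>a. a \<in> Obj C \<Longrightarrow> \<exists>x. x \<in> Cov C \<and> Dom C x = a \<and> Cod C x = t"
    and tu: "\<And>f g. \<lbrakk>f \<in> Arr C; g \<in> Arr C; Dom C f = Dom C g; Cod C f = t; Cod C g = t\<rbrakk> \<Longrightarrow> f = g"
    using terminal_cover by metis
  obtain x where x: "x \<in> Cov C" "Dom C x = a" "Cod C x = t" using t[OF assms(1)] by blast
  obtain y where y: "y \<in> Cov C" "Dom C y = b" "Cod C y = t" using t[OF assms(2)] by blast
  obtain p q where pb: "is_pullback C x y p q"
    using pullback_ex[of x y] x y by auto
  note D = pullbackD[OF pb]
  have "is_product C a b (Dom C p) p q"
  proof (rule productI)
    fix f g assume fg: "f \<in> Arr C" "g \<in> Arr C" "Dom C f = Dom C g" "Cod C f = a" "Cod C g = b"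
    have "x \<cdot> f = y \<cdot> g" by (rule tu) (use fg x y in simp_all)
    then obtain h where "h \<in> Arr C" "Dom C h = Dom C f" "Cod C h = Dom C p" "p \<cdot> h = f" "q \<cdot> h = g"
      using pullback_lift[OF pb, of f g] fg x y by auto
    then show "\<exists>h. h \<in> Arr C \<and> Dom C h = Dom C g \<and> Cod C h = Dom C p \<and> p \<cdot> h = f \<and> q \<cdot> h = g"
      using fg by auto
  next
    fix h h' assume "h \<in> Arr C" "h' \<in> Arr C" "Dom C h = Dom C h'" "Cod C h = Dom C p"
      "Cod C h' = Dom C p" "p \<cdot> h = p \<cdot> h'" "q \<cdot> h = q \<cdot> h'"
    then show "h = h'" by - (rule pullback_eq[OF pb]; simp)
  qed (use D x y in auto)
  with that show ?thesis by blast
qed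

lemma product_proj_Cov:
  assumes "is_product C a b P p q"
  shows "p \<in> Cov C"
proof -
  note D = productD[OF assms]
  obtain t where t: "\<And>a. a \<in> Obj C \<Longrightarrow> \<exists>x. x \<in> Cov C \<and> Dom C x = a \<and> Cod C x = t"
    and tu: "\<And>f g. \<lbrakk>f \<in> Arr C; g \<in> Arr C; Dom C f = Dom C g; Cod C f = t; Cod C g = t\<rbrakk> \<Longrightarrow> f = g"
    using terminal_cover by metis
  obtain x where x: "x \<in> Cov C" "Dom C x = a" "Cod C x = t" using t[OF D(7)] by blast
  obtain y where y: "y \<in> Cov C" "Dom C y = b" "Cod C y = t" using t[OF D(8)] by blast
  have "is_pullback C y x q p"
  proof (rule pullbackI)
    show "y \<cdot> q = x \<cdot> p" by (rule tu) (use D x y in auto)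
    fix f g assume fg: "f \<in> Arr C" "g \<in> Arr C" "Dom C f = Dom C g" "Cod C f = Dom C y" "Cod C g = Dom C x"
    obtain h where "h \<in> Arr C" "Dom C h = Dom C g" "Cod C h = P" "p \<cdot> h = g" "q \<cdot> h = f"
      by (rule product_lift[OF assms, of g f]) (use fg D x y in auto)
    then show "\<exists>h. h \<in> Arr C \<and> Dom C h = Dom C g \<and> Cod C h = Dom C q \<and> q \<cdot> h = f \<and> p \<cdot> h = g"
      using D by auto
  next
    fix h h' assume "h \<in> Arr C" "h' \<in> Arr C" "Dom C h = Dom C h'" "Cod C h = Dom C q"
      "Cod C h' = Dom C q" "q \<cdot> h = q \<cdot> h'" "p \<cdot> h = p \<cdot> h'"
    then show "h = h'" using D by - (rule product_eq[OF assms]; simp)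
  qed (use D x y in auto)
  then show ?thesis using pullback_Cov y by blast
qed

end

section \<open>Simplices of standard simplices\<close>

lemma simplex_iff: "\<sigma> \<in> simplex N \<longleftrightarrow> \<sigma> \<noteq> [] \<and> sorted \<sigma> \<and> set \<sigma> \<subseteq> {0..N}"
  unfolding simplex_def mono_maps_def by (cases \<sigma>) auto

lemma mono_maps_iff: "\<alpha> \<in> mono_maps l m \<longleftrightarrow> \<alpha> \<in> simplex m \<and> dim \<alpha> = l"
  unfolding simplex_iff mono_maps_def by (cases \<alpha>) auto

lemma simplex_length: "\<sigma> \<in> simplex N \<Longrightarrow> length \<sigma> = Suc (dim \<sigma>)"
  by (cases \<sigma>) (auto simp: simplex_iff)

lemma length_mcomp [simp]: "length (mcomp \<beta> \<alpha>) = length \<alpha>"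
  by (simp add: mcomp_def)

lemma set_mcomp: "set (mcomp \<sigma> \<alpha>) = (!) \<sigma> ` set \<alpha>"
  by (simp add: mcomp_def)

lemma simplex_nth_less: "\<sigma> \<in> simplex N \<Longrightarrow> \<alpha> \<in> simplex (dim \<sigma>) \<Longrightarrow> a \<in> set \<alpha> \<Longrightarrow> a < length \<sigma>"
  using simplex_length[of \<sigma> N] by (fastforce simp: simplex_iff[of \<alpha>])

lemma set_mcomp_subset: "\<sigma> \<in> simplex N \<Longrightarrow> \<alpha> \<in> simplex (dim \<sigma>) \<Longrightarrow> set (mcomp \<sigma> \<alpha>) \<subseteq> set \<sigma>"
  using simplex_nth_less by (fastforce simp: set_mcomp)

lemma mcomp_simplex [simp]:
  assumes "\<sigma> \<in> simplex N" "\<alpha> \<in> simplex (dim \<sigma>)"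
  shows "mcomp \<sigma> \<alpha> \<in> simplex N"
proof -
  have "sorted (mcomp \<sigma> \<alpha>)"
    unfolding mcomp_def sorted_map
    using assms simplex_nth_less[OF assms]
    by (auto simp: simplex_iff sorted_nth_mono intro!: sorted_wrt_mono_rel[of _ "(\<le>)" "\<lambda>x y. \<sigma> ! x \<le> \<sigma> ! y"])
  then show ?thesis using assms set_mcomp_subset[OF assms]
    by (auto simp: simplex_iff mcomp_def)
qed

lemma mcomp_assoc:
  assumes "\<beta> \<in> simplex (dim \<sigma>)" "\<alpha> \<in> simplex (dim \<beta>)"
  shows "mcomp (mcomp \<sigma> \<beta>) \<alpha> = mcomp \<sigma> (mcomp \<beta> \<alpha>)"
  using simplex_nth_less[OF assms] by (auto simp: mcomp_def)

lemma id_simplex [simp]: "[0..<Suc N] \<in> simplex N"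
  by (auto simp: simplex_iff simp del: upt_Suc)

lemma mcomp_id_right: "\<sigma> \<in> simplex N \<Longrightarrow> mcomp \<sigma> [0..<Suc (dim \<sigma>)] = \<sigma>"
  using simplex_length[of \<sigma> N] by (simp add: mcomp_def map_nth del: upt_Suc)

lemma mcomp_id_left: "\<sigma> \<in> simplex N \<Longrightarrow> mcomp [0..<Suc N] \<sigma> = \<sigma>"
  unfolding mcomp_def simplex_iff by (intro map_idI) (auto simp del: upt_Suc)

lemma mcomp_inj:
  assumes "distinct \<sigma>" "\<sigma> \<in> simplex N" "\<alpha> \<in> simplex (dim \<sigma>)" "\<beta> \<in> simplex (dim \<sigma>)"
    "mcomp \<sigma> \<alpha> = mcomp \<sigma> \<beta>"
  shows "\<alpha> = \<beta>"
proof -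
  have "inj_on ((!) \<sigma>) (set \<alpha> \<union> set \<beta>)"
    using assms simplex_nth_less[of \<sigma> N \<alpha>] simplex_nth_less[of \<sigma> N \<beta>]
    by (intro inj_on_nth) auto
  then show ?thesis using assms(5) unfolding mcomp_def by (metis map_inj_on)
qed

text \<open>Together with \<open>mcomp_inj\<close>: the faces and degeneracies of a nondegenerate simplex of \<open>\<Delta>\<^sup>N\<close> form a
  standard simplex.\<close>

lemma factor_ex:
  assumes "distinct \<sigma>" "\<sigma> \<in> simplex N" "\<tau> \<in> simplex N" "set \<tau> \<subseteq> set \<sigma>"
  shows "\<exists>\<alpha>\<in>simplex (dim \<sigma>). mcomp \<sigma> \<alpha> = \<tau>"
proof -
  define pos where "pos a = (SOME j. j < length \<sigma> \<and> \<sigma> ! j = a)" for a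
  have pos: "pos a < length \<sigma> \<and> \<sigma> ! pos a = a" if "a \<in> set \<tau>" for a
    unfolding pos_def by (rule someI_ex) (use that assms(4) in \<open>auto simp: in_set_conv_nth[symmetric]\<close>)
  have "sorted_wrt (<) \<sigma>" using assms by (simp add: simplex_iff strict_sorted_iff)
  then have "pos a \<le> pos b" if "a \<in> set \<tau>" "b \<in> set \<tau>" "a \<le> b" for a b
    using pos[OF that(1)] pos[OF that(2)] that(3)
    by (metis linorder_not_le sorted_wrt_nth_less)
  then have "sorted (map pos \<tau>)" using assms(3) unfolding sorted_map simplex_iff
    by (auto intro!: sorted_wrt_mono_rel[of _ "(\<le>)" "\<lambda>x y. pos x \<le> pos y"])
  moreover have "set (map pos \<tau>) \<subseteq> {0..dim \<sigma>}" using pos by fastforce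
  ultimately have "map pos \<tau> \<in> simplex (dim \<sigma>)" using assms(3) by (simp add: simplex_iff)
  moreover have "mcomp \<sigma> (map pos \<tau>) = \<tau>" using pos by (simp add: mcomp_def map_idI)
  ultimately show ?thesis by blast
qed

section \<open>Points of relative matching objects\<close>

(* The simplifier would rewrite length \<sigma> - 1 to length \<sigma> - Suc 0 and no longer recognise
   the dimension of a simplex. *)
declare One_nat_def [simp del]

context covers
begin

lemma simplicial_objectD:
  assumes "simplicial_object C X"
  shows "\<forall>k. Ob X k \<in> Obj C" "\<forall>l m. \<forall>\<alpha>\<in>mono_maps l m. Op X m \<alpha> \<in> hom C (Ob X m) (Ob X l)"
    "\<forall>m. Op X m [0..<Suc m] = Id C (Ob X m)"
    "\<forall>l m r. \<forall>\<alpha>\<in>mono_maps l m. \<forall>\<beta>\<in>mono_maps m r. Op X r (mcomp \<beta> \<alpha>) = Op X m \<alpha> \<cdot> Op X r \<beta>"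
  using assms unfolding simplicial_object_def by blast+

lemma Op_simps [simp]:
  assumes "simplicial_object C X" "\<alpha> \<in> simplex m"
  shows "Op X m \<alpha> \<in> Arr C" "Dom C (Op X m \<alpha>) = Ob X m" "Cod C (Op X m \<alpha>) = Ob X (dim \<alpha>)"
  using simplicial_objectD(2)[OF assms(1), rule_format, of \<alpha> "dim \<alpha>" m] assms(2) by (simp_all add: mono_maps_iff)

lemma Ob_Obj [simp]: "simplicial_object C X \<Longrightarrow> Ob X k \<in> Obj C"
  using simplicial_objectD(1) by blast

lemma Op_id [simp]: "simplicial_object C X \<Longrightarrow> Op X m [0..<Suc m] = Id C (Ob X m)"
  using simplicial_objectD(3) by blast

lemma Op_Op:
  assumes "simplicial_object C X" "\<alpha> \<in> simplex m" "\<beta> \<in> simplex r" "m = dim \<beta>"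
  shows "Op X m \<alpha> \<cdot> Op X r \<beta> = Op X r (mcomp \<beta> \<alpha>)"
proof -
  have "\<alpha> \<in> mono_maps (dim \<alpha>) m" "\<beta> \<in> mono_maps m r" using assms by (simp_all add: mono_maps_iff)
  then show ?thesis using simplicial_objectD(4)[OF assms(1)] by metis
qed

lemma Op_Op_comp:
  assumes "simplicial_object C X" "\<alpha> \<in> simplex m" "\<beta> \<in> simplex r" "m = dim \<beta>"
    "z \<in> Arr C" "Cod C z = Ob X r"
  shows "Op X m \<alpha> \<cdot> Op X r \<beta> \<cdot> z = Op X r (mcomp \<beta> \<alpha>) \<cdot> z"
  using comp_reduce[OF Op_Op[OF assms(1-4)]] assms by simp

lemma hom_pt_iff:
  "hom_pt C X S T x \<longleftrightarrow> (\<forall>\<sigma>\<in>S. x \<sigma> \<in> Arr C \<and> Dom C (x \<sigma>) = T \<and> Cod C (x \<sigma>) = Ob X (dim \<sigma>)) \<and>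
     (\<forall>\<sigma>\<in>S. \<forall>\<alpha>\<in>simplex (dim \<sigma>). x (mcomp \<sigma> \<alpha>) = Op X (dim \<sigma>) \<alpha> \<cdot> x \<sigma>)"
  unfolding hom_pt_def by (auto simp: mono_maps_iff)

end

definition sub_sset :: "nat \<Rightarrow> nat list set \<Rightarrow> bool" where
  "sub_sset N S \<longleftrightarrow> S \<subseteq> simplex N \<and> (\<forall>\<sigma>\<in>S. \<forall>\<alpha>\<in>simplex (dim \<sigma>). mcomp \<sigma> \<alpha> \<in> S)"

locale simplicial_morphism = covers C for C :: "('o, 'm) cov_cat" (structure) +
  fixes X Y :: "('o, 'm) sobj" and f :: "nat \<Rightarrow> 'm"
  assumes simplicial_morphism: "simplicial_map C X Y f"
begin

lemma X_obj [simp]: "simplicial_object C X" and Y_obj [simp]: "simplicial_object C Y"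
  using simplicial_morphism by (auto simp: simplicial_map_def)

lemma f_simps [simp]: "f k \<in> Arr C" "Dom C (f k) = Ob X k" "Cod C (f k) = Ob Y k"
  using simplicial_morphism by (auto simp: simplicial_map_def)

lemma natural:
  assumes "\<alpha> \<in> simplex m" "l = dim \<alpha>"
  shows "f l \<cdot> Op X m \<alpha> = Op Y m \<alpha> \<cdot> f m"
  using simplicial_morphism assms by (auto simp: simplicial_map_def mono_maps_iff)

lemma natural_comp:
  assumes "\<alpha> \<in> simplex m" "l = dim \<alpha>" "z \<in> Arr C" "Cod C z = Ob X m"
  shows "f l \<cdot> Op X m \<alpha> \<cdot> z = Op Y m \<alpha> \<cdot> f m \<cdot> z"
  using comp_reduce[OF natural[OF assms(1,2)]] assms by simp

abbreviation pt :: "nat \<Rightarrow> nat list set \<Rightarrow> 'o \<Rightarrow> (nat list \<Rightarrow> 'm) \<Rightarrow> 'm \<Rightarrow> bool" where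
  "pt \<equiv> rel_hom_pt C X Y f"

lemma pt_iff:
  "pt N S T x y \<longleftrightarrow> (\<forall>\<sigma>\<in>S. x \<sigma> \<in> Arr C \<and> Dom C (x \<sigma>) = T \<and> Cod C (x \<sigma>) = Ob X (dim \<sigma>)) \<and>
     (\<forall>\<sigma>\<in>S. \<forall>\<alpha>\<in>simplex (dim \<sigma>). x (mcomp \<sigma> \<alpha>) = Op X (dim \<sigma>) \<alpha> \<cdot> x \<sigma>) \<and>
     y \<in> Arr C \<and> Dom C y = T \<and> Cod C y = Ob Y N \<and>
     (\<forall>\<sigma>\<in>S. f (dim \<sigma>) \<cdot> x \<sigma> = Op Y N \<sigma> \<cdot> y)"
  unfolding rel_hom_pt_def hom_pt_iff by auto

lemma ptD:
  assumes "pt N S T x y"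
  shows "\<And>\<sigma>. \<sigma> \<in> S \<Longrightarrow> x \<sigma> \<in> Arr C" "\<And>\<sigma>. \<sigma> \<in> S \<Longrightarrow> Dom C (x \<sigma>) = T" "\<And>\<sigma>. \<sigma> \<in> S \<Longrightarrow> Cod C (x \<sigma>) = Ob X (dim \<sigma>)"
    "\<And>\<sigma> \<alpha>. \<sigma> \<in> S \<Longrightarrow> \<alpha> \<in> simplex (dim \<sigma>) \<Longrightarrow> x (mcomp \<sigma> \<alpha>) = Op X (dim \<sigma>) \<alpha> \<cdot> x \<sigma>"
    "y \<in> Arr C" "Dom C y = T" "Cod C y = Ob Y N"
    "\<And>\<sigma>. \<sigma> \<in> S \<Longrightarrow> f (dim \<sigma>) \<cdot> x \<sigma> = Op Y N \<sigma> \<cdot> y"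
  using assms unfolding pt_iff by auto

lemma pt_mono: "pt N S T x y \<Longrightarrow> S' \<subseteq> S \<Longrightarrow> pt N S' T x y"
  unfolding pt_iff by blast

lemma pt_cong:
  assumes "pt N S T x y" "sub_sset N S" "\<And>\<sigma>. \<sigma> \<in> S \<Longrightarrow> x' \<sigma> = x \<sigma>"
  shows "pt N S T x' y"
  using assms unfolding pt_iff sub_sset_def by simp

lemma pt_comp:
  assumes "pt N S T x y" "S \<subseteq> simplex N" "h \<in> Arr C" "Cod C h = T"
  shows "pt N S (Dom C h) (\<lambda>\<sigma>. x \<sigma> \<cdot> h) (y \<cdot> h)"
proof -
  note D = ptD[OF assms(1)]
  have S: "\<sigma> \<in> simplex N" if "\<sigma> \<in> S" for \<sigma> using assms(2) that by blast
  show ?thesis unfolding pt_iff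
    using D S assms(3,4) comp_reduce[OF D(8)] by (auto)
qed

lemma pt_empty: "pt N {} T x y \<longleftrightarrow> y \<in> Arr C \<and> Dom C y = T \<and> Cod C y = Ob Y N"
  by (auto simp: pt_iff)

lemma pt_simplex:
  assumes "e \<in> Arr C" "Cod C e = Ob X N"
  shows "pt N (simplex N) (Dom C e) (\<lambda>\<sigma>. Op X N \<sigma> \<cdot> e) (f N \<cdot> e)"
  unfolding pt_iff using assms by (simp add: Op_Op_comp natural_comp)

lemma pt_simplexD:
  assumes "pt N (simplex N) T x y"
  defines "e \<equiv> x [0..<Suc N]"
  shows "e \<in> Arr C" "Dom C e = T" "Cod C e = Ob X N" "f N \<cdot> e = y"
    "\<And>\<sigma>. \<sigma> \<in> simplex N \<Longrightarrow> x \<sigma> = Op X N \<sigma> \<cdot> e"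
proof -
  note D = ptD[OF assms(1)]
  show "e \<in> Arr C" "Dom C e = T" "Cod C e = Ob X N"
    using D(1-3)[OF id_simplex] by (simp_all add: e_def del: upt_Suc)
  show "f N \<cdot> e = y" using D(8)[OF id_simplex] D(5-7) by (simp add: e_def del: upt_Suc)
  show "x \<sigma> = Op X N \<sigma> \<cdot> e" if "\<sigma> \<in> simplex N" for \<sigma>
    using D(4)[OF id_simplex, of \<sigma>] that mcomp_id_left[OF that] by (simp add: e_def del: upt_Suc)
qed

text \<open>The pullback of the restriction map from points on \<open>A'\<close> to points on \<open>A\<close> along the point \<open>(x, y)\<close>, over
  the object \<open>Dom y\<close>, is represented by \<open>c\<close> with universal point \<open>x'\<close>: an arrow into \<open>Dom c\<close> amounts to an
  arrow \<open>t\<close> into \<open>Dom y\<close> together with an extension to \<open>A'\<close> of the point \<open>(x, y)\<close> restricted along \<open>t\<close>.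
  Neither functor of points has to be representable.\<close>

definition universal_ext ::
    "nat \<Rightarrow> nat list set \<Rightarrow> nat list set \<Rightarrow> (nat list \<Rightarrow> 'm) \<Rightarrow> 'm \<Rightarrow> 'm \<Rightarrow> (nat list \<Rightarrow> 'm) \<Rightarrow> bool" where
  "universal_ext N A A' x y c x' \<longleftrightarrow>
     c \<in> Cov C \<and> Cod C c = Dom C y \<and> pt N A' (Dom C c) x' (y \<cdot> c) \<and> (\<forall>\<sigma>\<in>A. x' \<sigma> = x \<sigma> \<cdot> c) \<and>
     (\<forall>t z. t \<in> Arr C \<and> Cod C t = Dom C y \<and> pt N A' (Dom C t) z (y \<cdot> t) \<and> (\<forall>\<sigma>\<in>A. z \<sigma> = x \<sigma> \<cdot> t) \<longrightarrow>
        (\<exists>h. h \<in> Arr C \<and> Dom C h = Dom C t \<and> Cod C h = Dom C c \<and> c \<cdot> h = t \<and> (\<forall>\<sigma>\<in>A'. x' \<sigma> \<cdot> h = z \<sigma>))) \<and>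
     (\<forall>h h'. h \<in> Arr C \<and> h' \<in> Arr C \<and> Dom C h = Dom C h' \<and> Cod C h = Dom C c \<and> Cod C h' = Dom C c \<and>
        c \<cdot> h = c \<cdot> h' \<and> (\<forall>\<sigma>\<in>A'. x' \<sigma> \<cdot> h = x' \<sigma> \<cdot> h') \<longrightarrow> h = h')"

text \<open>The natural map \<open>hom(A', X) \<times> Y\<^sub>N \<rightarrow> hom(A, X) \<times> Y\<^sub>N\<close>, with products over \<open>hom(A', Y)\<close> and \<open>hom(A, Y)\<close>, is
  a representable cover of functors of points.\<close>

definition extends :: "nat \<Rightarrow> nat list set \<Rightarrow> nat list set \<Rightarrow> bool" where
  "extends N A A' \<longleftrightarrow> (\<forall>T x y. pt N A T x y \<longrightarrow> (\<exists>c x'. universal_ext N A A' x y c x'))"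

text \<open>The case where \<open>A'\<close> is all of \<open>\<Delta>\<^sup>N\<close>. By the Yoneda lemma an extension is then a single arrow into
  \<open>Ob X N\<close>.\<close>

definition universal_fill ::
    "nat \<Rightarrow> nat list set \<Rightarrow> (nat list \<Rightarrow> 'm) \<Rightarrow> 'm \<Rightarrow> 'm \<Rightarrow> 'm \<Rightarrow> bool" where
  "universal_fill N A x y c e \<longleftrightarrow>
     c \<in> Cov C \<and> Cod C c = Dom C y \<and> e \<in> Arr C \<and> Dom C e = Dom C c \<and> Cod C e = Ob X N \<and>
     f N \<cdot> e = y \<cdot> c \<and> (\<forall>\<sigma>\<in>A. Op X N \<sigma> \<cdot> e = x \<sigma> \<cdot> c) \<and>
     (\<forall>t z. t \<in> Arr C \<and> Cod C t = Dom C y \<and> z \<in> Arr C \<and> Dom C z = Dom C t \<and> Cod C z = Ob X N \<and>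
         f N \<cdot> z = y \<cdot> t \<and> (\<forall>\<sigma>\<in>A. Op X N \<sigma> \<cdot> z = x \<sigma> \<cdot> t) \<longrightarrow>
        (\<exists>h. h \<in> Arr C \<and> Dom C h = Dom C t \<and> Cod C h = Dom C c \<and> c \<cdot> h = t \<and> e \<cdot> h = z)) \<and>
     (\<forall>h h'. h \<in> Arr C \<and> h' \<in> Arr C \<and> Dom C h = Dom C h' \<and> Cod C h = Dom C c \<and> Cod C h' = Dom C c \<and>
        c \<cdot> h = c \<cdot> h' \<and> e \<cdot> h = e \<cdot> h' \<longrightarrow> h = h')"

lemma universal_extD:
  assumes "universal_ext N A A' x y c x'"
  shows "c \<in> Cov C" "c \<in> Arr C" "Cod C c = Dom C y" "pt N A' (Dom C c) x' (y \<cdot> c)" "\<And>\<sigma>. \<sigma> \<in> A \<Longrightarrow> x' \<sigma> = x \<sigma> \<cdot> c"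
  using assms by (simp_all add: universal_ext_def)

lemma universal_ext_lift:
  assumes "universal_ext N A A' x y c x'" "t \<in> Arr C" "Cod C t = Dom C y" "pt N A' (Dom C t) z (y \<cdot> t)"
    "\<And>\<sigma>. \<sigma> \<in> A \<Longrightarrow> z \<sigma> = x \<sigma> \<cdot> t"
  obtains h where "h \<in> Arr C" "Dom C h = Dom C t" "Cod C h = Dom C c" "c \<cdot> h = t" "\<And>\<sigma>. \<sigma> \<in> A' \<Longrightarrow> x' \<sigma> \<cdot> h = z \<sigma>"
proof -
  have "\<exists>h. h \<in> Arr C \<and> Dom C h = Dom C t \<and> Cod C h = Dom C c \<and> c \<cdot> h = t \<and> (\<forall>\<sigma>\<in>A'. x' \<sigma> \<cdot> h = z \<sigma>)"
    using assms unfolding universal_ext_def by blast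
  with that show ?thesis by blast
qed

lemma universal_ext_eq:
  assumes "universal_ext N A A' x y c x'" "h \<in> Arr C" "h' \<in> Arr C" "Dom C h = Dom C h'" "Cod C h = Dom C c" "Cod C h' = Dom C c"
    "c \<cdot> h = c \<cdot> h'" "\<And>\<sigma>. \<sigma> \<in> A' \<Longrightarrow> x' \<sigma> \<cdot> h = x' \<sigma> \<cdot> h'"
  shows "h = h'"
  using assms unfolding universal_ext_def by blast

lemma universal_fillD:
  assumes "universal_fill N A x y c e"
  shows "c \<in> Cov C" "c \<in> Arr C" "Cod C c = Dom C y" "e \<in> Arr C" "Dom C e = Dom C c" "Cod C e = Ob X N"
    "f N \<cdot> e = y \<cdot> c" "\<And>\<sigma>. \<sigma> \<in> A \<Longrightarrow> Op X N \<sigma> \<cdot> e = x \<sigma> \<cdot> c"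
  using assms by (simp_all add: universal_fill_def)

lemma universal_fill_lift:
  assumes "universal_fill N A x y c e" "t \<in> Arr C" "Cod C t = Dom C y" "z \<in> Arr C" "Dom C z = Dom C t"
    "Cod C z = Ob X N" "f N \<cdot> z = y \<cdot> t" "\<And>\<sigma>. \<sigma> \<in> A \<Longrightarrow> Op X N \<sigma> \<cdot> z = x \<sigma> \<cdot> t"
  obtains h where "h \<in> Arr C" "Dom C h = Dom C t" "Cod C h = Dom C c" "c \<cdot> h = t" "e \<cdot> h = z"
proof -
  have "\<exists>h. h \<in> Arr C \<and> Dom C h = Dom C t \<and> Cod C h = Dom C c \<and> c \<cdot> h = t \<and> e \<cdot> h = z"
    using assms unfolding universal_fill_def by blast
  with that show ?thesis by blast
qed

lemma universal_fill_eq: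
  assumes "universal_fill N A x y c e" "h \<in> Arr C" "h' \<in> Arr C" "Dom C h = Dom C h'" "Cod C h = Dom C c" "Cod C h' = Dom C c"
    "c \<cdot> h = c \<cdot> h'" "e \<cdot> h = e \<cdot> h'"
  shows "h = h'"
  using assms unfolding universal_fill_def by blast

lemma extends_simplexD:
  assumes "extends N A (simplex N)" "A \<subseteq> simplex N" "pt N A T x y"
  obtains c e where "universal_fill N A x y c e"
proof -
  obtain c x' where u: "universal_ext N A (simplex N) x y c x'"
    using assms(1,3) unfolding extends_def by blast
  note D = universal_extD[OF u]
  note P = ptD[OF assms(3)]
  define e where "e = x' [0..<Suc N]"
  note E = pt_simplexD[OF D(4), folded e_def]
  have "universal_fill N A x y c e"
    unfolding universal_fill_def
  proof (intro conjI allI impI ballI; (elim conjE)?)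
    fix \<sigma> assume "\<sigma> \<in> A"
    then show "Op X N \<sigma> \<cdot> e = x \<sigma> \<cdot> c" using E(5)[of \<sigma>] D(5)[of \<sigma>] assms(2) by auto
  next
    fix t z assume a: "t \<in> Arr C" "Cod C t = Dom C y" "z \<in> Arr C" "Dom C z = Dom C t" "Cod C z = Ob X N"
      "f N \<cdot> z = y \<cdot> t" "\<forall>\<sigma>\<in>A. Op X N \<sigma> \<cdot> z = x \<sigma> \<cdot> t"
    obtain h where h: "h \<in> Arr C" "Dom C h = Dom C t" "Cod C h = Dom C c" "c \<cdot> h = t"
        "\<And>\<sigma>. \<sigma> \<in> simplex N \<Longrightarrow> x' \<sigma> \<cdot> h = Op X N \<sigma> \<cdot> z"
      using universal_ext_lift[OF u a(1,2), of "\<lambda>\<sigma>. Op X N \<sigma> \<cdot> z"] pt_simplex[OF a(3,5)] a by auto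
    then have "e \<cdot> h = z" using h(5)[OF id_simplex] a by (simp add: e_def del: upt_Suc)
    with h show "\<exists>h. h \<in> Arr C \<and> Dom C h = Dom C t \<and> Cod C h = Dom C c \<and> c \<cdot> h = t \<and> e \<cdot> h = z" by blast
  next
    fix h h' assume a: "h \<in> Arr C" "h' \<in> Arr C" "Dom C h = Dom C h'" "Cod C h = Dom C c" "Cod C h' = Dom C c"
        "c \<cdot> h = c \<cdot> h'" "e \<cdot> h = e \<cdot> h'"
    show "h = h'"
      by (rule universal_ext_eq[OF u a(1-6)]) (use a E in simp)
  qed (use D E in simp_all)
  with that show ?thesis .
qed

lemma extends_simplexI:
  assumes "A \<subseteq> simplex N" "\<And>T x y. pt N A T x y \<Longrightarrow> \<exists>c e. universal_fill N A x y c e"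
  shows "extends N A (simplex N)"
  unfolding extends_def
proof (intro allI impI)
  fix T x y assume p: "pt N A T x y"
  obtain c e where u: "universal_fill N A x y c e" using assms(2)[OF p] by blast
  note D = universal_fillD[OF u]
  have "universal_ext N A (simplex N) x y c (\<lambda>\<sigma>. Op X N \<sigma> \<cdot> e)"
    unfolding universal_ext_def
  proof (intro conjI allI impI ballI; (elim conjE)?)
    show "pt N (simplex N) (Dom C c) (\<lambda>\<sigma>. Op X N \<sigma> \<cdot> e) (y \<cdot> c)"
      using pt_simplex[of e N] D by simp
  next
    fix t z assume a: "t \<in> Arr C" "Cod C t = Dom C y" "pt N (simplex N) (Dom C t) z (y \<cdot> t)" "\<forall>\<sigma>\<in>A. z \<sigma> = x \<sigma> \<cdot> t"
    note E = pt_simplexD[OF a(3)]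
    have F: "Op X N \<sigma> \<cdot> z [0..<Suc N] = x \<sigma> \<cdot> t" if "\<sigma> \<in> A" for \<sigma>
      using that E(5)[of \<sigma>] a(4) assms(1) by (auto simp del: upt_Suc)
    obtain h where h: "h \<in> Arr C" "Dom C h = Dom C t" "Cod C h = Dom C c" "c \<cdot> h = t" "e \<cdot> h = z [0..<Suc N]"
      by (rule universal_fill_lift[OF u a(1,2) E(1-4) F])
    have "\<forall>\<sigma>\<in>simplex N. (Op X N \<sigma> \<cdot> e) \<cdot> h = z \<sigma>"
    proof
      fix \<sigma> assume s: "\<sigma> \<in> simplex N"
      show "(Op X N \<sigma> \<cdot> e) \<cdot> h = z \<sigma>" unfolding E(5)[OF s] using s h D by (simp del: upt_Suc)
    qed
    with h show "\<exists>h. h \<in> Arr C \<and> Dom C h = Dom C t \<and> Cod C h = Dom C c \<and> c \<cdot> h = t \<and>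
       (\<forall>\<sigma>\<in>simplex N. (Op X N \<sigma> \<cdot> e) \<cdot> h = z \<sigma>)" by blast
  next
    fix h h' assume a: "h \<in> Arr C" "h' \<in> Arr C" "Dom C h = Dom C h'" "Cod C h = Dom C c" "Cod C h' = Dom C c"
        "c \<cdot> h = c \<cdot> h'" "\<forall>\<sigma>\<in>simplex N. (Op X N \<sigma> \<cdot> e) \<cdot> h = (Op X N \<sigma> \<cdot> e) \<cdot> h'"
    show "h = h'"
      by (rule universal_fill_eq[OF u a(1-6)]) (use a(1-6) a(7)[rule_format, OF id_simplex] D in \<open>simp del: upt_Suc\<close>)
  qed (use D in simp_all)
  then show "\<exists>c x'. universal_ext N A (simplex N) x y c x'" by blast
qed

lemma extends_refl:
  assumes "sub_sset N A"
  shows "extends N A A"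
  unfolding extends_def
proof (intro allI impI)
  fix T x y assume p: "pt N A T x y"
  note D = ptD[OF p]
  have "universal_ext N A A x y (Id C T) x"
    unfolding universal_ext_def
    using D p by (force)
  then show "\<exists>c x'. universal_ext N A A x y c x'" by blast
qed

text \<open>Pasting of pullback squares, for functors of points.\<close>

lemma extends_trans:
  assumes "extends N A A'" "extends N A' A''" "A \<subseteq> A'" "A' \<subseteq> A''"
  shows "extends N A A''"
  unfolding extends_def
proof (intro allI impI)
  fix T x y assume p: "pt N A T x y"
  note P = ptD[OF p]
  obtain c1 x1 where u1: "universal_ext N A A' x y c1 x1" using assms(1) p unfolding extends_def by blast
  note D1 = universal_extD[OF u1]
  obtain c2 x2 where u2: "universal_ext N A' A'' x1 (y \<cdot> c1) c2 x2"
    using assms(2) D1(4) unfolding extends_def by blast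
  note D2 = universal_extD[OF u2]
  have [simp]: "Cod C c2 = Dom C c1" using D2(3) D1 P by simp
  note Q1 = ptD[OF D1(4)]
  note Q2 = ptD[OF D2(4)]
  have "universal_ext N A A'' x y (c1 \<cdot> c2) x2"
    unfolding universal_ext_def
  proof (intro conjI allI impI ballI; (elim conjE)?)
    show "c1 \<cdot> c2 \<in> Cov C" using D1 D2 by (intro comp_Cov) simp_all
    show "pt N A'' (Dom C (c1 \<cdot> c2)) x2 (y \<cdot> c1 \<cdot> c2)"
      using D2(4) D1(2,3) D2(2) P by simp
  next
    fix \<sigma> assume "\<sigma> \<in> A"
    then show "x2 \<sigma> = x \<sigma> \<cdot> c1 \<cdot> c2" using D1 D2 P assms(3) by auto
  next
    fix t z assume a: "t \<in> Arr C" "Cod C t = Dom C y" "pt N A'' (Dom C t) z (y \<cdot> t)" "\<forall>\<sigma>\<in>A. z \<sigma> = x \<sigma> \<cdot> t"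
    obtain h where h: "h \<in> Arr C" "Dom C h = Dom C t" "Cod C h = Dom C c1" "c1 \<cdot> h = t" "\<And>\<sigma>. \<sigma> \<in> A' \<Longrightarrow> x1 \<sigma> \<cdot> h = z \<sigma>"
      using universal_ext_lift[OF u1 a(1,2) pt_mono[OF a(3) assms(4)]] a(4) by auto
    have "pt N A'' (Dom C h) z ((y \<cdot> c1) \<cdot> h)" using a h P D1 by simp
    then obtain k where k: "k \<in> Arr C" "Dom C k = Dom C h" "Cod C k = Dom C c2" "c2 \<cdot> k = h" "\<And>\<sigma>. \<sigma> \<in> A'' \<Longrightarrow> x2 \<sigma> \<cdot> k = z \<sigma>"
      using universal_ext_lift[OF u2 h(1), of z] h P D1 by auto
    have "(c1 \<cdot> c2) \<cdot> k = t" using k h D1 D2 by simp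
    then show "\<exists>h. h \<in> Arr C \<and> Dom C h = Dom C t \<and> Cod C h = Dom C (c1 \<cdot> c2) \<and> (c1 \<cdot> c2) \<cdot> h = t \<and>
       (\<forall>\<sigma>\<in>A''. x2 \<sigma> \<cdot> h = z \<sigma>)" using k h(2) D1(2) D2(2) by (intro exI[of _ k]) simp
  next
    fix h h' assume a: "h \<in> Arr C" "h' \<in> Arr C" "Dom C h = Dom C h'" "Cod C h = Dom C (c1 \<cdot> c2)" "Cod C h' = Dom C (c1 \<cdot> c2)"
        "(c1 \<cdot> c2) \<cdot> h = (c1 \<cdot> c2) \<cdot> h'" "\<forall>\<sigma>\<in>A''. x2 \<sigma> \<cdot> h = x2 \<sigma> \<cdot> h'"
    have b: "Cod C h = Dom C c2" "Cod C h' = Dom C c2" using a D1 D2 by simp_all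
    have "c2 \<cdot> h = c2 \<cdot> h'"
    proof (rule universal_ext_eq[OF u1])
      fix \<sigma> assume s: "\<sigma> \<in> A'"
      have "x2 \<sigma> \<cdot> h = x2 \<sigma> \<cdot> h'" using a(7) assms(4) s by blast
      then show "x1 \<sigma> \<cdot> c2 \<cdot> h = x1 \<sigma> \<cdot> c2 \<cdot> h'"
        unfolding D2(5)[OF s] using a(1-3) b D1(2) D2(2) Q1(1-3)[OF s] by simp
    qed (use a b D1 D2 in simp_all)
    then show "h = h'" using universal_ext_eq[OF u2 a(1-3) b] a(7) by blast
  qed (use D1 D2 in simp_all)
  then show "\<exists>c x'. universal_ext N A A'' x y c x'" by blast
qed

lemma rel_hom_objD:
  assumes "is_rel_hom_obj C X Y f N S L u v"
  shows "L \<in> Obj C" "pt N S L u v"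
  using assms by (auto simp: is_rel_hom_obj_def)

lemma rel_hom_obj_lift:
  assumes "is_rel_hom_obj C X Y f N S L u v" "pt N S T x y"
  obtains h where "h \<in> Arr C" "Dom C h = T" "Cod C h = L" "\<And>\<sigma>. \<sigma> \<in> S \<Longrightarrow> u \<sigma> \<cdot> h = x \<sigma>" "v \<cdot> h = y"
proof -
  have "T \<in> Obj C" using ptD[OF assms(2)] by auto
  then have "\<exists>!h. h \<in> hom C T L \<and> (\<forall>\<sigma>\<in>S. u \<sigma> \<cdot> h = x \<sigma>) \<and> v \<cdot> h = y"
    using assms unfolding is_rel_hom_obj_def by blast
  then show ?thesis using that by auto
qed

lemma rel_hom_obj_eq:
  assumes "is_rel_hom_obj C X Y f N S L u v" "S \<subseteq> simplex N" "h \<in> Arr C" "h' \<in> Arr C" "Dom C h = Dom C h'" "Cod C h = L" "Cod C h' = L"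
    "\<And>\<sigma>. \<sigma> \<in> S \<Longrightarrow> u \<sigma> \<cdot> h = u \<sigma> \<cdot> h'" "v \<cdot> h = v \<cdot> h'"
  shows "h = h'"
proof -
  note R = rel_hom_objD[OF assms(1)]
  have "pt N S (Dom C h) (\<lambda>\<sigma>. u \<sigma> \<cdot> h) (v \<cdot> h)" using pt_comp[OF R(2) assms(2,3)] assms(6) by simp
  then have "\<exists>!k. k \<in> hom C (Dom C h) L \<and> (\<forall>\<sigma>\<in>S. u \<sigma> \<cdot> k = u \<sigma> \<cdot> h) \<and> v \<cdot> k = v \<cdot> h"
    using assms(1,3) unfolding is_rel_hom_obj_def by simp
  moreover have "h \<in> hom C (Dom C h) L \<and> (\<forall>\<sigma>\<in>S. u \<sigma> \<cdot> h = u \<sigma> \<cdot> h) \<and> v \<cdot> h = v \<cdot> h"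
    "h' \<in> hom C (Dom C h) L \<and> (\<forall>\<sigma>\<in>S. u \<sigma> \<cdot> h' = u \<sigma> \<cdot> h) \<and> v \<cdot> h' = v \<cdot> h"
    using assms(3-9) by simp_all
  ultimately show ?thesis by blast
qed

lemma rel_hom_obj_empty: "is_rel_hom_obj C X Y f N {} (Ob Y N) u (Id C (Ob Y N))"
  unfolding is_rel_hom_obj_def
proof (intro conjI ballI allI impI)
  fix T x y assume "pt N {} T x y"
  then have y: "y \<in> Arr C" "Dom C y = T" "Cod C y = Ob Y N" by (simp_all add: pt_empty)
  show "\<exists>!h. h \<in> hom C T (Ob Y N) \<and> (\<forall>\<sigma>\<in>{}. u \<sigma> \<cdot> h = x \<sigma>) \<and> Id C (Ob Y N) \<cdot> h = y"
  proof (rule ex1I[of _ y])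
    show "y \<in> hom C T (Ob Y N) \<and> (\<forall>\<sigma>\<in>{}. u \<sigma> \<cdot> y = x \<sigma>) \<and> Id C (Ob Y N) \<cdot> y = y" using y by simp
    fix h assume "h \<in> hom C T (Ob Y N) \<and> (\<forall>\<sigma>\<in>{}. u \<sigma> \<cdot> h = x \<sigma>) \<and> Id C (Ob Y N) \<cdot> h = y"
    then have h: "h \<in> Arr C" "Cod C h = Ob Y N" "Id C (Ob Y N) \<cdot> h = y" by simp_all
    show "h = y" using h(3) Id_comp[OF h(1,2)] by metis
  qed
qed (simp_all add: pt_empty)

text \<open>Extending the universal point on \<open>A\<close> gives the universal point on \<open>A'\<close>. This is how all limits in the
  proof come into existence.\<close>

lemma rel_hom_obj_extend:
  assumes "is_rel_hom_obj C X Y f N A L u v" "extends N A A'" "A \<subseteq> A'" "A' \<subseteq> simplex N"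
  obtains L' u' v' where "is_rel_hom_obj C X Y f N A' L' u' v'"
proof -
  note R = rel_hom_objD[OF assms(1)]
  note P = ptD[OF R(2)]
  obtain c x' where u: "universal_ext N A A' u v c x'" using assms(2) R(2) unfolding extends_def by blast
  note D = universal_extD[OF u]
  have vc: "Dom C v = L" "v \<in> Arr C" using P by simp_all
  have "is_rel_hom_obj C X Y f N A' (Dom C c) x' (v \<cdot> c)"
    unfolding is_rel_hom_obj_def
  proof (intro conjI ballI allI impI)
    show "Dom C c \<in> Obj C" using D by simp
    show "pt N A' (Dom C c) x' (v \<cdot> c)" by (rule D)
    fix T x y assume T: "T \<in> Obj C" and p: "pt N A' T x y"
    obtain t where t: "t \<in> Arr C" "Dom C t = T" "Cod C t = L" "\<And>\<sigma>. \<sigma> \<in> A \<Longrightarrow> u \<sigma> \<cdot> t = x \<sigma>" "v \<cdot> t = y"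
      using rel_hom_obj_lift[OF assms(1) pt_mono[OF p assms(3)]] by metis
    obtain h where h: "h \<in> Arr C" "Dom C h = Dom C t" "Cod C h = Dom C c" "c \<cdot> h = t" "\<And>\<sigma>. \<sigma> \<in> A' \<Longrightarrow> x' \<sigma> \<cdot> h = x \<sigma>"
      by (rule universal_ext_lift[OF u t(1), of x]) (use t p vc in simp_all)
    show "\<exists>!h. h \<in> hom C T (Dom C c) \<and> (\<forall>\<sigma>\<in>A'. x' \<sigma> \<cdot> h = x \<sigma>) \<and> (v \<cdot> c) \<cdot> h = y"
    proof (rule ex1I[of _ h])
      show "h \<in> hom C T (Dom C c) \<and> (\<forall>\<sigma>\<in>A'. x' \<sigma> \<cdot> h = x \<sigma>) \<and> (v \<cdot> c) \<cdot> h = y"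
        using h t vc D by simp
      fix k assume k: "k \<in> hom C T (Dom C c) \<and> (\<forall>\<sigma>\<in>A'. x' \<sigma> \<cdot> k = x \<sigma>) \<and> (v \<cdot> c) \<cdot> k = y"
      have "c \<cdot> k = c \<cdot> h"
      proof (rule rel_hom_obj_eq[OF assms(1)])
        fix \<sigma> assume s: "\<sigma> \<in> A"
        then have "x' \<sigma> \<cdot> k = x' \<sigma> \<cdot> h" using k h(5) assms(3) by auto
        then show "u \<sigma> \<cdot> c \<cdot> k = u \<sigma> \<cdot> c \<cdot> h" unfolding D(5)[OF s] using k h(1-3) D(2,3) P(1-3)[OF s] vc by simp
      qed (use k h D vc t assms(3,4) in auto)
      then show "k = h" using universal_ext_eq[OF u, of k h] k h t by simp
    qed
  qed
  with that show ?thesis by blast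
qed

text \<open>Pull the cover back along the arrow that classifies the given point.\<close>

lemma extends_of_cover:
  assumes L: "is_rel_hom_obj C X Y f N A L u v" and r: "is_rel_restr C X f N A L u v h" and c: "h \<in> Cov C"
    and A: "A \<subseteq> simplex N"
  shows "extends N A (simplex N)"
proof (rule extends_simplexI[OF A])
  fix T x y assume p: "pt N A T x y"
  note P = ptD[OF p]
  note V = ptD[OF rel_hom_objD(2)[OF L]]
  have H: "h \<in> Arr C" "Dom C h = Ob X N" "Cod C h = L" "\<And>\<sigma>. \<sigma> \<in> A \<Longrightarrow> u \<sigma> \<cdot> h = Op X N \<sigma>" "v \<cdot> h = f N"
    using r by (auto simp: is_rel_restr_def)
  obtain t where t: "t \<in> Arr C" "Dom C t = T" "Cod C t = L" "\<And>\<sigma>. \<sigma> \<in> A \<Longrightarrow> u \<sigma> \<cdot> t = x \<sigma>" "v \<cdot> t = y"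
    using rel_hom_obj_lift[OF L p] by metis
  obtain e c' where pb: "is_pullback C h t e c'" using pullback_ex[OF c t(1)] t H by auto
  note D = pullbackD[OF pb]
  have "universal_fill N A x y c' e"
    unfolding universal_fill_def
  proof (intro conjI allI impI ballI; (elim conjE)?)
    show "c' \<in> Cov C" using pullback_Cov[OF c pb] .
    have "f N \<cdot> e = v \<cdot> h \<cdot> e" using H(1-3) D(1-8) V(5,6) by (simp add: comp_reduce[OF H(5)])
    also have "\<dots> = v \<cdot> t \<cdot> c'" using D(9) by simp
    also have "\<dots> = y \<cdot> c'" using t(1-3) D(1-8) V(5,6) by (simp add: comp_reduce[OF t(5)])
    finally show "f N \<cdot> e = y \<cdot> c'" .
  next
    fix \<sigma> assume s: "\<sigma> \<in> A"
    have "Op X N \<sigma> \<cdot> e = u \<sigma> \<cdot> h \<cdot> e" using H(1-3) D(1-8) V(1-3)[OF s] by (simp add: comp_reduce[OF H(4)[OF s]])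
    also have "\<dots> = u \<sigma> \<cdot> t \<cdot> c'" using D(9) by simp
    also have "\<dots> = x \<sigma> \<cdot> c'" using t(1-3) D(1-8) V(1-3)[OF s] by (simp add: comp_reduce[OF t(4)[OF s]])
    finally show "Op X N \<sigma> \<cdot> e = x \<sigma> \<cdot> c'" .
  next
    fix s z assume a: "s \<in> Arr C" "Cod C s = Dom C y" "z \<in> Arr C" "Dom C z = Dom C s" "Cod C z = Ob X N"
      "f N \<cdot> z = y \<cdot> s" "\<forall>\<sigma>\<in>A. Op X N \<sigma> \<cdot> z = x \<sigma> \<cdot> s"
    have "h \<cdot> z = t \<cdot> s"
    proof (rule rel_hom_obj_eq[OF L A])
      show "v \<cdot> h \<cdot> z = v \<cdot> t \<cdot> s" using H t V a P by (simp add: comp_reduce[OF t(5)] comp_reduce[OF H(5)])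
      show "u \<sigma> \<cdot> h \<cdot> z = u \<sigma> \<cdot> t \<cdot> s" if s: "\<sigma> \<in> A" for \<sigma>
        using H(1-3) t(1-3) V a P s by (simp add: comp_reduce[OF t(4)[OF s]] comp_reduce[OF H(4)[OF s]])
    qed (use H t a P in simp_all)
    then obtain k where "k \<in> Arr C" "Dom C k = Dom C z" "Cod C k = Dom C e" "e \<cdot> k = z" "c' \<cdot> k = s"
      using pullback_lift[OF pb a(3,1)] a H t P by auto
    then show "\<exists>h. h \<in> Arr C \<and> Dom C h = Dom C s \<and> Cod C h = Dom C c' \<and> c' \<cdot> h = s \<and> e \<cdot> h = z"
      using a D by auto
  next
    fix k k' assume "k \<in> Arr C" "k' \<in> Arr C" "Dom C k = Dom C k'" "Cod C k = Dom C c'" "Cod C k' = Dom C c'"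
        "c' \<cdot> k = c' \<cdot> k'" "e \<cdot> k = e \<cdot> k'"
    then show "k = k'" using D by - (rule pullback_eq[OF pb]; simp)
  qed (use D t H P in simp_all)
  then show "\<exists>c e. universal_fill N A x y c e" by blast
qed

text \<open>The universal filler of the universal point on \<open>A\<close> is a cover of \<open>L\<close>. Its domain represents
  \<open>N\<close>-simplices of \<open>X\<close>, so it differs from the natural map by an isomorphism.\<close>

lemma cover_of_extends:
  assumes L: "is_rel_hom_obj C X Y f N A L u v" and A: "A \<subseteq> simplex N" and e: "extends N A (simplex N)"
  obtains h where "is_rel_restr C X f N A L u v h" "h \<in> Cov C"
proof -
  note V = ptD[OF rel_hom_objD(2)[OF L]]
  have "pt N A (Ob X N) (\<lambda>\<sigma>. Op X N \<sigma>) (f N)"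
    using pt_mono[OF pt_simplex[of "Id C (Ob X N)" N] A] A by (auto simp: pt_iff subset_iff Op_Op natural)
  then obtain h where h: "h \<in> Arr C" "Dom C h = Ob X N" "Cod C h = L" "\<And>\<sigma>. \<sigma> \<in> A \<Longrightarrow> u \<sigma> \<cdot> h = Op X N \<sigma>" "v \<cdot> h = f N"
    using rel_hom_obj_lift[OF L] by metis
  obtain c e where u: "universal_fill N A u v c e"
    using extends_simplexD[OF e A rel_hom_objD(2)[OF L]] .
  note D = universal_fillD[OF u]
  have vL: "Dom C v = L" using V by simp
  obtain s where s: "s \<in> Arr C" "Dom C s = Dom C h" "Cod C s = Dom C c" "c \<cdot> s = h" "e \<cdot> s = Id C (Ob X N)"
    by (rule universal_fill_lift[OF u h(1), of "Id C (Ob X N)"]) (use h V A in \<open>auto simp: subset_iff\<close>)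
  have "h \<cdot> e = c"
  proof (rule rel_hom_obj_eq[OF L A])
    show "v \<cdot> h \<cdot> e = v \<cdot> c" using h D V by (simp add: comp_reduce[OF h(5)])
    show "u \<sigma> \<cdot> h \<cdot> e = u \<sigma> \<cdot> c" if t: "\<sigma> \<in> A" for \<sigma> using h(1-3) D V t by (simp add: comp_reduce[OF h(4)[OF t]])
  qed (use h D V in simp_all)
  have "s \<cdot> e = Id C (Dom C c)"
    by (rule universal_fill_eq[OF u])
      (use s(1-3) D h(1-3) \<open>h \<cdot> e = c\<close> in \<open>simp_all add: comp_reduce[OF s(4)] comp_reduce[OF s(5)]\<close>)
  then have "s \<in> Cov C" using iso_Cov[of s e] s D h by simp
  then have "h \<in> Cov C" using comp_Cov[of s c] s D by simp
  moreover have "is_rel_restr C X f N A L u v h" using h by (simp add: is_rel_restr_def)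
  ultimately show ?thesis using that by blast
qed

end

section \<open>Collapsing simplicial subsets along a vertex\<close>

text \<open>Simplicial subsets of \<open>\<Delta>\<^sup>N\<close> are described by the vertex sets of their faces. Whether \<open>{}\<close> belongs to \<open>K\<close>
  does not affect \<open>cplx N K\<close>; counting it as a face lets a vertex be glued to the empty complex in the same
  way as a simplex to its horn.\<close>

definition cplx :: "nat \<Rightarrow> nat set set \<Rightarrow> nat list set" where
  "cplx N K = {\<sigma> \<in> simplex N. set \<sigma> \<in> K}"

definition down_closed :: "'a set set \<Rightarrow> bool" where
  "down_closed K \<longleftrightarrow> (\<forall>s\<in>K. \<forall>t. t \<subseteq> s \<longrightarrow> t \<in> K)"

lemma sub_sset_cplx: "down_closed K \<Longrightarrow> sub_sset N (cplx N K)"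
  unfolding sub_sset_def cplx_def down_closed_def using set_mcomp_subset by auto

lemma cplx_mono: "K \<subseteq> K' \<Longrightarrow> cplx N K \<subseteq> cplx N K'"
  by (auto simp: cplx_def)

lemma horn_subset: "horn k i \<subseteq> simplex k" and boundary_subset: "boundary k \<subseteq> simplex k"
  by (auto simp: horn_def boundary_def)

lemma sorted_list_simplex:
  assumes "finite s" "s \<noteq> {}" "s \<subseteq> {0..N}"
  shows "sorted_list_of_set s \<in> simplex N"
  using assms by (auto simp: simplex_iff)

context simplicial_morphism
begin

lemma pt_reindex:
  assumes p: "pt N S T x y" and \<theta>: "\<theta> \<in> simplex N" "dim \<theta> = k" and S': "S' \<subseteq> simplex k"
    and SS': "\<And>\<sigma>. \<sigma> \<in> S' \<Longrightarrow> mcomp \<theta> \<sigma> \<in> S"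
  shows "pt k S' T (\<lambda>\<sigma>. x (mcomp \<theta> \<sigma>)) (Op Y N \<theta> \<cdot> y)"
  unfolding pt_iff
proof (intro conjI ballI)
  note P = ptD[OF p]
  fix \<alpha> assume a: "\<alpha> \<in> S'"
  then have s: "mcomp \<theta> \<alpha> \<in> S" and ak: "\<alpha> \<in> simplex k" using SS' S' by auto
  show "x (mcomp \<theta> \<alpha>) \<in> Arr C" "Dom C (x (mcomp \<theta> \<alpha>)) = T" "Cod C (x (mcomp \<theta> \<alpha>)) = Ob X (dim \<alpha>)"
    using P(1-3)[OF s] by simp_all
  show "f (dim \<alpha>) \<cdot> x (mcomp \<theta> \<alpha>) = Op Y k \<alpha> \<cdot> Op Y N \<theta> \<cdot> y"
    using P(8)[OF s] P(5-7) \<theta> ak by (simp add: Op_Op_comp)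
  fix \<beta> assume b: "\<beta> \<in> simplex (dim \<alpha>)"
  show "x (mcomp \<theta> (mcomp \<alpha> \<beta>)) = Op X (dim \<alpha>) \<beta> \<cdot> x (mcomp \<theta> \<alpha>)"
    using P(4)[OF s, of \<beta>] b ak \<theta> by (simp add: mcomp_assoc)
qed (use ptD[OF p] \<theta> in simp_all)

text \<open>Gluing a simplex \<open>\<sigma>\<close> with distinct vertices to \<open>S\<close> along \<open>A\<close>. Every simplex that is added is \<open>\<sigma> \<circ> \<alpha>\<close> for a
  unique \<open>\<alpha>\<close>, so extending a point from \<open>S\<close> over \<open>\<sigma>\<close> is the same as filling its restriction to \<open>A\<close>.\<close>

lemma extends_attach:
  assumes S: "sub_sset N S" and \<sigma>: "\<sigma> \<in> simplex N" "distinct \<sigma>" and k: "dim \<sigma> = k"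
    and A: "A \<subseteq> simplex k" and SA: "\<And>\<alpha>. \<alpha> \<in> simplex k \<Longrightarrow> mcomp \<sigma> \<alpha> \<in> S \<longleftrightarrow> \<alpha> \<in> A"
    and ext: "extends k A (simplex k)"
  shows "extends N S (S \<union> mcomp \<sigma> ` simplex k)"
  unfolding extends_def
proof (intro allI impI)
  fix T x y assume p: "pt N S T x y"
  note P = ptD[OF p]
  have \<sigma>': "\<alpha> \<in> simplex k \<Longrightarrow> mcomp \<sigma> \<alpha> \<in> simplex N" for \<alpha> using \<sigma> k by simp
  have dimc: "dim (mcomp \<sigma> \<alpha>) = dim \<alpha>" for \<alpha> by simp
  have q: "pt k A T (\<lambda>\<alpha>. x (mcomp \<sigma> \<alpha>)) (Op Y N \<sigma> \<cdot> y)"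
    by (rule pt_reindex[OF p \<sigma>(1) k A]) (use SA A in blast)
  obtain c e where u: "universal_fill k A (\<lambda>\<alpha>. x (mcomp \<sigma> \<alpha>)) (Op Y N \<sigma> \<cdot> y) c e"
    using extends_simplexD[OF ext A q] .
  note D = universal_fillD[OF u]
  have cT: "Cod C c = T" using D(3) P(5-7) \<sigma> by simp
\<comment> \<open>New simplices get their value from the filler \<open>e\<close> through their unique factorisation over \<open>\<sigma>\<close>.\<close>
  define inv where "inv \<tau> = (SOME \<alpha>. \<alpha> \<in> simplex k \<and> mcomp \<sigma> \<alpha> = \<tau>)" for \<tau>
  have inv: "inv (mcomp \<sigma> \<alpha>) = \<alpha>" if "\<alpha> \<in> simplex k" for \<alpha>
  proof -
    have "inv (mcomp \<sigma> \<alpha>) \<in> simplex k \<and> mcomp \<sigma> (inv (mcomp \<sigma> \<alpha>)) = mcomp \<sigma> \<alpha>"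
      unfolding inv_def by (rule someI[of _ \<alpha>]) (use that in simp)
    then show ?thesis using mcomp_inj[OF \<sigma>(2,1)] that k by blast
  qed
  define x' where "x' \<tau> = (if \<tau> \<in> S then x \<tau> \<cdot> c else Op X k (inv \<tau>) \<cdot> e)" for \<tau>
  have x'S: "x' \<tau> = x \<tau> \<cdot> c" if "\<tau> \<in> S" for \<tau> using that by (simp add: x'_def)
  have x'\<sigma>: "x' (mcomp \<sigma> \<alpha>) = Op X k \<alpha> \<cdot> e" if "\<alpha> \<in> simplex k" for \<alpha>
  proof (cases "mcomp \<sigma> \<alpha> \<in> S")
    case True
    then have "\<alpha> \<in> A" using SA that by blast
    then show ?thesis using D(8) x'S[OF True] by simp
  next
    case False
    then show ?thesis using inv[OF that] by (simp add: x'_def)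
  qed
  have px: "pt N S (Dom C c) x' (y \<cdot> c)"
    using pt_cong[OF pt_comp[OF p _ D(2) cT] S] S x'S by (simp add: sub_sset_def)
  note Q = ptD[OF px]
  have "universal_ext N S (S \<union> mcomp \<sigma> ` simplex k) x y c x'"
    unfolding universal_ext_def
  proof (intro conjI allI impI ballI; (elim conjE)?)
    show "pt N (S \<union> mcomp \<sigma> ` simplex k) (Dom C c) x' (y \<cdot> c)"
      unfolding pt_iff
    proof (intro conjI ballI)
      fix \<tau> assume "\<tau> \<in> S \<union> mcomp \<sigma> ` simplex k"
      then consider "\<tau> \<in> S" | \<alpha> where "\<tau> = mcomp \<sigma> \<alpha>" "\<alpha> \<in> simplex k" by blast
      then have "x' \<tau> \<in> Arr C \<and> Dom C (x' \<tau>) = Dom C c \<and> Cod C (x' \<tau>) = Ob X (dim \<tau>) \<and>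
        f (dim \<tau>) \<cdot> x' \<tau> = Op Y N \<tau> \<cdot> y \<cdot> c \<and>
        (\<forall>\<beta>\<in>simplex (dim \<tau>). x' (mcomp \<tau> \<beta>) = Op X (dim \<tau>) \<beta> \<cdot> x' \<tau>)"
      proof cases
        case 1
        then show ?thesis using Q by simp
      next
        case 2
        have 3: "f (dim \<tau>) \<cdot> x' \<tau> = Op Y N \<tau> \<cdot> y \<cdot> c"
        proof -
          have "f (dim \<tau>) \<cdot> x' \<tau> = Op Y k \<alpha> \<cdot> f k \<cdot> e"
            unfolding 2(1) x'\<sigma>[OF 2(2)] using 2 D(4,6) by (simp add: natural_comp)
          also have "\<dots> = Op Y k \<alpha> \<cdot> Op Y N \<sigma> \<cdot> y \<cdot> c" using D(2,7) P(5-7) cT \<sigma> k by simp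
          also have "\<dots> = Op Y N \<tau> \<cdot> y \<cdot> c" unfolding 2(1) using D(2) P(5-7) cT \<sigma> k 2(2) by (simp add: Op_Op_comp)
          finally show ?thesis .
        qed
        have 4: "x' (mcomp \<tau> \<beta>) = Op X (dim \<tau>) \<beta> \<cdot> x' \<tau>" if b: "\<beta> \<in> simplex (dim \<tau>)" for \<beta>
        proof -
          have b': "\<beta> \<in> simplex (dim \<alpha>)" using b 2 by simp
          have "mcomp \<tau> \<beta> = mcomp \<sigma> (mcomp \<alpha> \<beta>)" using 2 k b' by (simp add: mcomp_assoc)
          moreover have "mcomp \<alpha> \<beta> \<in> simplex k" using 2 b' by simp
          ultimately show ?thesis using x'\<sigma> 2 D(4,6) b' by (simp add: Op_Op_comp)
        qed
        show ?thesis using 3 4 x'\<sigma>[OF 2(2)] 2 D(4-6) by simp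
      qed
      then show "x' \<tau> \<in> Arr C" "Dom C (x' \<tau>) = Dom C c" "Cod C (x' \<tau>) = Ob X (dim \<tau>)"
        "f (dim \<tau>) \<cdot> x' \<tau> = Op Y N \<tau> \<cdot> y \<cdot> c"
        "\<And>\<beta>. \<beta> \<in> simplex (dim \<tau>) \<Longrightarrow> x' (mcomp \<tau> \<beta>) = Op X (dim \<tau>) \<beta> \<cdot> x' \<tau>" by blast+
    qed (use Q(5-7) in simp_all)
  next
    fix t z assume a: "t \<in> Arr C" "Cod C t = Dom C y" "pt N (S \<union> mcomp \<sigma> ` simplex k) (Dom C t) z (y \<cdot> t)"
      "\<forall>\<sigma>\<in>S. z \<sigma> = x \<sigma> \<cdot> t"
    note Z = ptD[OF a(3)]
    have idk: "mcomp \<sigma> [0..<Suc k] = \<sigma>" using mcomp_id_right[OF \<sigma>(1)] k by simp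
    have \<sigma>m: "\<sigma> \<in> S \<union> mcomp \<sigma> ` simplex k" using idk id_simplex[of k] by (metis UnI2 imageI)
    have z\<sigma>: "z (mcomp \<sigma> \<alpha>) = Op X k \<alpha> \<cdot> z \<sigma>" if "\<alpha> \<in> simplex k" for \<alpha>
      using Z(4)[OF \<sigma>m] that k by simp
    have 1: "f k \<cdot> z \<sigma> = (Op Y N \<sigma> \<cdot> y) \<cdot> t" using Z(8)[OF \<sigma>m] k a(1,2) P(5-7) \<sigma> by simp
    have 2: "Op X k \<alpha> \<cdot> z \<sigma> = x (mcomp \<sigma> \<alpha>) \<cdot> t" if "\<alpha> \<in> A" for \<alpha>
      using z\<sigma>[of \<alpha>] that A SA a(4) by auto
    obtain h where h: "h \<in> Arr C" "Dom C h = Dom C t" "Cod C h = Dom C c" "c \<cdot> h = t" "e \<cdot> h = z \<sigma>"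
      by (rule universal_fill_lift[OF u a(1) _ _ _ _ 1 2]) (use a(2) Z(1-3)[OF \<sigma>m] k P(5-7) \<sigma> in simp_all)
    have "x' \<tau> \<cdot> h = z \<tau>" if t: "\<tau> \<in> S \<union> mcomp \<sigma> ` simplex k" for \<tau>
    proof (cases "\<tau> \<in> S")
      case True
      then show ?thesis using x'S h(1-4) a(4) P(1-3) cT D(2) by simp
    next
      case False
      then obtain \<alpha> where al: "\<tau> = mcomp \<sigma> \<alpha>" "\<alpha> \<in> simplex k" using t by blast
      then show ?thesis using x'\<sigma> z\<sigma> h D(4-6) by simp
    qed
    with h show "\<exists>h. h \<in> Arr C \<and> Dom C h = Dom C t \<and> Cod C h = Dom C c \<and> c \<cdot> h = t \<and>
       (\<forall>\<sigma>\<in>S \<union> mcomp \<sigma> ` simplex k. x' \<sigma> \<cdot> h = z \<sigma>)" by blast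
  next
    fix h h' assume a: "h \<in> Arr C" "h' \<in> Arr C" "Dom C h = Dom C h'" "Cod C h = Dom C c" "Cod C h' = Dom C c"
        "c \<cdot> h = c \<cdot> h'" "\<forall>\<tau>\<in>S \<union> mcomp \<sigma> ` simplex k. x' \<tau> \<cdot> h = x' \<tau> \<cdot> h'"
    have "x' (mcomp \<sigma> [0..<Suc k]) \<cdot> h = x' (mcomp \<sigma> [0..<Suc k]) \<cdot> h'" using a(7) id_simplex by blast
    then have "e \<cdot> h = e \<cdot> h'" unfolding x'\<sigma>[OF id_simplex] using D(4-6) by (simp del: upt_Suc)
    then show "h = h'" using universal_fill_eq[OF u a(1-6)] by blast
  qed (use D(1) cT P(6) x'S in simp_all)
  then show "\<exists>c x'. universal_ext N S (S \<union> mcomp \<sigma> ` simplex k) x y c x'" by blast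
qed

text \<open>For \<open>k = 0\<close> the only horn \<open>horn 0 0\<close> is empty, and the condition says that \<open>f 0\<close> is a cover.\<close>

definition fibration :: bool where
  "fibration \<longleftrightarrow> (\<forall>k. \<forall>i\<le>k. extends k (horn k i) (simplex k))"

text \<open>The faces \<open>t\<close> and \<open>insert v t\<close> are added together, by gluing a simplex along the horn that omits the face
  opposite to \<open>v\<close>. For \<open>t = {}\<close> this adds the vertex \<open>v\<close>, glued along the empty horn.\<close>

lemma extends_elementary:
  assumes fib: "fibration" and K: "down_closed K" and v: "v \<notin> t" "insert v t \<subseteq> {0..N}"
    and n: "t \<notin> K" "insert v t \<notin> K"
    and sub: "\<And>s. s \<subseteq> insert v t \<Longrightarrow> s \<noteq> t \<Longrightarrow> s \<noteq> insert v t \<Longrightarrow> s \<in> K"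
  shows "extends N (cplx N K) (cplx N (K \<union> {t, insert v t}))"
proof -
  have fin: "finite (insert v t)" by (rule finite_subset[OF v(2)]) simp
  define \<sigma> where "\<sigma> = sorted_list_of_set (insert v t)"
  define k where "k = card t"
  have set\<sigma>: "set \<sigma> = insert v t" using fin by (simp add: \<sigma>_def del: sorted_list_of_set_insert_remove)
  have \<sigma>: "\<sigma> \<in> simplex N" "distinct \<sigma>"
    unfolding \<sigma>_def using sorted_list_simplex[OF fin _ v(2)] by (simp_all del: sorted_list_of_set_insert_remove)
  have len: "length \<sigma> = Suc k" using fin v(1)
    by (simp add: \<sigma>_def k_def del: sorted_list_of_set_insert_remove)
  then have k: "dim \<sigma> = k" by simp
  obtain i where i: "i \<le> k" "\<sigma> ! i = v" using set\<sigma> len by (metis in_set_conv_nth insertI1 less_Suc_eq_le)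
  have im: "(!) \<sigma> ` {0..k} = insert v t"
    unfolding set\<sigma>[symmetric] set_conv_nth len by (force simp: less_Suc_eq_le)
  have inj: "inj_on ((!) \<sigma>) {0..k}" using \<sigma>(2) len by (intro inj_on_nth) auto
\<comment> \<open>As \<open>i\<close> is the position of \<open>v\<close> in \<open>\<sigma>\<close>, faces of \<open>\<sigma>\<close> outside the horn are those whose vertices include \<open>t\<close>.\<close>
  have imt: "(!) \<sigma> ` ({0..k} - {i}) = t"
    using inj_on_image_set_diff[OF inj, of "{0..k}" "{i}"] im i v(1) by auto
  have horn: "mcomp \<sigma> \<alpha> \<in> cplx N K \<longleftrightarrow> \<alpha> \<in> horn k i" if al: "\<alpha> \<in> simplex k" for \<alpha>
  proof -
    have sa: "set \<alpha> \<subseteq> {0..k}" using al by (simp add: simplex_iff)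
    have "{0..k} - {i} \<subseteq> set \<alpha> \<longleftrightarrow> t \<subseteq> (!) \<sigma> ` set \<alpha>"
      unfolding imt[symmetric] image_subset_iff subset_iff[of "{0..k} - {i}"]
      using inj_on_image_mem_iff[OF inj _ sa] by blast
    moreover have "(!) \<sigma> ` set \<alpha> \<subseteq> insert v t" using im sa by blast
    ultimately have "{0..k} - {i} \<subseteq> set \<alpha> \<longleftrightarrow> (!) \<sigma> ` set \<alpha> \<notin> K"
      using sub[of "(!) \<sigma> ` set \<alpha>"] n by (metis subset_insert insert_subset subset_antisym subset_insertI subset_refl)
    then show ?thesis using al \<sigma> k by (simp add: cplx_def horn_def set_mcomp)
  qed
  have "cplx N K \<union> mcomp \<sigma> ` simplex k = cplx N (K \<union> {t, insert v t})" (is "?L = ?R")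
  proof
    have "mcomp \<sigma> \<alpha> \<in> ?R" if "\<alpha> \<in> simplex k" for \<alpha>
      using that \<sigma> k sub[of "set (mcomp \<sigma> \<alpha>)"] set_mcomp_subset[of \<sigma> N \<alpha>] set\<sigma> by (auto simp: cplx_def)
    then show "?L \<subseteq> ?R" using cplx_mono[OF Un_upper1, of N K "{t, insert v t}"] by blast
    show "?R \<subseteq> ?L"
    proof
      fix \<tau> assume t: "\<tau> \<in> ?R"
      show "\<tau> \<in> ?L"
      proof (cases "set \<tau> \<in> K")
        case True
        then show ?thesis using t by (simp add: cplx_def)
      next
        case False
        then have "\<tau> \<in> simplex N" "set \<tau> \<subseteq> set \<sigma>" using t set\<sigma> by (auto simp: cplx_def)
        then show ?thesis using factor_ex[OF \<sigma>(2,1)] k by blast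
      qed
    qed
  qed
  with extends_attach[OF sub_sset_cplx[OF K] \<sigma> k horn_subset horn] fib i
  show ?thesis by (simp add: fibration_def)
qed

text \<open>The new faces are matched in pairs \<open>t - {v}\<close>, \<open>insert v t\<close>. Adding the pairs in the order of increasing
  size makes every step elementary: all other subsets of \<open>insert v t\<close> belong to \<open>K\<close> or to smaller pairs.\<close>

lemma extends_collapse:
  assumes fib: "fibration" and K': "K' \<subseteq> Pow {0..N}" "down_closed K'" and v: "v \<le> N"
    and K: "K \<subseteq> K'" "down_closed K"
    and vK: "\<And>t. t \<in> K' - K \<Longrightarrow> insert v t \<in> K' - K \<and> t - {v} \<in> K' - K"
  shows "extends N (cplx N K) (cplx N K')"
  using K vK
proof (induction "card (K' - K)" arbitrary: K rule: less_induct)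
  case (less K)
  have fin: "finite (K' - K)" by (rule finite_subset[of _ "Pow {0..N}"]) (use K'(1) in auto)
  show ?case
  proof (cases "K' - K = {}")
    case True
    then have "K = K'" using less.prems(1) by blast
    then show ?thesis using extends_refl[OF sub_sset_cplx[OF K'(2)]] by simp
  next
    case False
\<comment> \<open>A new face of least size does not contain \<open>v\<close>, and its proper subsets are old.\<close>
    define t where "t = arg_min_on card (K' - K)"
    have t: "t \<in> K' - K" unfolding t_def using arg_min_if_finite(1)[OF fin False] .
    have tmin: "s \<in> K" if "s \<in> K'" "card s < card t" for s
      using arg_min_if_finite(2)[OF fin False, of card] that unfolding t_def by blast
    have fs: "finite s" if "s \<in> K'" for s by (rule finite_subset[of _ "{0..N}"]) (use that K'(1) in auto)
    have vt: "v \<notin> t"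
    proof
      assume "v \<in> t"
      then have "card (t - {v}) < card t" using fs t by (intro psubset_card_mono) auto
      then show False using tmin less.prems(3)[OF t] by blast
    qed
    note it = less.prems(3)[OF t]
    let ?K = "K \<union> {t, insert v t}"
    have sub: "s \<in> K" if s: "s \<subseteq> insert v t" "s \<noteq> t" "s \<noteq> insert v t" for s
    proof -
      have sK: "s \<in> K'" using s(1) it K'(2) unfolding down_closed_def by blast
      have "s - {v} \<subset> t" using s vt by auto
      then have "card (s - {v}) < card t" using fs[of t] t by (intro psubset_card_mono) auto
      then have "s - {v} \<in> K" using tmin sK K'(2) unfolding down_closed_def by blast
      then show ?thesis using less.prems(3)[of s] sK by blast
    qed
    have 1: "extends N (cplx N K) (cplx N ?K)"
      by (rule extends_elementary[OF fib less.prems(2) vt]) (use it t K'(1) sub in auto)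
    have "down_closed ?K"
      unfolding down_closed_def
    proof (intro ballI allI impI)
      fix s r assume "s \<in> ?K" "r \<subseteq> s"
      then show "r \<in> ?K" using less.prems(2) sub[of r] unfolding down_closed_def by blast
    qed
    moreover have "card (K' - ?K) < card (K' - K)" using t fin by (intro psubset_card_mono) auto
    moreover have "insert v s \<in> K' - ?K \<and> s - {v} \<in> K' - ?K" if s: "s \<in> K' - ?K" for s
    proof -
      have "insert v s \<in> K' - K \<and> s - {v} \<in> K' - K" using less.prems(3)[of s] s by blast
      moreover have "insert v s \<noteq> t" "s - {v} \<noteq> insert v t" using vt by auto
      moreover have "insert v s \<noteq> insert v t"
      proof
        assume e: "insert v s = insert v t"
        then have "s = t \<or> s = insert v t" using vt by (metis insert_absorb insert_ident)
        then show False using s by blast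
      qed
      moreover have "s - {v} \<noteq> t"
      proof
        assume "s - {v} = t"
        then have "s = t \<or> s = insert v t" by auto
        then show False using s by blast
      qed
      ultimately show ?thesis by blast
    qed
    ultimately have "extends N (cplx N ?K) (cplx N K')"
      using less.hyps[of ?K] less.prems(1) t it by blast
    with 1 show ?thesis
      using extends_trans cplx_mono[of K ?K] cplx_mono[of ?K K'] less.prems(1) t it by (meson Diff_iff Un_least Un_upper1 empty_subsetI insert_subset)
  qed
qed

end

section \<open>Bundles, hypercovers and their composites\<close>

text \<open>For \<open>k > 0\<close> this is the join \<open>\<partial>\<Delta>\<^sup>k\<^sup>-\<^sup>1 \<star> \<Delta>\<^sup>l\<close>; for \<open>k = 0\<close> it is empty. Points on it over \<open>Y\<^sub>k\<^sub>+\<^sub>l\<close> thus give the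
  object \<open>B\<close> for \<open>k > 0\<close> and \<open>Y\<close> for \<open>k = 0\<close>, which makes the two clauses in the definition of the higher
  morphism space instances of one construction.\<close>

definition bdry_part :: "nat \<Rightarrow> nat \<Rightarrow> nat list set" where
  "bdry_part k l = {\<sigma> \<in> simplex (k + l). \<not> {0..<k} \<subseteq> set \<sigma>}"

lemma cplx_horn: "horn N i = cplx N {s. s \<subseteq> {0..N} \<and> \<not> {0..N} - {i} \<subseteq> s}"
  by (auto simp: horn_def cplx_def simplex_iff)

lemma cplx_bdry_part: "bdry_part k l = cplx (k + l) {s. s \<subseteq> {0..k + l} \<and> \<not> {0..<k} \<subseteq> s}"
  by (auto simp: bdry_part_def cplx_def simplex_iff)

lemma down_closed_not_superset: "down_closed {s. s \<subseteq> A \<and> \<not> B \<subseteq> s}"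
  unfolding down_closed_def by auto

lemma sub_sset_horn: "sub_sset N (horn N i)"
  unfolding cplx_horn by (rule sub_sset_cplx[OF down_closed_not_superset])

lemma sub_sset_bdry_part: "sub_sset (k + l) (bdry_part k l)"
  unfolding cplx_bdry_part by (rule sub_sset_cplx[OF down_closed_not_superset])

lemma bdry_part_subset: "bdry_part k l \<subseteq> simplex (k + l)"
  by (auto simp: bdry_part_def)

text \<open>The horn \<open>horn (k + m) (k + i)\<close> is the union of \<open>bdry_part k m\<close> with the join of \<open>\<Delta>\<^sup>k\<^sup>-\<^sup>1\<close> and
  \<open>horn m i\<close>.\<close>

lemma bdry_part_horn: "bdry_part k m \<subseteq> horn (k + m) (k + i)"
proof -
  have "{0..<k} \<subseteq> {0..k + m} - {k + i}" by auto
  then show ?thesis unfolding bdry_part_def horn_def by blast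
qed

lemma coface_simplex: "0 < k \<Longrightarrow> coface k i \<in> simplex k"
  unfolding simplex_iff coface_def by (auto simp: sorted_iff_nth_mono)

lemma length_coface [simp]: "length (coface k i) = k"
  by (simp add: coface_def)

lemma nth_coface: "j < k \<Longrightarrow> coface k i ! j = (if j < i then j else Suc j)"
  by (simp add: coface_def)

lemma distinct_coface: "distinct (coface k i)"
  unfolding distinct_conv_nth by (auto simp: nth_coface)

lemma set_coface:
  assumes "i \<le> k"
  shows "set (coface k i) = {0..k} - {i}"
proof
  show "set (coface k i) \<subseteq> {0..k} - {i}" by (auto simp: coface_def)
  show "{0..k} - {i} \<subseteq> set (coface k i)"
  proof
    fix j assume j: "j \<in> {0..k} - {i}"
    show "j \<in> set (coface k i)"
    proof (cases "j < i")
      case True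
      then show ?thesis using nth_coface[of j k i] nth_mem[of j "coface k i"] assms by simp
    next
      case False
      then have "coface k i ! (j - 1) = j" "j - 1 < k" using nth_coface[of "j - 1" k i] j by auto
      then show ?thesis using nth_mem[of "j - 1" "coface k i"] by simp
    qed
  qed
qed

lemma superset_mcomp_iff:
  assumes "distinct \<sigma>" "\<sigma> \<in> simplex N" "\<alpha> \<in> simplex (dim \<sigma>)" "\<beta> \<subseteq> {0..dim \<sigma>}"
  shows "(!) \<sigma> ` \<beta> \<subseteq> set (mcomp \<sigma> \<alpha>) \<longleftrightarrow> \<beta> \<subseteq> set \<alpha>"
proof -
  have len: "length \<sigma> = Suc (dim \<sigma>)" using simplex_length assms(2) by blast
  have inj: "inj_on ((!) \<sigma>) {0..dim \<sigma>}" using assms(1) len by (intro inj_on_nth) auto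
  have "set \<alpha> \<subseteq> {0..dim \<sigma>}" using assms(3) by (simp add: simplex_iff)
  then show ?thesis unfolding set_mcomp image_subset_iff subset_iff[of \<beta>]
    using inj_on_image_mem_iff[OF inj, of _ "set \<alpha>"] assms(4) by blast
qed

lemma image_nth: "(!) \<sigma> ` {0..<length \<sigma>} = set \<sigma>"
  by (force simp: set_conv_nth)

lemma coface_horn_iff:
  assumes "0 < k" "i \<le> k" "\<alpha> \<in> simplex (k - 1)"
  shows "mcomp (coface k i) \<alpha> \<in> horn k i \<longleftrightarrow> \<alpha> \<in> boundary (k - 1)"
proof -
  have e: "{0..k - 1} = {0..<length (coface k i)}" using assms(1) by auto
  have im: "(!) (coface k i) ` {0..k - 1} = set (coface k i)" unfolding e by (rule image_nth)
  have "set (coface k i) \<subseteq> set (mcomp (coface k i) \<alpha>) \<longleftrightarrow> {0..k - 1} \<subseteq> set \<alpha>"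
    using superset_mcomp_iff[OF distinct_coface coface_simplex[OF assms(1), of i], of \<alpha> "{0..k - 1}"] assms(3)
    unfolding im by simp
  then show ?thesis using assms set_coface[OF assms(2)] coface_simplex[OF assms(1), of i]
    by (simp add: horn_def boundary_def)
qed

lemma horn_un_coface:
  assumes "0 < k" "i \<le> k"
  shows "horn k i \<union> mcomp (coface k i) ` simplex (k - 1) = boundary k"
proof
  have "mcomp (coface k i) \<alpha> \<in> boundary k" if "\<alpha> \<in> simplex (k - 1)" for \<alpha>
    using set_mcomp_subset[OF coface_simplex[OF assms(1)], of \<alpha> i] that set_coface[OF assms(2)]
      coface_simplex[OF assms(1), of i] assms(2) by (auto simp: boundary_def)
  then show "horn k i \<union> mcomp (coface k i) ` simplex (k - 1) \<subseteq> boundary k"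
    by (auto simp: horn_def boundary_def)
  show "boundary k \<subseteq> horn k i \<union> mcomp (coface k i) ` simplex (k - 1)"
  proof
    fix \<tau> assume t: "\<tau> \<in> boundary k"
    show "\<tau> \<in> horn k i \<union> mcomp (coface k i) ` simplex (k - 1)"
    proof (cases "\<tau> \<in> horn k i")
      case False
      then have "set \<tau> \<subseteq> set (coface k i)" "\<tau> \<in> simplex k"
        using t set_coface[OF assms(2)] by (auto simp: boundary_def horn_def simplex_iff)
      then show ?thesis using factor_ex[OF distinct_coface coface_simplex[OF assms(1)], of \<tau> i] by auto
    qed simp
  qed
qed

lemma horn_0: "horn 0 0 = {}" and boundary_0: "boundary 0 = {}"
  by (auto simp: horn_def boundary_def simplex_iff subset_singleton_iff)

context simplicial_morphism
begin

text \<open>Gluing in the missing face along its own boundary turns a horn into the boundary of the simplex.\<close>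

lemma fibration_of_boundary:
  assumes "\<And>k. extends k (boundary k) (simplex k)"
  shows "fibration"
  unfolding fibration_def
proof (intro allI impI)
  fix k i :: nat assume i: "i \<le> k"
  show "extends k (horn k i) (simplex k)"
  proof (cases "k = 0")
    case True
    then show ?thesis using assms[of 0] i by (simp add: horn_0 boundary_0)
  next
    case False
    then have k: "0 < k" by simp
    have "extends k (horn k i) (horn k i \<union> mcomp (coface k i) ` simplex (k - 1))"
      by (rule extends_attach[OF sub_sset_horn coface_simplex[OF k] distinct_coface _ boundary_subset _ assms])
        (use coface_horn_iff[OF k i] in simp_all)
    then have "extends k (horn k i) (boundary k)" using horn_un_coface[OF k i] by simp
    from extends_trans[OF this assms _ boundary_subset] show ?thesis using horn_un_coface[OF k i] by blast
  qed
qed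

text \<open>A horn is a cone with apex \<open>i\<close>, hence it collapses to nothing when \<open>{}\<close> is counted as a face.\<close>

lemma extends_empty_horn:
  assumes "fibration" "0 < N" "i \<le> N"
  shows "extends N {} (horn N i)"
proof -
  have "extends N (cplx N {}) (cplx N {s. s \<subseteq> {0..N} \<and> \<not> {0..N} - {i} \<subseteq> s})"
    by (rule extends_collapse[OF assms(1) _ down_closed_not_superset assms(3)])
      (use assms(2,3) in \<open>auto simp: down_closed_def\<close>)
  then show ?thesis unfolding cplx_horn by (simp add: cplx_def)
qed

text \<open>The join with \<open>\<Delta>\<^sup>l\<close> is a cone with apex any vertex of \<open>\<Delta>\<^sup>l\<close>, for instance the last one.\<close>

lemma extends_empty_bdry:
  assumes "fibration"
  shows "extends (k + l) {} (bdry_part k l)"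
proof -
  have "extends (k + l) (cplx (k + l) {}) (cplx (k + l) {s. s \<subseteq> {0..k + l} \<and> \<not> {0..<k} \<subseteq> s})"
  proof (rule extends_collapse[OF assms(1) _ down_closed_not_superset, where v = "k + l"])
    fix t assume t: "t \<in> {s. s \<subseteq> {0..k + l} \<and> \<not> {0..<k} \<subseteq> s} - {}"
    have "k + l \<notin> {0..<k}" by simp
    then show "insert (k + l) t \<in> {s. s \<subseteq> {0..k + l} \<and> \<not> {0..<k} \<subseteq> s} - {} \<and>
         t - {k + l} \<in> {s. s \<subseteq> {0..k + l} \<and> \<not> {0..<k} \<subseteq> s} - {}" using t by auto
  qed (auto simp: down_closed_def)
  then show ?thesis unfolding cplx_bdry_part by (simp add: cplx_def)
qed

text \<open>A face outside \<open>bdry_part k m\<close> contains all vertices below \<open>k\<close>; neither this nor membership in the horn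
  changes when the vertex \<open>k + i\<close> is added or removed.\<close>

lemma extends_bdry_horn:
  assumes "fibration" "i \<le> m"
  shows "extends (k + m) (bdry_part k m) (horn (k + m) (k + i))"
  unfolding cplx_bdry_part cplx_horn
proof (rule extends_collapse[OF assms(1) _ down_closed_not_superset, where v = "k + i"])
  let ?A = "{s. s \<subseteq> {0..k + m} \<and> \<not> {0..k + m} - {k + i} \<subseteq> s}"
  let ?B = "{s. s \<subseteq> {0..k + m} \<and> \<not> {0..<k} \<subseteq> s}"
  have "{0..<k} \<subseteq> {0..k + m} - {k + i}" by auto
  then show "?B \<subseteq> ?A" by blast
  fix t assume t: "t \<in> ?A - ?B"
  have "k + i \<notin> {0..<k}" "k + i \<in> {0..k + m}" using assms(2) by simp_all
  then show "insert (k + i) t \<in> ?A - ?B \<and> t - {k + i} \<in> ?A - ?B" using t by blast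
qed (use assms(2) in \<open>auto intro: down_closed_not_superset\<close>)

lemma extends_bdry_simplex:
  assumes "fibration"
  shows "extends (k + l) (bdry_part k l) (simplex (k + l))"
proof -
  have "extends (k + l) (horn (k + l) (k + 0)) (simplex (k + l))" using assms by (simp add: fibration_def)
  from extends_trans[OF extends_bdry_horn[OF assms, of 0 l k] this bdry_part_horn horn_subset]
  show ?thesis by simp
qed

lemma fibration_stack:
  assumes fib: "fibration" and "lie_groupoid C \<infinity> X" "lie_groupoid C \<infinity> Y"
  shows "stack C \<infinity> X Y f"
  unfolding stack_def
proof (intro conjI allI impI)
  fix k i :: nat assume k: "0 < k" and i: "i \<le> k"
  obtain L u v where L: "is_rel_hom_obj C X Y f k (horn k i) L u v"
    using rel_hom_obj_extend[OF rel_hom_obj_empty extends_empty_horn[OF fib k i] _ horn_subset] by blast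
  have e: "extends k (horn k i) (simplex k)" using fib i by (simp add: fibration_def)
  obtain h where "is_rel_restr C X f k (horn k i) L u v h" "h \<in> Cov C"
    using cover_of_extends[OF L horn_subset e] .
  with L show "\<exists>L u v h. is_rel_hom_obj C X Y f k (horn k i) L u v \<and>
        is_rel_restr C X f k (horn k i) L u v h \<and> h \<in> Cov C \<and> (\<infinity> < enat k \<longrightarrow> is_iso C h)"
    by (intro exI conjI) simp_all
qed (use assms simplicial_morphism in simp_all)

end

context covers
begin

lemma simplicial_map_comp:
  assumes "simplicial_map C E U p" "simplicial_map C U X f"
  shows "simplicial_map C E X (\<lambda>k. f k \<cdot> p k)"
proof -
  interpret p: simplicial_morphism C E U p by unfold_locales (rule assms)
  interpret f: simplicial_morphism C U X f by unfold_locales (rule assms)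
  show ?thesis unfolding simplicial_map_def
    by (simp add: mono_maps_iff p.natural f.natural_comp)
qed

text \<open>Lift in two steps, first from \<open>X\<close> to \<open>U\<close> and then from \<open>U\<close> to \<open>E\<close>. The intermediate point of \<open>U\<close> lives on
  the whole simplex, so it is an arrow over which the second problem can be posed.\<close>

lemma extends_comp:
  assumes "simplicial_map C E U p" "simplicial_map C U X f" "A \<subseteq> simplex N"
    "simplicial_morphism.extends C E U p N A (simplex N)" "simplicial_morphism.extends C U X f N A (simplex N)"
  shows "simplicial_morphism.extends C E X (\<lambda>k. f k \<cdot> p k) N A (simplex N)"
proof -
  interpret p: simplicial_morphism C E U p by unfold_locales (rule assms)
  interpret f: simplicial_morphism C U X f by unfold_locales (rule assms)
  interpret g: simplicial_morphism C E X "\<lambda>k. f k \<cdot> p k" by unfold_locales (rule simplicial_map_comp[OF assms(1,2)])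
  show ?thesis
  proof (rule g.extends_simplexI[OF assms(3)])
    fix T x y assume pt: "g.pt N A T x y"
    note P = g.ptD[OF pt]
    have AN: "\<sigma> \<in> simplex N" if "\<sigma> \<in> A" for \<sigma> using that assms(3) by blast
    have "f.pt N A T (\<lambda>\<sigma>. p (dim \<sigma>) \<cdot> x \<sigma>) y"
      unfolding f.pt_iff
    proof (intro conjI ballI)
      fix \<sigma> assume s: "\<sigma> \<in> A"
      show "f (dim \<sigma>) \<cdot> p (dim \<sigma>) \<cdot> x \<sigma> = Op X N \<sigma> \<cdot> y" using P(8)[OF s] P(1-3)[OF s] by simp
      fix \<alpha> assume "\<alpha> \<in> simplex (dim \<sigma>)"
      then show "p (dim (mcomp \<sigma> \<alpha>)) \<cdot> x (mcomp \<sigma> \<alpha>) = Op U (dim \<sigma>) \<alpha> \<cdot> p (dim \<sigma>) \<cdot> x \<sigma>"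
        using P(4)[OF s] P(1-3)[OF s] by (simp add: p.natural_comp)
    qed (use P in simp_all)
    then obtain c w where u: "f.universal_fill N A (\<lambda>\<sigma>. p (dim \<sigma>) \<cdot> x \<sigma>) y c w"
      using f.extends_simplexD[OF assms(5,3)] by blast
    note D = f.universal_fillD[OF u]
    have cT: "Cod C c = T" using D P by simp
    have pc: "g.pt N A (Dom C c) (\<lambda>\<sigma>. x \<sigma> \<cdot> c) (y \<cdot> c)" using g.pt_comp[OF pt assms(3) D(2) cT] .
    note Q = g.ptD[OF pc]
    have pw: "p.pt N A (Dom C c) (\<lambda>\<sigma>. x \<sigma> \<cdot> c) w"
      unfolding p.pt_iff
    proof (intro conjI ballI)
      fix \<sigma> assume s: "\<sigma> \<in> A"
      show "p (dim \<sigma>) \<cdot> x \<sigma> \<cdot> c = Op U N \<sigma> \<cdot> w" using D(8)[OF s] P(1-3)[OF s] D(2) cT by simp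
    qed (use Q D in auto)
    then obtain d e where v: "p.universal_fill N A (\<lambda>\<sigma>. x \<sigma> \<cdot> c) w d e"
      using p.extends_simplexD[OF assms(4,3)] by blast
    note D' = p.universal_fillD[OF v]
    have dc: "Cod C d = Dom C c" using D' D by simp
    have "g.universal_fill N A x y (c \<cdot> d) e"
      unfolding g.universal_fill_def
    proof (intro conjI allI impI ballI; (elim conjE)?)
      show "c \<cdot> d \<in> Cov C" using D(1) D'(1) dc by (intro comp_Cov)
      show "(f N \<cdot> p N) \<cdot> e = y \<cdot> c \<cdot> d"
        using D(2-7) D'(2-7) P(5-7) dc by (simp add: comp_reduce[OF D(7)])
    next
      fix \<sigma> assume s: "\<sigma> \<in> A"
      show "Op E N \<sigma> \<cdot> e = x \<sigma> \<cdot> c \<cdot> d" using D'(8)[OF s] P(1-3)[OF s] D(2) D'(2) cT dc by simp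
    next
      fix t z assume a: "t \<in> Arr C" "Cod C t = Dom C y" "z \<in> Arr C" "Dom C z = Dom C t" "Cod C z = Ob E N"
        "(f N \<cdot> p N) \<cdot> z = y \<cdot> t" "\<forall>\<sigma>\<in>A. Op E N \<sigma> \<cdot> z = x \<sigma> \<cdot> t"
      have tT: "Cod C t = T" using a P by simp
      obtain h where h: "h \<in> Arr C" "Dom C h = Dom C t" "Cod C h = Dom C c" "c \<cdot> h = t" "w \<cdot> h = p N \<cdot> z"
      proof (rule f.universal_fill_lift[OF u a(1,2), of "p N \<cdot> z"])
        show "f N \<cdot> p N \<cdot> z = y \<cdot> t" using a by simp
        fix \<sigma> assume s: "\<sigma> \<in> A"
        have "Op U N \<sigma> \<cdot> p N \<cdot> z = p (dim \<sigma>) \<cdot> Op E N \<sigma> \<cdot> z" using a(1-5) AN[OF s] by (simp add: p.natural_comp)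
        then show "Op U N \<sigma> \<cdot> p N \<cdot> z = (p (dim \<sigma>) \<cdot> x \<sigma>) \<cdot> t" using a(1,7) s P(1-3)[OF s] tT by simp
      qed (use a that in simp_all)
      have zh: "Op E N \<sigma> \<cdot> z = (x \<sigma> \<cdot> c) \<cdot> h" if s: "\<sigma> \<in> A" for \<sigma>
        using a(7) s h P(1-3)[OF s] D(2) cT by simp
      obtain k where k: "k \<in> Arr C" "Dom C k = Dom C h" "Cod C k = Dom C d" "d \<cdot> k = h" "e \<cdot> k = z"
        by (rule p.universal_fill_lift[OF v h(1) _ a(3) _ a(5) h(5)[symmetric] zh]) (use h a D in simp_all)
      have "(c \<cdot> d) \<cdot> k = t" using k h D(2) D'(2) dc by simp
      then show "\<exists>h. h \<in> Arr C \<and> Dom C h = Dom C t \<and> Cod C h = Dom C (c \<cdot> d) \<and> (c \<cdot> d) \<cdot> h = t \<and> e \<cdot> h = z"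
        using k h(2) D(2) D'(2) dc by (intro exI[of _ k]) simp
    next
      fix h h' assume a: "h \<in> Arr C" "h' \<in> Arr C" "Dom C h = Dom C h'" "Cod C h = Dom C (c \<cdot> d)" "Cod C h' = Dom C (c \<cdot> d)"
        "(c \<cdot> d) \<cdot> h = (c \<cdot> d) \<cdot> h'" "e \<cdot> h = e \<cdot> h'"
      have b: "Cod C h = Dom C d" "Cod C h' = Dom C d" using a(4,5) D(2) D'(2) dc by simp_all
      have "p N \<cdot> e \<cdot> h = p N \<cdot> e \<cdot> h'" using a(7) by simp
      then have w: "w \<cdot> d \<cdot> h = w \<cdot> d \<cdot> h'"
        using a(1-3) b D(2-6) D'(2-6) dc by (simp add: comp_reduce[OF D'(7)])
      have "d \<cdot> h = d \<cdot> h'"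
        by (rule f.universal_fill_eq[OF u]) (use a(1-3,6) b D(2) D'(2) dc w in simp_all)
      then show "h = h'" using p.universal_fill_eq[OF v a(1-3) b] a(7) by blast
    qed (use D D' dc P in simp_all)
    then show "\<exists>c e. g.universal_fill N A x y c e" by blast
  qed
qed

lemma fibration_comp:
  assumes "simplicial_map C E U p" "simplicial_map C U X f"
    "simplicial_morphism.fibration C E U p" "simplicial_morphism.fibration C U X f"
  shows "simplicial_morphism.fibration C E X (\<lambda>k. f k \<cdot> p k)"
proof -
  interpret p: simplicial_morphism C E U p by unfold_locales (rule assms)
  interpret f: simplicial_morphism C U X f by unfold_locales (rule assms)
  interpret g: simplicial_morphism C E X "\<lambda>k. f k \<cdot> p k" by unfold_locales (rule simplicial_map_comp[OF assms(1,2)])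
  show ?thesis using assms(3,4) extends_comp[OF assms(1,2) horn_subset]
    unfolding p.fibration_def f.fibration_def g.fibration_def by blast
qed

lemma hypercover_extends:
  assumes "hypercover C m U X f"
  shows "simplicial_morphism.extends C U X f k (boundary k) (simplex k)"
proof -
  interpret f: simplicial_morphism C U X f by unfold_locales (use assms in \<open>simp add: hypercover_def\<close>)
  obtain L u v h where "is_rel_hom_obj C U X f k (boundary k) L u v"
        "is_rel_restr C U f k (boundary k) L u v h" "h \<in> Cov C"
    using assms unfolding hypercover_def by blast
  then show ?thesis using f.extends_of_cover boundary_subset by blast
qed

lemma hypercover_fibration:
  assumes "hypercover C m U X f"
  shows "simplicial_morphism.fibration C U X f"
proof -
  interpret f: simplicial_morphism C U X f by unfold_locales (use assms in \<open>simp add: hypercover_def\<close>)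
  show ?thesis using f.fibration_of_boundary hypercover_extends[OF assms] by blast
qed

text \<open>Transports the product decomposition of a twisted Cartesian product along its trivialisation.\<close>

lemma product_iso:
  assumes "is_product C a b Q p q" "\<phi> \<in> Arr C" "is_iso C \<phi>" "Cod C \<phi> = Q"
  shows "is_product C a b (Dom C \<phi>) (p \<cdot> \<phi>) (q \<cdot> \<phi>)"
proof -
  note D = productD[OF assms(1)]
  obtain g where g: "g \<in> Arr C" "Dom C g = Q" "Cod C g = Dom C \<phi>" "g \<cdot> \<phi> = Id C (Dom C \<phi>)" "\<phi> \<cdot> g = Id C Q"
    using assms(3,4) unfolding is_iso_def by auto
  show ?thesis
  proof (rule productI)
    fix x y assume a: "x \<in> Arr C" "y \<in> Arr C" "Dom C x = Dom C y" "Cod C x = a" "Cod C y = b"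
    obtain h where h: "h \<in> Arr C" "Dom C h = Dom C x" "Cod C h = Q" "p \<cdot> h = x" "q \<cdot> h = y"
      using product_lift[OF assms(1) a(1,2,4,5,3)] .
    show "\<exists>h. h \<in> Arr C \<and> Dom C h = Dom C y \<and> Cod C h = Dom C \<phi> \<and> (p \<cdot> \<phi>) \<cdot> h = x \<and> (q \<cdot> \<phi>) \<cdot> h = y"
      using h a(3) g D assms by (intro exI[of _ "g \<cdot> h"]) (simp add: comp_reduce[OF g(5)])
  next
    fix h h' assume a: "h \<in> Arr C" "h' \<in> Arr C" "Dom C h = Dom C h'" "Cod C h = Dom C \<phi>" "Cod C h' = Dom C \<phi>"
      "(p \<cdot> \<phi>) \<cdot> h = (p \<cdot> \<phi>) \<cdot> h'" "(q \<cdot> \<phi>) \<cdot> h = (q \<cdot> \<phi>) \<cdot> h'"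
    have "\<phi> \<cdot> h = \<phi> \<cdot> h'"
      by (rule product_eq[OF assms(1)]) (use a D assms in simp_all)
    then have "g \<cdot> \<phi> \<cdot> h = g \<cdot> \<phi> \<cdot> h'" by simp
    then show "h = h'" using a(1-5) g(1-3) assms(2,4) by (simp add: comp_reduce[OF g(4)])
  qed (use D assms in simp_all)
qed

lemma tcp_product:
  assumes "twisted_cartesian_product C E U p"
  obtains F \<psi> where "is_product C (Ob U k) F (Ob E k) (p k) \<psi>"
proof -
  obtain Y :: "('o, 'm) sobj" and Q pr1 pr2 \<phi> where
       pr: "\<forall>k. is_product C (Ob U k) (Ob Y k) (Q k) (pr1 k) (pr2 k)" and
       ph: "\<forall>k. \<phi> k \<in> hom C (Ob E k) (Q k) \<and> is_iso C (\<phi> k) \<and> pr1 k \<cdot> \<phi> k = p k"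
    using assms unfolding twisted_cartesian_product_def by (elim conjE exE) (rule that)
  have "is_product C (Ob U k) (Ob Y k) (Dom C (\<phi> k)) (pr1 k \<cdot> \<phi> k) (pr2 k \<cdot> \<phi> k)"
    by (rule product_iso[OF pr[rule_format, of k]]) (use ph in auto)
  then show ?thesis using that ph by auto
qed

text \<open>In positive degrees this is the stack condition; in degree 0 the filler is \<open>p 0\<close>, the projection of a
  product.\<close>

lemma local_bundle_fibration:
  assumes "local_bundle C n E U p"
  shows "simplicial_morphism.fibration C E U p"
proof -
  have tcp: "twisted_cartesian_product C E U p" and st: "stack C (enat n) E U p"
    using assms by (simp_all add: local_bundle_def)
  interpret p: simplicial_morphism C E U p by unfold_locales (use st in \<open>simp add: stack_def\<close>)
  show ?thesis unfolding p.fibration_def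
  proof (intro allI impI)
    fix k i :: nat assume i: "i \<le> k"
    show "p.extends k (horn k i) (simplex k)"
    proof (cases "k = 0")
      case True
      obtain F \<psi> where "is_product C (Ob U 0) F (Ob E 0) (p 0) \<psi>" using tcp_product[OF tcp] .
      then have c: "p 0 \<in> Cov C" by (rule product_proj_Cov)
      have "is_rel_restr C E p 0 {} (Ob U 0) u (Id C (Ob U 0)) (p 0)" for u
        by (simp add: is_rel_restr_def)
      then have "p.extends 0 {} (simplex 0)"
        by (rule p.extends_of_cover[OF p.rel_hom_obj_empty _ c]) simp
      then show ?thesis using True i by (simp add: horn_0)
    next
      case False
      then have "0 < k" by simp
      then obtain L u v h where "is_rel_hom_obj C E U p k (horn k i) L u v"
        "is_rel_restr C E p k (horn k i) L u v h" "h \<in> Cov C"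
        using st i unfolding stack_def by blast
      then show ?thesis using p.extends_of_cover horn_subset by blast
    qed
  qed
qed

end

section \<open>Construction of the higher morphism space\<close>

lemma length_id_join [simp]: "length (id_join k \<alpha>) = k + length \<alpha>"
  by (simp add: id_join_def)

lemma dim_id_join [simp]: "\<alpha> \<in> simplex m \<Longrightarrow> k + length \<alpha> - 1 = k + dim \<alpha>"
  using simplex_length[of \<alpha> m] by simp

lemma nth_id_join: "a < k + length \<alpha> \<Longrightarrow> id_join k \<alpha> ! a = (if a < k then a else k + \<alpha> ! (a - k))"
  by (simp add: id_join_def nth_append)

lemma set_id_join: "set (id_join k \<alpha>) = {0..<k} \<union> (+) k ` set \<alpha>"
  by (simp add: id_join_def)

lemma id_join_simplex [simp]: "\<alpha> \<in> simplex m \<Longrightarrow> id_join k \<alpha> \<in> simplex (k + m)"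
  unfolding simplex_iff id_join_def
  by (auto simp: sorted_append sorted_map intro!: sorted_wrt_mono_rel[of _ "(\<le>)" "\<lambda>x y. k + x \<le> k + y"])

lemma id_join_mcomp:
  assumes "\<alpha> \<in> simplex (dim \<beta>)" "\<beta> \<in> simplex r"
  shows "id_join k (mcomp \<beta> \<alpha>) = mcomp (id_join k \<beta>) (id_join k \<alpha>)"
proof (rule nth_equalityI)
  fix a assume "a < length (id_join k (mcomp \<beta> \<alpha>))"
  then have a: "a < k + length \<alpha>" by simp
  show "id_join k (mcomp \<beta> \<alpha>) ! a = mcomp (id_join k \<beta>) (id_join k \<alpha>) ! a"
  proof (cases "a < k")
    case True
    then show ?thesis using a by (simp add: nth_id_join mcomp_def)
  next
    case False
    then have l: "a - k < length \<alpha>" using a by simp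
    then have "\<alpha> ! (a - k) < length \<beta>" using simplex_nth_less[OF assms(2,1)] by simp
    then show ?thesis using a l False by (simp add: nth_id_join mcomp_def)
  qed
qed simp

lemma id_join_id: "id_join k [0..<Suc m] = [0..<Suc (k + m)]"
proof -
  have "[0..<Suc (k + m)] = [0..<k] @ [k..<k + Suc m]" by (metis add_Suc_right le_add1 upt_add_eq_append zero_le)
  moreover have "map ((+) k) [0..<Suc m] = [k..<k + Suc m]"
    using map_add_upt[of k "Suc m"] by (simp add: add.commute[of k] fun_eq_iff cong: map_cong del: upt_Suc)
  ultimately show ?thesis by (simp add: id_join_def del: upt_Suc)
qed

lemma distinct_id_join: "distinct \<alpha> \<Longrightarrow> distinct (id_join k \<alpha>)"
  by (auto simp: id_join_def distinct_map)

text \<open>The operator \<open>id \<star> \<alpha>\<close> fixes the vertices below \<open>k\<close> and maps no other vertex to them.\<close>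

lemma mcomp_id_join_bdry:
  assumes "\<alpha> \<in> simplex m" "\<tau> \<in> simplex (k + dim \<alpha>)"
  shows "mcomp (id_join k \<alpha>) \<tau> \<in> bdry_part k m \<longleftrightarrow> \<tau> \<in> bdry_part k (dim \<alpha>)"
proof -
  have t: "a < k + length \<alpha>" if "a \<in> set \<tau>" for a
  proof -
    have "a \<le> k + dim \<alpha>" using that assms(2) unfolding simplex_iff by auto
    then show ?thesis using simplex_length[OF assms(1)] by linarith
  qed
  have "j \<in> set (mcomp (id_join k \<alpha>) \<tau>) \<longleftrightarrow> j \<in> set \<tau>" if "j < k" for j
  proof -
    have "(j = id_join k \<alpha> ! a) = (j = a)" if "a \<in> set \<tau>" for a
      using nth_id_join[OF t[OF that]] \<open>j < k\<close> by auto
    then have "(\<exists>a\<in>set \<tau>. j = id_join k \<alpha> ! a) = (\<exists>a\<in>set \<tau>. j = a)" by (rule bex_cong[OF refl])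
    then show ?thesis unfolding set_mcomp image_iff by simp
  qed
  then have "{0..<k} \<subseteq> set (mcomp (id_join k \<alpha>) \<tau>) \<longleftrightarrow> {0..<k} \<subseteq> set \<tau>" by (simp add: subset_iff)
  moreover have "mcomp (id_join k \<alpha>) \<tau> \<in> simplex (k + m)" using assms by simp
  ultimately show ?thesis using assms by (simp add: bdry_part_def)
qed

lemma bdry_join_eq:
  assumes "0 < k"
  shows "bdry_join k l = bdry_part k l"
proof
  show "bdry_join k l \<subseteq> bdry_part k l"
  proof
    fix \<sigma> assume "\<sigma> \<in> bdry_join k l"
    then obtain s t where st: "\<sigma> = s @ map ((+) k) t" "s \<in> insert [] (boundary (k - 1))"
      "t \<in> insert [] (simplex l)" "(s, t) \<noteq> ([], [])"
      using assms unfolding bdry_join_def sjoin_def by auto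
    have s: "sorted s" "set s \<subseteq> {0..<k}" "\<not> {0..<k} \<subseteq> set s"
    proof -
      have e: "{0..k - 1} = {0..<k}" using assms by auto
      show "sorted s" "set s \<subseteq> {0..<k}" "\<not> {0..<k} \<subseteq> set s"
        using st(2) assms unfolding boundary_def simplex_iff e by auto
    qed
    have t: "sorted t" "set t \<subseteq> {0..l}" using st(3) by (auto simp: simplex_iff)
    have "sorted \<sigma>" unfolding st(1) using s t
      by (auto simp: sorted_append sorted_map intro!: sorted_wrt_mono_rel[of _ "(\<le>)" "\<lambda>x y. k + x \<le> k + y"])
    moreover have "set \<sigma> \<subseteq> {0..k + l}" unfolding st(1) using s t by fastforce
    moreover have "\<not> {0..<k} \<subseteq> set \<sigma>" unfolding st(1) using s by auto
    ultimately show "\<sigma> \<in> bdry_part k l" using st(1,4) by (auto simp: bdry_part_def simplex_iff)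
  qed
  show "bdry_part k l \<subseteq> bdry_join k l"
  proof
    fix \<sigma> assume a: "\<sigma> \<in> bdry_part k l"
    then have \<sigma>: "\<sigma> \<noteq> []" "sorted \<sigma>" "set \<sigma> \<subseteq> {0..k + l}" "\<not> {0..<k} \<subseteq> set \<sigma>" by (auto simp: bdry_part_def simplex_iff)
\<comment> \<open>Split the simplex at its first vertex in the second factor of the join.\<close>
    define s where "s = takeWhile (\<lambda>j. j < k) \<sigma>"
    define t where "t = map (\<lambda>j. j - k) (dropWhile (\<lambda>j. j < k) \<sigma>)"
    have dw: "k \<le> j" if "j \<in> set (dropWhile (\<lambda>j. j < k) \<sigma>)" for j
    proof -
      let ?d = "dropWhile (\<lambda>j. j < k) \<sigma>"
      have ne: "?d \<noteq> []" using that by (metis empty_iff list.set(1))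
      have so: "sorted ?d" using \<sigma>(2) sorted_dropWhile by blast
      have "\<not> hd ?d < k" using hd_dropWhile[OF ne] .
      moreover have "hd ?d \<le> j" using so that ne by (metis list.collapse order_refl set_ConsD sorted_simps(2))
      ultimately show ?thesis by simp
    qed
    have mt: "map ((+) k) t = dropWhile (\<lambda>j. j < k) \<sigma>"
      unfolding t_def map_map by (rule map_idI) (use dw in auto)
    have e: "\<sigma> = s @ map ((+) k) t" unfolding mt s_def by simp
    have sk: "set s \<subseteq> {0..<k}" unfolding s_def using set_takeWhileD by fastforce
    have "s \<in> insert [] (boundary (k - 1))"
    proof (cases "s = []")
      case False
      have "set s \<subseteq> {0..k - 1}" using sk assms by auto
      moreover have "sorted s" unfolding s_def using \<sigma>(2) sorted_takeWhile by blast
      moreover have "\<not> {0..k - 1} \<subseteq> set s"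
      proof
        assume "{0..k - 1} \<subseteq> set s"
        moreover have "{0..<k} \<subseteq> {0..k - 1}" using assms by auto
        ultimately show False using \<sigma>(4) unfolding e by auto
      qed
      ultimately show ?thesis using False by (simp add: boundary_def simplex_iff)
    qed simp
    moreover have "t \<in> insert [] (simplex l)"
    proof (cases "t = []")
      case False
      have "sorted (map ((+) k) t)" unfolding mt using \<sigma>(2) sorted_dropWhile by blast
      then have "sorted t" by (auto simp: sorted_map)
      moreover have "set t \<subseteq> {0..l}"
      proof
        fix j assume "j \<in> set t"
        then have "k + j \<in> set \<sigma>" unfolding e by simp
        then show "j \<in> {0..l}" using \<sigma>(3) by auto
      qed
      ultimately show ?thesis using False by (simp add: simplex_iff)
    qed simp
    moreover have "(s, t) \<noteq> ([], [])" using e \<sigma>(1) by auto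
    ultimately show "\<sigma> \<in> bdry_join k l"
      using e assms unfolding bdry_join_def sjoin_def by (intro CollectI exI[of _ s] exI[of _ t]) simp
  qed
qed

context covers
begin

lemma simplicial_objectI:
  assumes "\<And>k. Ob X k \<in> Obj C"
    "\<And>m \<alpha>. \<alpha> \<in> simplex m \<Longrightarrow> Op X m \<alpha> \<in> hom C (Ob X m) (Ob X (dim \<alpha>))"
    "\<And>m. Op X m [0..<Suc m] = Id C (Ob X m)"
    "\<And>r \<alpha> \<beta>. \<beta> \<in> simplex r \<Longrightarrow> \<alpha> \<in> simplex (dim \<beta>) \<Longrightarrow> Op X r (mcomp \<beta> \<alpha>) = Op X (dim \<beta>) \<alpha> \<cdot> Op X r \<beta>"
  shows "simplicial_object C X"
  unfolding simplicial_object_def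
proof (intro conjI allI ballI)
  fix l m \<alpha> assume "\<alpha> \<in> mono_maps l m"
  then show "Op X m \<alpha> \<in> hom C (Ob X m) (Ob X l)" using assms(2)[of \<alpha> m] by (simp add: mono_maps_iff)
next
  fix l m r \<alpha> \<beta> assume "\<alpha> \<in> mono_maps l m" "\<beta> \<in> mono_maps m r"
  then show "Op X r (mcomp \<beta> \<alpha>) = Op X m \<alpha> \<cdot> Op X r \<beta>" using assms(4)[of \<beta> r \<alpha>] by (simp add: mono_maps_iff)
qed (use assms in simp_all)

lemma simplicial_mapI:
  assumes "simplicial_object C X" "simplicial_object C Y" "\<And>k. f k \<in> hom C (Ob X k) (Ob Y k)"
    "\<And>m \<alpha>. \<alpha> \<in> simplex m \<Longrightarrow> f (dim \<alpha>) \<cdot> Op X m \<alpha> = Op Y m \<alpha> \<cdot> f m"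
  shows "simplicial_map C X Y f"
  unfolding simplicial_map_def
proof (intro conjI allI ballI)
  fix l m \<alpha> assume "\<alpha> \<in> mono_maps l m"
  then show "f l \<cdot> Op X m \<alpha> = Op Y m \<alpha> \<cdot> f m" using assms(4)[of \<alpha> m] by (simp add: mono_maps_iff)
qed (use assms in simp_all)

lemma const_sobj: "a \<in> Obj C \<Longrightarrow> simplicial_object C (const_sobj C a)"
  by (rule simplicial_objectI) (simp_all add: const_sobj_def)

lemma replicate_simplex: "replicate (Suc l) 0 \<in> simplex m"
  by (auto simp: simplex_iff simp del: replicate_Suc)

lemma vertex_incl_map:
  assumes "simplicial_object C B"
  shows "simplicial_map C (const_sobj C (Ob B 0)) B (vertex_incl B)"
proof (rule simplicial_mapI[OF const_sobj assms])
  fix m \<alpha> assume a: "\<alpha> \<in> simplex m"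
  have "mcomp (replicate (Suc m) 0) \<alpha> = replicate (Suc (dim \<alpha>)) 0"
    using a simplex_length[OF a] unfolding mcomp_def simplex_iff
    by (intro replicate_eqI) (auto simp del: replicate_Suc simp: less_Suc_eq_le)
  then show "vertex_incl B (dim \<alpha>) \<cdot> Op (const_sobj C (Ob B 0)) m \<alpha> = Op B m \<alpha> \<cdot> vertex_incl B m"
    using assms a by (simp add: const_sobj_def vertex_incl_def Op_Op replicate_simplex del: replicate_Suc)
qed (use assms in \<open>simp_all add: const_sobj_def vertex_incl_def replicate_simplex del: replicate_Suc\<close>)

lemma simplex_slice_object:
  assumes "simplicial_object C X"
  shows "simplicial_object C (simplex_slice k X)"
  by (rule simplicial_objectI)
    (use assms in \<open>simp_all add: simplex_slice_def id_join_id id_join_mcomp Op_Op del: upt_Suc\<close>)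

lemma simplicial_pullback_ex:
  assumes r: "simplicial_map C A B r" and c: "simplicial_map C D B c"
    and pb: "\<And>l. is_pullback C (r l) (c l) (i l) (b l)"
  obtains Z where "is_simplicial_pullback C A D B r c Z i b"
proof -
  interpret r: simplicial_morphism C A B r by unfold_locales (rule r)
  interpret c: simplicial_morphism C D B c by unfold_locales (rule c)
  note P = pullbackD[OF pb]
  define H where "H m \<alpha> = (SOME h. h \<in> Arr C \<and> Dom C h = Dom C (i m) \<and> Cod C h = Dom C (i (dim \<alpha>)) \<and>
      i (dim \<alpha>) \<cdot> h = Op A m \<alpha> \<cdot> i m \<and> b (dim \<alpha>) \<cdot> h = Op D m \<alpha> \<cdot> b m)" for m \<alpha>
  have H: "H m \<alpha> \<in> Arr C \<and> Dom C (H m \<alpha>) = Dom C (i m) \<and> Cod C (H m \<alpha>) = Dom C (i (dim \<alpha>)) \<and>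
      i (dim \<alpha>) \<cdot> H m \<alpha> = Op A m \<alpha> \<cdot> i m \<and> b (dim \<alpha>) \<cdot> H m \<alpha> = Op D m \<alpha> \<cdot> b m" if a: "\<alpha> \<in> simplex m" for m \<alpha>
  proof -
    have "r (dim \<alpha>) \<cdot> Op A m \<alpha> \<cdot> i m = c (dim \<alpha>) \<cdot> Op D m \<alpha> \<cdot> b m"
      using a P[of m] by (simp add: r.natural_comp c.natural_comp)
    then obtain h where "h \<in> Arr C" "Dom C h = Dom C (Op A m \<alpha> \<cdot> i m)" "Cod C h = Dom C (i (dim \<alpha>))"
      "i (dim \<alpha>) \<cdot> h = Op A m \<alpha> \<cdot> i m" "b (dim \<alpha>) \<cdot> h = Op D m \<alpha> \<cdot> b m"
      using pullback_lift[OF pb, of "Op A m \<alpha> \<cdot> i m" "Op D m \<alpha> \<cdot> b m"] a P[of m] by auto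
    then have "\<exists>h. h \<in> Arr C \<and> Dom C h = Dom C (i m) \<and> Cod C h = Dom C (i (dim \<alpha>)) \<and>
      i (dim \<alpha>) \<cdot> h = Op A m \<alpha> \<cdot> i m \<and> b (dim \<alpha>) \<cdot> h = Op D m \<alpha> \<cdot> b m" using a P[of m] by auto
    then show ?thesis unfolding H_def by (rule someI_ex)
  qed
  define Z :: "('o, 'm) sobj" where "Z = \<lparr>Ob = \<lambda>l. Dom C (i l), Op = H\<rparr>"
  have Z: "simplicial_object C Z"
  proof (rule simplicial_objectI)
    fix m
    have "H m [0..<Suc m] = Id C (Dom C (i m))"
      by (rule pullback_eq[OF pb[of m]]) (use H[OF id_simplex, of m] P[of m] in \<open>simp_all del: upt_Suc\<close>)
    then show "Op Z m [0..<Suc m] = Id C (Ob Z m)" by (simp add: Z_def)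
  next
    fix s \<alpha> \<beta> assume a: "\<beta> \<in> simplex s" "\<alpha> \<in> simplex (dim \<beta>)"
    have m: "mcomp \<beta> \<alpha> \<in> simplex s" using a by simp
    note Ha = H[OF a(2)] and Hb = H[OF a(1)]
    have Hm: "H s (mcomp \<beta> \<alpha>) \<in> Arr C" "Dom C (H s (mcomp \<beta> \<alpha>)) = Dom C (i s)" "Cod C (H s (mcomp \<beta> \<alpha>)) = Dom C (i (dim \<alpha>))"
      "i (dim \<alpha>) \<cdot> H s (mcomp \<beta> \<alpha>) = Op A s (mcomp \<beta> \<alpha>) \<cdot> i s" "b (dim \<alpha>) \<cdot> H s (mcomp \<beta> \<alpha>) = Op D s (mcomp \<beta> \<alpha>) \<cdot> b s"
      using H[OF m] by simp_all
    have "i (dim \<alpha>) \<cdot> H (dim \<beta>) \<alpha> \<cdot> H s \<beta> = (Op A (dim \<beta>) \<alpha> \<cdot> i (dim \<beta>)) \<cdot> H s \<beta>"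
      using Ha Hb P[of "dim \<alpha>"] by (simp add: comp_reduce)
    also have "\<dots> = Op A (dim \<beta>) \<alpha> \<cdot> Op A s \<beta> \<cdot> i s" using Hb P[of "dim \<beta>"] a by simp
    also have "\<dots> = Op A s (mcomp \<beta> \<alpha>) \<cdot> i s" using a P[of s] by (simp add: Op_Op_comp)
    finally have 1: "i (dim \<alpha>) \<cdot> H (dim \<beta>) \<alpha> \<cdot> H s \<beta> = Op A s (mcomp \<beta> \<alpha>) \<cdot> i s" .
    have "b (dim \<alpha>) \<cdot> H (dim \<beta>) \<alpha> \<cdot> H s \<beta> = (Op D (dim \<beta>) \<alpha> \<cdot> b (dim \<beta>)) \<cdot> H s \<beta>"
      using Ha Hb P[of "dim \<alpha>"] by (simp add: comp_reduce)
    also have "\<dots> = Op D (dim \<beta>) \<alpha> \<cdot> Op D s \<beta> \<cdot> b s" using Hb P[of "dim \<beta>"] a by simp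
    also have "\<dots> = Op D s (mcomp \<beta> \<alpha>) \<cdot> b s" using a P[of s] by (simp add: Op_Op_comp)
    finally have 2: "b (dim \<alpha>) \<cdot> H (dim \<beta>) \<alpha> \<cdot> H s \<beta> = Op D s (mcomp \<beta> \<alpha>) \<cdot> b s" .
    have "H s (mcomp \<beta> \<alpha>) = H (dim \<beta>) \<alpha> \<cdot> H s \<beta>"
      by (rule pullback_eq[OF pb[of "dim \<alpha>"]]) (use Ha Hb Hm 1 2 in simp_all)
    then show "Op Z s (mcomp \<beta> \<alpha>) = Op Z (dim \<beta>) \<alpha> \<cdot> Op Z s \<beta>" by (simp add: Z_def)
  qed (use H P in \<open>simp_all add: Z_def\<close>)
  have "is_simplicial_pullback C A D B r c Z i b"
    unfolding is_simplicial_pullback_def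
  proof (intro conjI allI)
    show "simplicial_map C Z A i" by (rule simplicial_mapI[OF Z r.X_obj]) (use H P in \<open>simp_all add: Z_def\<close>)
    show "simplicial_map C Z D b" by (rule simplicial_mapI[OF Z c.X_obj]) (use H P in \<open>simp_all add: Z_def\<close>)
  qed (rule r c pb)+
  with that show ?thesis .
qed

end

context simplicial_morphism
begin

text \<open>The condition \<open>is_bdry_slice\<close> with \<open>bdry_part\<close> for \<open>bdry_join\<close>, which extends it to \<open>k = 0\<close>.\<close>

definition is_slice :: "nat \<Rightarrow> ('o, 'm) sobj \<Rightarrow> (nat \<Rightarrow> nat list \<Rightarrow> 'm) \<Rightarrow> (nat \<Rightarrow> 'm) \<Rightarrow> bool" where
  "is_slice k B u v \<longleftrightarrow> simplicial_object C B \<and>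
     (\<forall>l. is_rel_hom_obj C X Y f (k + l) (bdry_part k l) (Ob B l) (u l) (v l)) \<and>
     (\<forall>m. \<forall>\<alpha>\<in>simplex m.
        (\<forall>\<sigma>\<in>bdry_part k (dim \<alpha>). u (dim \<alpha>) \<sigma> \<cdot> Op B m \<alpha> = u m (mcomp (id_join k \<alpha>) \<sigma>)) \<and>
        v (dim \<alpha>) \<cdot> Op B m \<alpha> = Op Y (k + m) (id_join k \<alpha>) \<cdot> v m)"

text \<open>The objects of \<open>B\<close> represent points on \<open>bdry_part k l\<close>, so its operators are induced by reindexing the
  universal points, and functoriality follows from uniqueness.\<close>

lemma slice_exists:
  assumes fib: "fibration"
  obtains B u v where "is_slice k B u v"
proof -
  have "\<exists>L u v. is_rel_hom_obj C X Y f (k + l) (bdry_part k l) L u v" for l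
    using rel_hom_obj_extend[OF rel_hom_obj_empty extends_empty_bdry[OF fib, of k l] _ bdry_part_subset] by blast
  then obtain L u v where L: "\<And>l. is_rel_hom_obj C X Y f (k + l) (bdry_part k l) (L l) (u l) (v l)" by metis
  note R = rel_hom_objD[OF L]
  note P = ptD[OF R(2)]
  let ?x = "\<lambda>m \<alpha> \<sigma>. u m (mcomp (id_join k \<alpha>) \<sigma>)"
  let ?y = "\<lambda>m \<alpha>. Op Y (k + m) (id_join k \<alpha>) \<cdot> v m"
  define H where "H m \<alpha> = (SOME h. h \<in> Arr C \<and> Dom C h = L m \<and> Cod C h = L (dim \<alpha>) \<and>
      (\<forall>\<sigma>\<in>bdry_part k (dim \<alpha>). u (dim \<alpha>) \<sigma> \<cdot> h = ?x m \<alpha> \<sigma>) \<and> v (dim \<alpha>) \<cdot> h = ?y m \<alpha>)" for m \<alpha>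
  have H: "H m \<alpha> \<in> Arr C \<and> Dom C (H m \<alpha>) = L m \<and> Cod C (H m \<alpha>) = L (dim \<alpha>) \<and>
      (\<forall>\<sigma>\<in>bdry_part k (dim \<alpha>). u (dim \<alpha>) \<sigma> \<cdot> H m \<alpha> = ?x m \<alpha> \<sigma>) \<and> v (dim \<alpha>) \<cdot> H m \<alpha> = ?y m \<alpha>"
    if a: "\<alpha> \<in> simplex m" for m \<alpha>
  proof -
    have "pt (k + dim \<alpha>) (bdry_part k (dim \<alpha>)) (L m) (?x m \<alpha>) (?y m \<alpha>)"
    proof (rule pt_reindex[OF R(2) id_join_simplex[OF a]])
      fix \<sigma> assume "\<sigma> \<in> bdry_part k (dim \<alpha>)"
      then show "mcomp (id_join k \<alpha>) \<sigma> \<in> bdry_part k m"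
        using mcomp_id_join_bdry[OF a, of \<sigma> k] bdry_part_subset by blast
    qed (use a bdry_part_subset in simp_all)
    then obtain h where "h \<in> Arr C" "Dom C h = L m" "Cod C h = L (dim \<alpha>)"
      "\<And>\<sigma>. \<sigma> \<in> bdry_part k (dim \<alpha>) \<Longrightarrow> u (dim \<alpha>) \<sigma> \<cdot> h = ?x m \<alpha> \<sigma>" "v (dim \<alpha>) \<cdot> h = ?y m \<alpha>"
      using rel_hom_obj_lift[OF L[of "dim \<alpha>"]] by blast
    then have "\<exists>h. h \<in> Arr C \<and> Dom C h = L m \<and> Cod C h = L (dim \<alpha>) \<and>
      (\<forall>\<sigma>\<in>bdry_part k (dim \<alpha>). u (dim \<alpha>) \<sigma> \<cdot> h = ?x m \<alpha> \<sigma>) \<and> v (dim \<alpha>) \<cdot> h = ?y m \<alpha>" by blast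
    then show ?thesis unfolding H_def by (rule someI_ex)
  qed
  define B :: "('o, 'm) sobj" where "B = \<lparr>Ob = L, Op = H\<rparr>"
  have B: "simplicial_object C B"
  proof (rule simplicial_objectI)
    fix m
    note Hm = H[OF id_simplex, of m]
    have dm: "dim [0..<Suc m] = m" by simp
    have "H m [0..<Suc m] = Id C (L m)"
    proof (rule rel_hom_obj_eq[OF L[of m] bdry_part_subset])
      fix \<sigma> assume s: "\<sigma> \<in> bdry_part k m"
      then have "\<sigma> \<in> simplex (k + m)" using bdry_part_subset by blast
      then show "u m \<sigma> \<cdot> H m [0..<Suc m] = u m \<sigma> \<cdot> Id C (L m)"
        using Hm s P(1-3)[OF s] by (simp add: id_join_id mcomp_id_left dm del: upt_Suc)
    qed (use Hm R(1) P(5-7)[of m] in \<open>simp_all add: id_join_id dm del: upt_Suc\<close>)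
    then show "Op B m [0..<Suc m] = Id C (Ob B m)" by (simp add: B_def)
  next
    fix s \<alpha> \<beta> assume a: "\<beta> \<in> simplex s" "\<alpha> \<in> simplex (dim \<beta>)"
    have m: "mcomp \<beta> \<alpha> \<in> simplex s" using a by simp
    note Ha = H[OF a(2)] and Hb = H[OF a(1)]
    have Hm: "H s (mcomp \<beta> \<alpha>) \<in> Arr C" "Dom C (H s (mcomp \<beta> \<alpha>)) = L s" "Cod C (H s (mcomp \<beta> \<alpha>)) = L (dim \<alpha>)"
      "\<And>\<sigma>. \<sigma> \<in> bdry_part k (dim \<alpha>) \<Longrightarrow> u (dim \<alpha>) \<sigma> \<cdot> H s (mcomp \<beta> \<alpha>) = ?x s (mcomp \<beta> \<alpha>) \<sigma>"
      "v (dim \<alpha>) \<cdot> H s (mcomp \<beta> \<alpha>) = ?y s (mcomp \<beta> \<alpha>)"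
      using H[OF m] by simp_all
    have "H s (mcomp \<beta> \<alpha>) = H (dim \<beta>) \<alpha> \<cdot> H s \<beta>"
    proof (rule rel_hom_obj_eq[OF L[of "dim \<alpha>"] bdry_part_subset])
      fix \<sigma> assume s: "\<sigma> \<in> bdry_part k (dim \<alpha>)"
      then have sx: "\<sigma> \<in> simplex (k + dim \<alpha>)" using bdry_part_subset by blast
      then have m': "mcomp (id_join k \<alpha>) \<sigma> \<in> bdry_part k (dim \<beta>)" using mcomp_id_join_bdry[OF a(2) sx] s by simp
      have "u (dim \<alpha>) \<sigma> \<cdot> H (dim \<beta>) \<alpha> \<cdot> H s \<beta> = u (dim \<beta>) (mcomp (id_join k \<alpha>) \<sigma>) \<cdot> H s \<beta>"
        using Ha Hb s P(1-3)[OF s] by (simp add: comp_reduce)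
      also have "\<dots> = u s (mcomp (id_join k \<beta>) (mcomp (id_join k \<alpha>) \<sigma>))" using Hb m' by simp
      also have "\<dots> = ?x s (mcomp \<beta> \<alpha>) \<sigma>" using a sx id_join_mcomp[OF a(2,1)]
        by (simp add: mcomp_assoc)
      finally show "u (dim \<alpha>) \<sigma> \<cdot> H s (mcomp \<beta> \<alpha>) = u (dim \<alpha>) \<sigma> \<cdot> H (dim \<beta>) \<alpha> \<cdot> H s \<beta>" using Hm(4)[OF s] by simp
    next
      have "v (dim \<alpha>) \<cdot> H (dim \<beta>) \<alpha> \<cdot> H s \<beta> = ?y (dim \<beta>) \<alpha> \<cdot> H s \<beta>"
        using Ha Hb P(5-7)[of "dim \<alpha>"] by (simp add: comp_reduce)
      also have "\<dots> = Op Y (k + dim \<beta>) (id_join k \<alpha>) \<cdot> ?y s \<beta>" using Hb a P(5-7)[of "dim \<beta>"] by simp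
      also have "\<dots> = ?y s (mcomp \<beta> \<alpha>)" using a P(5-7)[of s] id_join_mcomp[OF a(2,1)] by (simp add: Op_Op_comp)
      finally show "v (dim \<alpha>) \<cdot> H s (mcomp \<beta> \<alpha>) = v (dim \<alpha>) \<cdot> H (dim \<beta>) \<alpha> \<cdot> H s \<beta>" using Hm(5) by simp
    qed (use Ha Hb Hm in simp_all)
    then show "Op B s (mcomp \<beta> \<alpha>) = Op B (dim \<beta>) \<alpha> \<cdot> Op B s \<beta>" by (simp add: B_def)
  qed (use H R in \<open>simp_all add: B_def\<close>)
  have "is_slice k B u v" unfolding is_slice_def using B L H by (simp add: B_def)
  with that show ?thesis .
qed

lemma slice_restr_map:
  assumes B: "is_slice k B u v" and r: "\<And>l. is_rel_restr C X f (k + l) (bdry_part k l) (Ob B l) (u l) (v l) (r l)"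
  shows "simplicial_map C (simplex_slice k X) B r"
proof (rule simplicial_mapI[OF simplex_slice_object[OF X_obj]])
  have Bo: "simplicial_object C B" and L: "\<And>l. is_rel_hom_obj C X Y f (k + l) (bdry_part k l) (Ob B l) (u l) (v l)"
    and N: "\<And>m \<alpha> \<sigma>. \<alpha> \<in> simplex m \<Longrightarrow> \<sigma> \<in> bdry_part k (dim \<alpha>) \<Longrightarrow> u (dim \<alpha>) \<sigma> \<cdot> Op B m \<alpha> = u m (mcomp (id_join k \<alpha>) \<sigma>)"
     "\<And>m \<alpha>. \<alpha> \<in> simplex m \<Longrightarrow> v (dim \<alpha>) \<cdot> Op B m \<alpha> = Op Y (k + m) (id_join k \<alpha>) \<cdot> v m"
    using B by (simp_all add: is_slice_def)
  have r': "r l \<in> Arr C" "Dom C (r l) = Ob X (k + l)" "Cod C (r l) = Ob B l" "v l \<cdot> r l = f (k + l)"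
    "\<sigma> \<in> bdry_part k l \<Longrightarrow> u l \<sigma> \<cdot> r l = Op X (k + l) \<sigma>" for l \<sigma>
    using r[of l] by (simp_all add: is_rel_restr_def)
  note P = ptD[OF rel_hom_objD(2)[OF L]]
  show "simplicial_object C B" by (rule Bo)
  show "r l \<in> hom C (Ob (simplex_slice k X) l) (Ob B l)" for l using r' by (simp add: simplex_slice_def)
  fix m \<alpha> assume a: "\<alpha> \<in> simplex m"
  have "r (dim \<alpha>) \<cdot> Op X (k + m) (id_join k \<alpha>) = Op B m \<alpha> \<cdot> r m"
  proof (rule rel_hom_obj_eq[OF L[of "dim \<alpha>"] bdry_part_subset])
    fix \<sigma> assume s: "\<sigma> \<in> bdry_part k (dim \<alpha>)"
    then have sx: "\<sigma> \<in> simplex (k + dim \<alpha>)" using bdry_part_subset by blast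
    then have m': "mcomp (id_join k \<alpha>) \<sigma> \<in> bdry_part k m" using mcomp_id_join_bdry[OF a sx] s by simp
    show "u (dim \<alpha>) \<sigma> \<cdot> r (dim \<alpha>) \<cdot> Op X (k + m) (id_join k \<alpha>) = u (dim \<alpha>) \<sigma> \<cdot> Op B m \<alpha> \<cdot> r m"
      using r'(1-3) Bo P(1-3)[OF s] a sx m'
      by (simp add: comp_reduce[OF N(1)[OF a s]] comp_reduce[OF r'(5)[OF s]] r'(5) Op_Op)
  next
    show "v (dim \<alpha>) \<cdot> r (dim \<alpha>) \<cdot> Op X (k + m) (id_join k \<alpha>) = v (dim \<alpha>) \<cdot> Op B m \<alpha> \<cdot> r m"
      using r'(1-4) Bo P(5-7) a
      by (simp add: comp_reduce[OF N(2)[OF a]] comp_reduce[OF r'(4)] natural)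
  qed (use r'(1-3) Bo a in simp_all)
  then show "r (dim \<alpha>) \<cdot> Op (simplex_slice k X) m \<alpha> = Op B m \<alpha> \<cdot> r m" by (simp add: simplex_slice_def)
qed

definition is_mor_space :: "nat \<Rightarrow> ('o, 'm) sobj \<Rightarrow> (nat \<Rightarrow> nat list \<Rightarrow> 'm) \<Rightarrow> (nat \<Rightarrow> 'm) \<Rightarrow> (nat \<Rightarrow> 'm) \<Rightarrow>
    ('o, 'm) sobj \<Rightarrow> (nat \<Rightarrow> 'm) \<Rightarrow> (nat \<Rightarrow> 'm) \<Rightarrow> bool" where
  "is_mor_space k B u v r Z i b \<longleftrightarrow> is_slice k B u v \<and>
     (\<forall>l. is_rel_restr C X f (k + l) (bdry_part k l) (Ob B l) (u l) (v l) (r l)) \<and>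
     is_simplicial_pullback C (simplex_slice k X) (const_sobj C (Ob B 0)) B r (vertex_incl B) Z i b"

lemma mor_space_over:
  assumes fib: "fibration" and B: "is_slice k B u v"
  obtains r Z i b where "is_mor_space k B u v r Z i b"
proof -
  have L: "\<And>l. is_rel_hom_obj C X Y f (k + l) (bdry_part k l) (Ob B l) (u l) (v l)" and Bo: "simplicial_object C B"
    using B by (simp_all add: is_slice_def)
  have "\<exists>r. is_rel_restr C X f (k + l) (bdry_part k l) (Ob B l) (u l) (v l) r \<and> r \<in> Cov C" for l
    using cover_of_extends[OF L bdry_part_subset extends_bdry_simplex[OF fib]] by blast
  then obtain r where r: "\<And>l. is_rel_restr C X f (k + l) (bdry_part k l) (Ob B l) (u l) (v l) (r l)"
    and rc: "\<And>l. r l \<in> Cov C" by metis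
  note rm = slice_restr_map[OF B r]
  interpret r: simplicial_morphism C "simplex_slice k X" B r by unfold_locales (rule rm)
  interpret c: simplicial_morphism C "const_sobj C (Ob B 0)" B "vertex_incl B" by unfold_locales (rule vertex_incl_map[OF Bo])
  have "\<exists>i b. is_pullback C (r l) (vertex_incl B l) i b" for l
  proof -
    have "vertex_incl B l \<in> Arr C" "Cod C (vertex_incl B l) = Cod C (r l)" by simp_all
    then show ?thesis using pullback_ex[OF rc] by metis
  qed
  then obtain i b where "\<And>l. is_pullback C (r l) (vertex_incl B l) (i l) (b l)" by metis
  then obtain Z where "is_simplicial_pullback C (simplex_slice k X) (const_sobj C (Ob B 0)) B r (vertex_incl B) Z i b"
    using simplicial_pullback_ex[OF rm c.simplicial_morphism] by metis
  then show ?thesis using that[of r Z i b] B r unfolding is_mor_space_def by blast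
qed

lemma mor_space_exists:
  assumes fib: "fibration"
  obtains B u v r Z i b where "is_mor_space k B u v r Z i b" "is_higher_mor C k X Y f Z"
proof (cases "k = 0")
  case False
  obtain B u v where B: "is_slice k B u v" using slice_exists[OF fib] .
  obtain r Z i b where Z: "is_mor_space k B u v r Z i b" using mor_space_over[OF fib B] .
  have e: "bdry_join k l = bdry_part k l" for l using bdry_join_eq False by simp
  have "is_bdry_slice C k X Y f B u v"
    unfolding is_bdry_slice_def e
  proof (intro conjI allI ballI)
    fix l m \<alpha> \<sigma> assume "\<alpha> \<in> mono_maps l m" and s: "\<sigma> \<in> bdry_part k l"
    then have "\<alpha> \<in> simplex m" "l = dim \<alpha>" by (simp_all add: mono_maps_iff)
    then show "u l \<sigma> \<cdot> Op B m \<alpha> = u m (mcomp (id_join k \<alpha>) \<sigma>)"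
      using B s unfolding is_slice_def by blast
  next
    fix l m \<alpha> assume "\<alpha> \<in> mono_maps l m"
    then have "\<alpha> \<in> simplex m" "l = dim \<alpha>" by (simp_all add: mono_maps_iff)
    then show "v l \<cdot> Op B m \<alpha> = Op Y (k + m) (id_join k \<alpha>) \<cdot> v m"
      using B unfolding is_slice_def by blast
  qed (use B in \<open>auto simp: is_slice_def\<close>)
  then have "\<exists>B u v r i b. is_bdry_slice C k X Y f B u v \<and>
           (\<forall>l. is_rel_restr C X f (k + l) (bdry_join k l) (Ob B l) (u l) (v l) (r l)) \<and>
           is_simplicial_pullback C (simplex_slice k X) (const_sobj C (Ob B 0)) B r (vertex_incl B) Z i b"
    using Z unfolding is_mor_space_def e by blast
  then have "is_higher_mor C k X Y f Z"
    using False unfolding is_higher_mor_def by simp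
  with Z that show ?thesis by blast
next
  case True
  have e: "bdry_part 0 l = {}" for l by (auto simp: bdry_part_def)
  have j: "id_join 0 \<alpha> = \<alpha>" for \<alpha> by (simp add: id_join_def map_idI)
\<comment> \<open>A point on the empty set over \<open>Y\<^sub>l\<close> is just an element of \<open>Y\<^sub>l\<close>, so \<open>Y\<close> itself serves as \<open>B\<close>.\<close>
  have B: "is_slice 0 Y (\<lambda>_ _. undefined) (\<lambda>l. Id C (Ob Y l))"
    unfolding is_slice_def by (simp add: e j rel_hom_obj_empty)
  obtain r Z i b where Z: "is_mor_space 0 Y (\<lambda>_ _. undefined) (\<lambda>l. Id C (Ob Y l)) r Z i b"
    using mor_space_over[OF fib B] .
  have "r l = f l" for l
  proof -
    have "is_rel_restr C X f (0 + l) (bdry_part 0 l) (Ob Y l) (\<lambda>_. undefined) (Id C (Ob Y l)) (r l)"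
      using Z unfolding is_mor_space_def by blast
    then have "r l \<in> Arr C" "Cod C (r l) = Ob Y l" "Id C (Ob Y l) \<cdot> r l = f l" by (simp_all add: is_rel_restr_def)
    then show ?thesis by simp
  qed
  then have "r = f" by auto
  moreover have "simplex_slice 0 X = X" by (simp add: simplex_slice_def j)
  ultimately have "is_higher_mor C 0 X Y f Z"
    using Z unfolding is_higher_mor_def is_mor_space_def by auto
  with Z that True show ?thesis by blast
qed

end

section \<open>The higher morphism space is a Lie groupoid\<close>

text \<open>The nondegenerate simplex on the vertices \<open>A\<close> and \<open>j\<close>. Including the apex \<open>j\<close> of \<open>horn m j\<close> keeps it
  nonempty and inside the horn.\<close>

definition cone_list :: "nat \<Rightarrow> nat \<Rightarrow> nat set \<Rightarrow> nat list" where
  "cone_list m j A = filter (\<lambda>a. a = j \<or> a \<in> A) [0..<Suc m]"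

lemma set_cone_list: "set (cone_list m j A) = {a. a \<le> m \<and> (a = j \<or> a \<in> A)}"
  by (auto simp: cone_list_def less_Suc_eq_le simp del: upt_Suc)

lemma distinct_cone_list: "distinct (cone_list m j A)"
  by (simp add: cone_list_def del: upt_Suc)

lemma cone_list_horn:
  assumes "j \<le> m" "\<not> {0..m} - {j} \<subseteq> A"
  shows "cone_list m j A \<in> horn m j"
proof -
  have "sorted (cone_list m j A)" unfolding cone_list_def by (intro sorted_wrt_filter) (simp del: upt_Suc)
  moreover have "set (cone_list m j A) \<noteq> {}" using assms(1) unfolding set_cone_list by blast
  then have "cone_list m j A \<noteq> []" by (metis list.set(1))
  moreover have "set (cone_list m j A) \<subseteq> {0..m}" unfolding set_cone_list by auto
  moreover have "\<not> {0..m} - {j} \<subseteq> set (cone_list m j A)" using assms(2) unfolding set_cone_list by auto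
  ultimately show ?thesis by (simp add: horn_def simplex_iff)
qed

lemma horn_cone_list:
  assumes "\<sigma> \<in> horn m j" "j \<le> m"
  shows "cone_list m j (set \<sigma>) \<in> horn m j" "set \<sigma> \<subseteq> set (cone_list m j (set \<sigma>))"
proof -
  show "cone_list m j (set \<sigma>) \<in> horn m j" using assms by (intro cone_list_horn) (auto simp: horn_def)
  show "set \<sigma> \<subseteq> set (cone_list m j (set \<sigma>))" using assms unfolding set_cone_list by (auto simp: horn_def simplex_iff)
qed

lemma vertex_horn:
  assumes "0 < m" "j \<le> m"
  shows "[j] \<in> horn m j"
proof -
  define a where "a = (if j = 0 then m else 0)"
  have "a \<in> {0..m} - {j}" "a \<notin> set [j]" using assms by (auto simp: a_def)
  then have "\<not> {0..m} - {j} \<subseteq> set [j]" by blast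
  then show ?thesis using assms(2) by (simp add: horn_def simplex_iff)
qed

lemma id_join_horn:
  assumes "\<sigma> \<in> horn m j"
  shows "id_join k \<sigma> \<in> horn (k + m) (k + j)"
proof -
  have "\<not> {0..m} - {j} \<subseteq> set \<sigma>" using assms unfolding horn_def by blast
  then obtain a where "a \<in> {0..m} - {j}" "a \<notin> set \<sigma>" by blast
  then have a: "a \<le> m" "a \<noteq> j" "a \<notin> set \<sigma>" by simp_all
  then have "k + a \<in> {0..k + m} - {k + j}" "k + a \<notin> set (id_join k \<sigma>)" by (auto simp: set_id_join)
  then show ?thesis using assms unfolding horn_def by (intro CollectI conjI) (simp, blast)
qed

text \<open>A simplex of \<open>horn (k + m) (k + j)\<close> that contains all vertices below \<open>k\<close> lies in \<open>\<Delta>\<^sup>k\<^sup>-\<^sup>1 \<star> t\<close> for the simplex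
  \<open>t\<close> of \<open>horn m j\<close> spanned by \<open>j\<close> and its remaining vertices.\<close>

lemma horn_decompose:
  assumes "\<tau> \<in> horn (k + m) (k + j)" "\<tau> \<notin> bdry_part k m" "j \<le> m"
  defines "t \<equiv> cone_list m j {a. k + a \<in> set \<tau>}"
  shows "t \<in> horn m j" "\<exists>\<alpha>\<in>simplex (k + dim t). mcomp (id_join k t) \<alpha> = \<tau>"
proof -
  have \<tau>: "\<tau> \<in> simplex (k + m)" "{0..<k} \<subseteq> set \<tau>" "\<not> {0..k + m} - {k + j} \<subseteq> set \<tau>"
    using assms(1,2) unfolding horn_def bdry_part_def by blast+
  then obtain c where "c \<in> {0..k + m} - {k + j}" "c \<notin> set \<tau>" by blast
  then have c: "c \<le> k + m" "c \<noteq> k + j" "c \<notin> set \<tau>" by simp_all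
  then have "k \<le> c" using \<tau>(2) by (meson atLeastLessThan_iff not_le_imp_less subsetD zero_le)
  then have "c - k \<in> {0..m} - {j}" "c - k \<notin> {a. k + a \<in> set \<tau>}" using c by auto
  then show t: "t \<in> horn m j" unfolding t_def using assms(3) by (intro cone_list_horn) blast+
  have "set \<tau> \<subseteq> set (id_join k t)"
  proof
    fix a assume a: "a \<in> set \<tau>"
    show "a \<in> set (id_join k t)"
    proof (cases "a < k")
      case True
      then show ?thesis by (simp add: set_id_join)
    next
      case False
      then have "a = k + (a - k)" by simp
      moreover have "a - k \<in> set t" using a \<tau>(1) False unfolding t_def set_cone_list by (auto simp: simplex_iff)
      ultimately show ?thesis unfolding set_id_join by blast
    qed
  qed
  moreover have ts: "t \<in> simplex m" using t by (simp add: horn_def)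
  moreover have "distinct (id_join k t)" unfolding t_def by (intro distinct_id_join distinct_cone_list)
  ultimately show "\<exists>\<alpha>\<in>simplex (k + dim t). mcomp (id_join k t) \<alpha> = \<tau>"
    using factor_ex[of "id_join k t" "k + m" \<tau>] \<tau>(1) by simp
qed

text \<open>Here \<open>Z\<close> is the higher morphism space of \<open>f\<close>, \<open>i l\<close> includes \<open>Z\<^sub>l\<close> into \<open>X\<^sub>k\<^sub>+\<^sub>l\<close>, and \<open>b l\<close> sends an
  element of \<open>Z\<^sub>l\<close> to the vertex of \<open>B\<close> over which it lies.\<close>

locale mor_space = simplicial_morphism C X Y f
  for C :: "('o, 'm) cov_cat" (structure) and X Y :: "('o, 'm) sobj" and f :: "nat \<Rightarrow> 'm" +
  fixes k :: nat and B :: "('o, 'm) sobj" and u :: "nat \<Rightarrow> nat list \<Rightarrow> 'm" and v r :: "nat \<Rightarrow> 'm"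
    and Z :: "('o, 'm) sobj" and i b :: "nat \<Rightarrow> 'm"
  assumes fib: "fibration" and mor: "is_mor_space k B u v r Z i b"
begin

lemma slice: "is_slice k B u v"
  and restr: "is_rel_restr C X f (k + l) (bdry_part k l) (Ob B l) (u l) (v l) (r l)"
  and spb: "is_simplicial_pullback C (simplex_slice k X) (const_sobj C (Ob B 0)) B r (vertex_incl B) Z i b"
  using mor by (simp_all add: is_mor_space_def)

lemma B_obj [simp]: "simplicial_object C B"
  and B_rep: "is_rel_hom_obj C X Y f (k + l) (bdry_part k l) (Ob B l) (u l) (v l)"
  and u_Op: "\<alpha> \<in> simplex m \<Longrightarrow> \<sigma> \<in> bdry_part k (dim \<alpha>) \<Longrightarrow> u (dim \<alpha>) \<sigma> \<cdot> Op B m \<alpha> = u m (mcomp (id_join k \<alpha>) \<sigma>)"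
  and v_Op: "\<alpha> \<in> simplex m \<Longrightarrow> v (dim \<alpha>) \<cdot> Op B m \<alpha> = Op Y (k + m) (id_join k \<alpha>) \<cdot> v m"
  using slice by (simp_all add: is_slice_def)

lemmas uv = ptD[OF rel_hom_objD(2)[OF B_rep]]

lemma v_simps [simp]: "v l \<in> Arr C" "Dom C (v l) = Ob B l" "Cod C (v l) = Ob Y (k + l)"
  using uv(5-7) .

lemma r_simps [simp]: "r l \<in> Arr C" "Dom C (r l) = Ob X (k + l)" "Cod C (r l) = Ob B l"
  and v_r: "v l \<cdot> r l = f (k + l)"
  and u_r: "\<sigma> \<in> bdry_part k l \<Longrightarrow> u l \<sigma> \<cdot> r l = Op X (k + l) \<sigma>"
  using restr[of l] by (simp_all add: is_rel_restr_def)

lemma pb: "is_pullback C (r l) (vertex_incl B l) (i l) (b l)"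
  and i_map: "simplicial_map C Z (simplex_slice k X) i" and b_map: "simplicial_map C Z (const_sobj C (Ob B 0)) b"
  using spb by (simp_all add: is_simplicial_pullback_def)

lemma Z_obj [simp]: "simplicial_object C Z"
  using i_map by (simp add: simplicial_map_def)

lemma i_simps [simp]: "i l \<in> Arr C" "Dom C (i l) = Ob Z l" "Cod C (i l) = Ob X (k + l)"
  using i_map by (simp_all add: simplicial_map_def simplex_slice_def)

lemma b_simps [simp]: "b l \<in> Arr C" "Dom C (b l) = Ob Z l" "Cod C (b l) = Ob B 0"
  using b_map by (simp_all add: simplicial_map_def const_sobj_def)

lemma i_Op: "\<alpha> \<in> simplex m \<Longrightarrow> i (dim \<alpha>) \<cdot> Op Z m \<alpha> = Op X (k + m) (id_join k \<alpha>) \<cdot> i m"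
  using i_map by (simp add: simplicial_map_def simplex_slice_def mono_maps_iff)

lemma b_Op: "\<alpha> \<in> simplex m \<Longrightarrow> b (dim \<alpha>) \<cdot> Op Z m \<alpha> = b m"
  using b_map by (simp add: simplicial_map_def const_sobj_def mono_maps_iff)

lemma vi_simps [simp]: "vertex_incl B l \<in> Arr C" "Dom C (vertex_incl B l) = Ob B 0" "Cod C (vertex_incl B l) = Ob B l"
  using vertex_incl_map[OF B_obj] by (simp_all add: simplicial_map_def const_sobj_def)

lemma vi_Op: "\<alpha> \<in> simplex m \<Longrightarrow> Op B m \<alpha> \<cdot> vertex_incl B m = vertex_incl B (dim \<alpha>)"
  using vertex_incl_map[OF B_obj] by (simp add: simplicial_map_def const_sobj_def mono_maps_iff)

text \<open>The universal vertex of \<open>B\<close>, spread over \<open>bdry_part k l\<close> by degeneracies. An element of \<open>Z\<^sub>l\<close> over \<open>\<beta>\<close> is a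
  simplex \<open>e\<close> of \<open>X\<^sub>k\<^sub>+\<^sub>l\<close> that restricts to \<open>u0 l \<cdot> \<beta>\<close> and has image \<open>v0 l \<cdot> \<beta>\<close> in \<open>Y\<close>; this is the content of
  \<open>Z_pt\<close> and \<open>Z_lift\<close>.\<close>

definition u0 :: "nat \<Rightarrow> nat list \<Rightarrow> 'm" where "u0 l \<sigma> = u l \<sigma> \<cdot> vertex_incl B l"

definition v0 :: "nat \<Rightarrow> 'm" where "v0 l = v l \<cdot> vertex_incl B l"

lemma pt0: "pt (k + l) (bdry_part k l) (Ob B 0) (u0 l) (v0 l)"
  using pt_comp[OF rel_hom_objD(2)[OF B_rep] bdry_part_subset, of "vertex_incl B l" l]
  by (simp add: u0_def[abs_def] v0_def)

lemmas uv0 = ptD[OF pt0]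

lemma v0_simps [simp]: "v0 l \<in> Arr C" "Dom C (v0 l) = Ob B 0" "Cod C (v0 l) = Ob Y (k + l)"
  using uv0(5-7) .

lemma u0_join:
  assumes "\<alpha> \<in> simplex m" "\<sigma> \<in> bdry_part k (dim \<alpha>)"
  shows "u0 m (mcomp (id_join k \<alpha>) \<sigma>) = u0 (dim \<alpha>) \<sigma>"
proof -
  have "u0 m (mcomp (id_join k \<alpha>) \<sigma>) = (u (dim \<alpha>) \<sigma> \<cdot> Op B m \<alpha>) \<cdot> vertex_incl B m"
    unfolding u0_def u_Op[OF assms] ..
  also have "\<dots> = u (dim \<alpha>) \<sigma> \<cdot> Op B m \<alpha> \<cdot> vertex_incl B m" using assms uv(1-3)[OF assms(2)] by simp
  also have "\<dots> = u0 (dim \<alpha>) \<sigma>" using vi_Op[OF assms(1)] by (simp add: u0_def)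
  finally show ?thesis .
qed

lemma v0_join:
  assumes "\<alpha> \<in> simplex m"
  shows "Op Y (k + m) (id_join k \<alpha>) \<cdot> v0 m = v0 (dim \<alpha>)"
proof -
  have "Op Y (k + m) (id_join k \<alpha>) \<cdot> v0 m = (v (dim \<alpha>) \<cdot> Op B m \<alpha>) \<cdot> vertex_incl B m"
    unfolding v_Op[OF assms] v0_def using assms by simp
  also have "\<dots> = v (dim \<alpha>) \<cdot> Op B m \<alpha> \<cdot> vertex_incl B m" using assms by simp
  also have "\<dots> = v0 (dim \<alpha>)" using vi_Op[OF assms] by (simp add: v0_def)
  finally show ?thesis .
qed

lemma Z_pt:
  assumes "z \<in> Arr C" "Cod C z = Ob Z l"
  shows "\<sigma> \<in> bdry_part k l \<Longrightarrow> Op X (k + l) \<sigma> \<cdot> i l \<cdot> z = u0 l \<sigma> \<cdot> b l \<cdot> z"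
    and "f (k + l) \<cdot> i l \<cdot> z = v0 l \<cdot> b l \<cdot> z"
proof -
  have e: "r l \<cdot> i l \<cdot> z = vertex_incl B l \<cdot> b l \<cdot> z"
    using comp_reduce[OF pullbackD(9)[OF pb, of l]] assms by simp
  show "f (k + l) \<cdot> i l \<cdot> z = v0 l \<cdot> b l \<cdot> z"
  proof -
    have "f (k + l) \<cdot> i l \<cdot> z = v l \<cdot> r l \<cdot> i l \<cdot> z" using assms by (simp add: comp_reduce[OF v_r])
    then show ?thesis unfolding e v0_def using assms by simp
  qed
  assume s: "\<sigma> \<in> bdry_part k l"
  have "Op X (k + l) \<sigma> \<cdot> i l \<cdot> z = u l \<sigma> \<cdot> r l \<cdot> i l \<cdot> z" using assms uv(1-3)[OF s] by (simp add: comp_reduce[OF u_r[OF s]])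
  then show "Op X (k + l) \<sigma> \<cdot> i l \<cdot> z = u0 l \<sigma> \<cdot> b l \<cdot> z"
    unfolding e u0_def using assms uv(1-3)[OF s] by simp
qed

lemma Z_lift:
  assumes "e \<in> Arr C" "Cod C e = Ob X (k + l)" "\<beta> \<in> Arr C" "Cod C \<beta> = Ob B 0" "Dom C e = Dom C \<beta>"
    "\<And>\<sigma>. \<sigma> \<in> bdry_part k l \<Longrightarrow> Op X (k + l) \<sigma> \<cdot> e = u0 l \<sigma> \<cdot> \<beta>" "f (k + l) \<cdot> e = v0 l \<cdot> \<beta>"
  obtains z where "z \<in> Arr C" "Dom C z = Dom C e" "Cod C z = Ob Z l" "i l \<cdot> z = e" "b l \<cdot> z = \<beta>"
proof -
  have "r l \<cdot> e = vertex_incl B l \<cdot> \<beta>"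
  proof (rule rel_hom_obj_eq[OF B_rep[of l] bdry_part_subset])
    fix \<sigma> assume s: "\<sigma> \<in> bdry_part k l"
    show "u l \<sigma> \<cdot> r l \<cdot> e = u l \<sigma> \<cdot> vertex_incl B l \<cdot> \<beta>"
      using assms(6)[OF s] assms(1-5) uv(1-3)[OF s] by (simp add: u0_def comp_reduce[OF u_r[OF s]])
  next
    show "v l \<cdot> r l \<cdot> e = v l \<cdot> vertex_incl B l \<cdot> \<beta>"
      using assms(7) assms(1-5) by (simp add: v0_def comp_reduce[OF v_r])
  qed (use assms in simp_all)
  then obtain z where "z \<in> Arr C" "Dom C z = Dom C e" "Cod C z = Dom C (i l)" "i l \<cdot> z = e" "b l \<cdot> z = \<beta>"
    using pullback_lift[OF pb[of l] assms(1,3)] assms by auto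
  then show ?thesis using that by simp
qed

lemma Z_eq:
  assumes "z \<in> Arr C" "z' \<in> Arr C" "Cod C z = Ob Z l" "Cod C z' = Ob Z l" "Dom C z = Dom C z'"
    "i l \<cdot> z = i l \<cdot> z'" "b l \<cdot> z = b l \<cdot> z'"
  shows "z = z'"
  by (rule pullback_eq[OF pb[of l]]) (use assms in simp_all)

lemma hom_ptD:
  assumes "hom_pt C Z S T z"
  shows "\<sigma> \<in> S \<Longrightarrow> z \<sigma> \<in> Arr C" "\<sigma> \<in> S \<Longrightarrow> Dom C (z \<sigma>) = T" "\<sigma> \<in> S \<Longrightarrow> Cod C (z \<sigma>) = Ob Z (dim \<sigma>)"
    "\<sigma> \<in> S \<Longrightarrow> \<alpha> \<in> simplex (dim \<sigma>) \<Longrightarrow> z (mcomp \<sigma> \<alpha>) = Op Z (dim \<sigma>) \<alpha> \<cdot> z \<sigma>"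
  using assms unfolding hom_pt_iff by auto

lemma i_z:
  assumes "hom_pt C Z S T z" "\<sigma> \<in> S" "\<alpha> \<in> simplex (dim \<sigma>)"
  shows "i (dim \<alpha>) \<cdot> z (mcomp \<sigma> \<alpha>) = Op X (k + dim \<sigma>) (id_join k \<alpha>) \<cdot> i (dim \<sigma>) \<cdot> z \<sigma>"
    and "b (dim \<alpha>) \<cdot> z (mcomp \<sigma> \<alpha>) = b (dim \<sigma>) \<cdot> z \<sigma>"
  using hom_ptD[OF assms(1)] assms(2,3)
  by (simp_all add: comp_reduce[OF i_Op[OF assms(3)]] comp_reduce[OF b_Op[OF assms(3)]])

text \<open>The horn is a cone, so \<open>\<sigma>\<close> and \<open>[j]\<close> are faces of one simplex of it, and \<open>b\<close> is invariant under operators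
  because it maps to a constant object.\<close>

lemma horn_base_constant:
  assumes z: "hom_pt C Z (horn m j) T z" and j: "j \<le> m" and \<sigma>: "\<sigma> \<in> horn m j"
  shows "b (dim \<sigma>) \<cdot> z \<sigma> = b 0 \<cdot> z [j]"
proof -
  define w where "w = cone_list m j (set \<sigma>)"
  have w: "w \<in> horn m j" "set \<sigma> \<subseteq> set w" unfolding w_def using horn_cone_list[OF \<sigma> j] .
  have ws: "w \<in> simplex m" "\<sigma> \<in> simplex m" "[j] \<in> simplex m" using w \<sigma> j by (auto simp: horn_def simplex_iff)
  have "distinct w" unfolding w_def by (rule distinct_cone_list)
  moreover have "set [j] \<subseteq> set w" unfolding w_def set_cone_list using j by simp
  ultimately obtain \<delta> \<epsilon> where d: "\<delta> \<in> simplex (dim w)" "mcomp w \<delta> = \<sigma>" and e: "\<epsilon> \<in> simplex (dim w)" "mcomp w \<epsilon> = [j]"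
    using factor_ex[of w m] ws w(2) by meson
  have "length \<epsilon> = 1" using arg_cong[OF e(2), of length] by (simp add: One_nat_def)
  then have "dim \<epsilon> = 0" by simp
  moreover have "dim \<delta> = dim \<sigma>" using arg_cong[OF d(2), of length] by simp
  ultimately show ?thesis using i_z(2)[OF z w(1) d(1)] i_z(2)[OF z w(1) e(1)] d(2) e(2) by simp
qed

text \<open>A horn in \<open>Z\<close> over \<open>\<beta>\<close> determines a point of \<open>X\<close> on \<open>horn (k + m) (k + j)\<close>: on \<open>bdry_part k m\<close> it is
  prescribed by \<open>\<beta>\<close>, and every other simplex is a face of some \<open>id_join k \<sigma>\<close>, where \<open>i (z \<sigma>)\<close> gives its value.\<close>

lemma horn_point:
  assumes z: "hom_pt C Z (horn m j) T z" and j: "j \<le> m" and \<beta>: "\<beta> \<in> Arr C" "Dom C \<beta> = T" "Cod C \<beta> = Ob B 0"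
    and zb: "\<And>\<sigma>. \<sigma> \<in> horn m j \<Longrightarrow> b (dim \<sigma>) \<cdot> z \<sigma> = \<beta>"
  obtains x where "pt (k + m) (horn (k + m) (k + j)) T x (v0 m \<cdot> \<beta>)"
    "\<And>\<sigma>. \<sigma> \<in> bdry_part k m \<Longrightarrow> x \<sigma> = u0 m \<sigma> \<cdot> \<beta>"
    "\<And>\<sigma> \<gamma>. \<sigma> \<in> horn m j \<Longrightarrow> \<gamma> \<in> simplex (k + dim \<sigma>) \<Longrightarrow>
       x (mcomp (id_join k \<sigma>) \<gamma>) = Op X (k + dim \<sigma>) \<gamma> \<cdot> i (dim \<sigma>) \<cdot> z \<sigma>"
proof -
  note ZD = hom_ptD[OF z]
  define t where "t \<tau> = cone_list m j {a. k + a \<in> set \<tau>}" for \<tau>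
  define fac where "fac \<tau> = (SOME \<alpha>. \<alpha> \<in> simplex (k + dim (t \<tau>)) \<and> mcomp (id_join k (t \<tau>)) \<alpha> = \<tau>)" for \<tau>
  define x where "x \<tau> = (if \<tau> \<in> bdry_part k m then u0 m \<tau> \<cdot> \<beta>
    else Op X (k + dim (t \<tau>)) (fac \<tau>) \<cdot> i (dim (t \<tau>)) \<cdot> z (t \<tau>))" for \<tau>
  have t: "t \<tau> \<in> horn m j" "fac \<tau> \<in> simplex (k + dim (t \<tau>))" "mcomp (id_join k (t \<tau>)) (fac \<tau>) = \<tau>"
    if "\<tau> \<in> horn (k + m) (k + j)" "\<tau> \<notin> bdry_part k m" for \<tau>
  proof -
    note d = horn_decompose[OF that j, folded t_def]
    show "t \<tau> \<in> horn m j" by (rule d)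
    have "fac \<tau> \<in> simplex (k + dim (t \<tau>)) \<and> mcomp (id_join k (t \<tau>)) (fac \<tau>) = \<tau>"
      unfolding fac_def by (rule someI_ex) (use d(2) in blast)
    then show "fac \<tau> \<in> simplex (k + dim (t \<tau>))" "mcomp (id_join k (t \<tau>)) (fac \<tau>) = \<tau>" by auto
  qed
  have hs: "\<sigma> \<in> simplex m" if "\<sigma> \<in> horn m j" for \<sigma> using that by (simp add: horn_def)
  have xD: "x \<sigma> = u0 m \<sigma> \<cdot> \<beta>" if "\<sigma> \<in> bdry_part k m" for \<sigma> using that by (simp add: x_def)
\<comment> \<open>The value of \<open>x\<close> can be computed from any simplex \<open>\<sigma>\<close> of the horn; compatibility with operators follows.\<close>
  have K: "x (mcomp (id_join k \<sigma>) \<gamma>) = Op X (k + dim \<sigma>) \<gamma> \<cdot> i (dim \<sigma>) \<cdot> z \<sigma>"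
    if \<sigma>: "\<sigma> \<in> horn m j" and \<gamma>: "\<gamma> \<in> simplex (k + dim \<sigma>)" for \<sigma> \<gamma>
  proof -
    define \<tau> where "\<tau> = mcomp (id_join k \<sigma>) \<gamma>"
    note \<sigma>s = hs[OF \<sigma>]
    show ?thesis
    proof (cases "\<tau> \<in> bdry_part k m")
      case True
      then have g: "\<gamma> \<in> bdry_part k (dim \<sigma>)" unfolding \<tau>_def using mcomp_id_join_bdry[OF \<sigma>s \<gamma>] by blast
      have "Op X (k + dim \<sigma>) \<gamma> \<cdot> i (dim \<sigma>) \<cdot> z \<sigma> = u0 (dim \<sigma>) \<gamma> \<cdot> \<beta>"
        using Z_pt(1)[OF ZD(1,3) g] \<sigma> zb[OF \<sigma>] by simp
      also have "\<dots> = u0 m \<tau> \<cdot> \<beta>" unfolding \<tau>_def u0_join[OF \<sigma>s g] ..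
      finally show ?thesis using True by (simp add: x_def \<tau>_def)
    next
      case False
      have "\<tau> \<in> horn (k + m) (k + j)"
        using id_join_horn[OF \<sigma>, of k] sub_sset_horn[of "k + m" "k + j"] \<gamma> \<sigma>s unfolding \<tau>_def sub_sset_def by simp
      note T = t[OF this False]
      define w where "w = cone_list m j (set \<sigma>)"
      have w: "w \<in> horn m j" "set \<sigma> \<subseteq> set w" unfolding w_def using horn_cone_list[OF \<sigma> j] .
      have wd: "distinct w" unfolding w_def by (rule distinct_cone_list)
\<comment> \<open>The value at \<open>\<tau>\<close> is defined through \<open>t \<tau>\<close>. Neither of \<open>\<sigma>\<close> and \<open>t \<tau>\<close> needs to be a face of the other, but both
  are faces of the simplex \<open>w\<close> spanned by \<open>\<sigma>\<close> and \<open>j\<close>.\<close>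
      have "set \<tau> \<subseteq> set (id_join k \<sigma>)" unfolding \<tau>_def using set_mcomp_subset[OF id_join_simplex[OF \<sigma>s]] \<gamma> \<sigma>s by simp
      then have "a \<in> set \<sigma>" if "k + a \<in> set \<tau>" for a using that by (auto simp: set_id_join)
      then have "set (t \<tau>) \<subseteq> set w" unfolding t_def w_def set_cone_list by auto
      then obtain \<delta> \<epsilon> where d: "\<delta> \<in> simplex (dim w)" "mcomp w \<delta> = \<sigma>" and e: "\<epsilon> \<in> simplex (dim w)" "mcomp w \<epsilon> = t \<tau>"
        using factor_ex[OF wd hs[OF w(1)]] \<sigma>s hs[OF T(1)] w(2) by meson
      have dd: "dim \<delta> = dim \<sigma>" "dim \<epsilon> = dim (t \<tau>)" using arg_cong[OF d(2), of length] arg_cong[OF e(2), of length] by simp_all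
      have ws: "w \<in> simplex m" by (rule hs[OF w(1)])
      have js: "id_join k w \<in> simplex (k + m)" "id_join k \<delta> \<in> simplex (k + dim w)" "id_join k \<epsilon> \<in> simplex (k + dim w)"
        using ws d e by simp_all
      have g': "\<gamma> \<in> simplex (dim (id_join k \<delta>))" "fac \<tau> \<in> simplex (dim (id_join k \<epsilon>))"
        using \<gamma> T(2) d(1) e(1) dd by simp_all
      have "mcomp (id_join k w) (mcomp (id_join k \<delta>) \<gamma>) = \<tau>"
      proof -
        have "mcomp (mcomp (id_join k w) (id_join k \<delta>)) \<gamma> = \<tau>"
          unfolding \<tau>_def using id_join_mcomp[OF d(1) ws, of k] d(2) by simp
        then show ?thesis using mcomp_assoc[of "id_join k \<delta>" "id_join k w" \<gamma>] js g' ws by simp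
      qed
      moreover have "mcomp (id_join k w) (mcomp (id_join k \<epsilon>) (fac \<tau>)) = \<tau>"
      proof -
        have "mcomp (mcomp (id_join k w) (id_join k \<epsilon>)) (fac \<tau>) = \<tau>"
          using T(3) id_join_mcomp[OF e(1) ws, of k] e(2) by simp
        then show ?thesis using mcomp_assoc[of "id_join k \<epsilon>" "id_join k w" "fac \<tau>"] js g' ws by simp
      qed
      moreover have "mcomp (id_join k \<delta>) \<gamma> \<in> simplex (dim (id_join k w))"
        "mcomp (id_join k \<epsilon>) (fac \<tau>) \<in> simplex (dim (id_join k w))"
        using js g' ws by simp_all
      ultimately have eq: "mcomp (id_join k \<delta>) \<gamma> = mcomp (id_join k \<epsilon>) (fac \<tau>)"
        using mcomp_inj[OF distinct_id_join[OF wd] js(1)] by metis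
      have 1: "i (dim \<sigma>) \<cdot> z \<sigma> = Op X (k + dim w) (id_join k \<delta>) \<cdot> i (dim w) \<cdot> z w"
        using i_z(1)[OF z w(1) d(1)] d(2) dd by simp
      have 2: "i (dim (t \<tau>)) \<cdot> z (t \<tau>) = Op X (k + dim w) (id_join k \<epsilon>) \<cdot> i (dim w) \<cdot> z w"
        using i_z(1)[OF z w(1) e(1)] e(2) dd by simp
      have "Op X (k + dim \<sigma>) \<gamma> \<cdot> i (dim \<sigma>) \<cdot> z \<sigma> = Op X (k + dim w) (mcomp (id_join k \<delta>) \<gamma>) \<cdot> i (dim w) \<cdot> z w"
        unfolding 1 using \<gamma> js ZD(1-3)[OF w(1)] dd d(1) by (simp add: Op_Op_comp)
      also have "\<dots> = Op X (k + dim (t \<tau>)) (fac \<tau>) \<cdot> i (dim (t \<tau>)) \<cdot> z (t \<tau>)"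
        unfolding 2 eq using T(2) js ZD(1-3)[OF w(1)] dd e(1) by (simp add: Op_Op_comp)
      finally show ?thesis using False by (simp add: x_def \<tau>_def[symmetric])
    qed
  qed
  have p0: "pt (k + m) (bdry_part k m) T (\<lambda>\<sigma>. u0 m \<sigma> \<cdot> \<beta>) (v0 m \<cdot> \<beta>)"
    using pt_comp[OF pt0 bdry_part_subset \<beta>(1,3)] \<beta>(2) by simp
  have pD: "pt (k + m) (bdry_part k m) T x (v0 m \<cdot> \<beta>)"
    by (rule pt_cong[OF p0 sub_sset_bdry_part]) (rule xD)
  note PD = ptD[OF pD]
  have "pt (k + m) (horn (k + m) (k + j)) T x (v0 m \<cdot> \<beta>)"
    unfolding pt_iff
  proof (intro conjI ballI)
    fix \<tau> assume h: "\<tau> \<in> horn (k + m) (k + j)"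
    have "x \<tau> \<in> Arr C \<and> Dom C (x \<tau>) = T \<and> Cod C (x \<tau>) = Ob X (dim \<tau>) \<and>
        f (dim \<tau>) \<cdot> x \<tau> = Op Y (k + m) \<tau> \<cdot> v0 m \<cdot> \<beta> \<and>
        (\<forall>\<alpha>\<in>simplex (dim \<tau>). x (mcomp \<tau> \<alpha>) = Op X (dim \<tau>) \<alpha> \<cdot> x \<tau>)"
    proof (cases "\<tau> \<in> bdry_part k m")
      case True
      then show ?thesis using PD by simp
    next
      case False
      note T = t[OF h False]
      define s \<gamma> where "s = t \<tau>" and "\<gamma> = fac \<tau>"
      have sg: "s \<in> horn m j" "\<gamma> \<in> simplex (k + dim s)" "\<tau> = mcomp (id_join k s) \<gamma>" using T by (simp_all add: s_def \<gamma>_def)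
      note ss = hs[OF sg(1)]
      have x\<tau>: "x \<tau> = Op X (k + dim s) \<gamma> \<cdot> i (dim s) \<cdot> z s" unfolding sg(3) by (rule K[OF sg(1,2)])
      have ar: "z s \<in> Arr C" "Dom C (z s) = T" "Cod C (z s) = Ob Z (dim s)" using ZD(1-3)[OF sg(1)] .
      have d\<tau>: "dim \<tau> = dim \<gamma>" unfolding sg(3) by simp
      have "f (dim \<tau>) \<cdot> x \<tau> = Op Y (k + dim s) \<gamma> \<cdot> f (k + dim s) \<cdot> i (dim s) \<cdot> z s"
        unfolding x\<tau> d\<tau> using sg(2) ar by (simp add: natural_comp)
      also have "\<dots> = Op Y (k + dim s) \<gamma> \<cdot> v0 (dim s) \<cdot> \<beta>" unfolding Z_pt(2)[OF ar(1,3)] zb[OF sg(1)] ..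
      also have "\<dots> = Op Y (k + dim s) \<gamma> \<cdot> Op Y (k + m) (id_join k s) \<cdot> v0 m \<cdot> \<beta>"
        using ss \<beta> by (simp add: comp_reduce[OF v0_join[OF ss]])
      also have "\<dots> = Op Y (k + m) \<tau> \<cdot> v0 m \<cdot> \<beta>" unfolding sg(3) using ss sg(2) \<beta> by (simp add: Op_Op_comp)
      finally have 1: "f (dim \<tau>) \<cdot> x \<tau> = Op Y (k + m) \<tau> \<cdot> v0 m \<cdot> \<beta>" .
      have 2: "x (mcomp \<tau> \<alpha>) = Op X (dim \<tau>) \<alpha> \<cdot> x \<tau>" if a: "\<alpha> \<in> simplex (dim \<tau>)" for \<alpha>
      proof -
        have a': "\<alpha> \<in> simplex (dim \<gamma>)" using a d\<tau> by simp
        have "mcomp \<tau> \<alpha> = mcomp (id_join k s) (mcomp \<gamma> \<alpha>)" unfolding sg(3) using sg(2) ss a' by (simp add: mcomp_assoc)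
        then have "x (mcomp \<tau> \<alpha>) = Op X (k + dim s) (mcomp \<gamma> \<alpha>) \<cdot> i (dim s) \<cdot> z s"
          using K[OF sg(1), of "mcomp \<gamma> \<alpha>"] sg(2) a' by simp
        also have "\<dots> = Op X (dim \<tau>) \<alpha> \<cdot> x \<tau>" unfolding x\<tau> d\<tau> using sg(2) a' ar by (simp add: Op_Op_comp)
        finally show ?thesis .
      qed
      show ?thesis using 1 2 x\<tau> d\<tau> sg(2) ar by simp
    qed
    then show "x \<tau> \<in> Arr C" "Dom C (x \<tau>) = T" "Cod C (x \<tau>) = Ob X (dim \<tau>)"
        "f (dim \<tau>) \<cdot> x \<tau> = Op Y (k + m) \<tau> \<cdot> v0 m \<cdot> \<beta>"
        "\<And>\<alpha>. \<alpha> \<in> simplex (dim \<tau>) \<Longrightarrow> x (mcomp \<tau> \<alpha>) = Op X (dim \<tau>) \<alpha> \<cdot> x \<tau>" by blast+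
  qed (use \<beta> in simp_all)
  with xD K that show ?thesis by blast
qed

text \<open>By \<open>horn_point\<close>, horns in \<open>Z\<close> are the points on \<open>horn (k + m) (k + j)\<close> that restrict to \<open>(u0, v0)\<close> on
  \<open>bdry_part k m\<close>, and these are represented by the universal extension of \<open>(u0, v0)\<close>.\<close>

lemma horn_object:
  assumes m: "0 < m" and j: "j \<le> m"
    and U: "universal_ext (k + m) (bdry_part k m) (horn (k + m) (k + j)) (u0 m) (v0 m) c x"
  obtains U where "is_hom_obj C Z (horn m j) (Dom C c) U"
    "\<And>\<sigma>. \<sigma> \<in> horn m j \<Longrightarrow> i (dim \<sigma>) \<cdot> U \<sigma> = x (id_join k \<sigma>)" "\<And>\<sigma>. \<sigma> \<in> horn m j \<Longrightarrow> b (dim \<sigma>) \<cdot> U \<sigma> = c"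
proof -
  note D = universal_extD[OF U]
  have cB: "Cod C c = Ob B 0" using D(3) by simp
  note P = ptD[OF D(4)]
  have hs: "\<sigma> \<in> simplex m" if "\<sigma> \<in> horn m j" for \<sigma> using that by (simp add: horn_def)
  have "\<exists>z. z \<in> Arr C \<and> Dom C z = Dom C c \<and> Cod C z = Ob Z (dim \<sigma>) \<and> i (dim \<sigma>) \<cdot> z = x (id_join k \<sigma>) \<and> b (dim \<sigma>) \<cdot> z = c"
    if s: "\<sigma> \<in> horn m j" for \<sigma>
  proof -
    note h = id_join_horn[OF s, of k]
    note ss = hs[OF s]
    have 1: "Op X (k + dim \<sigma>) \<tau> \<cdot> x (id_join k \<sigma>) = u0 (dim \<sigma>) \<tau> \<cdot> c" if t: "\<tau> \<in> bdry_part k (dim \<sigma>)" for \<tau>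
    proof -
      have ts: "\<tau> \<in> simplex (k + dim \<sigma>)" using t bdry_part_subset by blast
      have m: "mcomp (id_join k \<sigma>) \<tau> \<in> bdry_part k m" using mcomp_id_join_bdry[OF ss ts] t by simp
      have "Op X (k + dim \<sigma>) \<tau> \<cdot> x (id_join k \<sigma>) = x (mcomp (id_join k \<sigma>) \<tau>)" using P(4)[OF h, of \<tau>] ts ss by simp
      then show ?thesis using D(5)[OF m] u0_join[OF ss t] by simp
    qed
    have "f (k + dim \<sigma>) \<cdot> x (id_join k \<sigma>) = Op Y (k + m) (id_join k \<sigma>) \<cdot> v0 m \<cdot> c" using P(8)[OF h] ss by simp
    also have "\<dots> = v0 (dim \<sigma>) \<cdot> c" using ss D(2) cB by (simp add: comp_reduce[OF v0_join[OF ss]])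
    finally have 2: "f (k + dim \<sigma>) \<cdot> x (id_join k \<sigma>) = v0 (dim \<sigma>) \<cdot> c" .
    have ar: "x (id_join k \<sigma>) \<in> Arr C" "Dom C (x (id_join k \<sigma>)) = Dom C c" "Cod C (x (id_join k \<sigma>)) = Ob X (k + dim \<sigma>)"
      using P(1-3)[OF h] ss by simp_all
    obtain z where "z \<in> Arr C" "Dom C z = Dom C (x (id_join k \<sigma>))" "Cod C z = Ob Z (dim \<sigma>)"
       "i (dim \<sigma>) \<cdot> z = x (id_join k \<sigma>)" "b (dim \<sigma>) \<cdot> z = c"
      using Z_lift[OF ar(1,3) D(2) cB ar(2) 1 2] by blast
    then show ?thesis using ar(2) by auto
  qed
  then obtain W where W: "\<And>\<sigma>. \<sigma> \<in> horn m j \<Longrightarrow> W \<sigma> \<in> Arr C" "\<And>\<sigma>. \<sigma> \<in> horn m j \<Longrightarrow> Dom C (W \<sigma>) = Dom C c"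
    "\<And>\<sigma>. \<sigma> \<in> horn m j \<Longrightarrow> Cod C (W \<sigma>) = Ob Z (dim \<sigma>)"
    "\<And>\<sigma>. \<sigma> \<in> horn m j \<Longrightarrow> i (dim \<sigma>) \<cdot> W \<sigma> = x (id_join k \<sigma>)" "\<And>\<sigma>. \<sigma> \<in> horn m j \<Longrightarrow> b (dim \<sigma>) \<cdot> W \<sigma> = c" by metis
  have WP: "hom_pt C Z (horn m j) (Dom C c) W"
    unfolding hom_pt_iff
  proof (intro conjI ballI)
    fix \<sigma> \<alpha> assume s: "\<sigma> \<in> horn m j" and a: "\<alpha> \<in> simplex (dim \<sigma>)"
    have sa: "mcomp \<sigma> \<alpha> \<in> horn m j" using s a sub_sset_horn[of m j] by (simp add: sub_sset_def)
    have 1: "i (dim \<alpha>) \<cdot> W (mcomp \<sigma> \<alpha>) = i (dim \<alpha>) \<cdot> Op Z (dim \<sigma>) \<alpha> \<cdot> W \<sigma>"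
    proof -
      have "i (dim \<alpha>) \<cdot> W (mcomp \<sigma> \<alpha>) = x (mcomp (id_join k \<sigma>) (id_join k \<alpha>))"
        using W(4)[OF sa] id_join_mcomp[OF a hs[OF s]] by simp
      also have "\<dots> = Op X (k + dim \<sigma>) (id_join k \<alpha>) \<cdot> x (id_join k \<sigma>)"
        using P(4)[OF id_join_horn[OF s], of "id_join k \<alpha>"] a hs[OF s] by simp
      also have "\<dots> = Op X (k + dim \<sigma>) (id_join k \<alpha>) \<cdot> i (dim \<sigma>) \<cdot> W \<sigma>" using W(4)[OF s] by simp
      also have "\<dots> = i (dim \<alpha>) \<cdot> Op Z (dim \<sigma>) \<alpha> \<cdot> W \<sigma>" using W(1-3)[OF s] a by (simp add: comp_reduce[OF i_Op[OF a]])
      finally show ?thesis .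
    qed
    show "W (mcomp \<sigma> \<alpha>) = Op Z (dim \<sigma>) \<alpha> \<cdot> W \<sigma>"
      by (rule Z_eq[of _ _ "dim \<alpha>"])
        (use 1 W(1-3)[OF s] W(1-3)[OF sa] W(5)[OF s] W(5)[OF sa] a in \<open>simp_all add: comp_reduce[OF b_Op[OF a]]\<close>)
  qed (use W in simp_all)
  have "is_hom_obj C Z (horn m j) (Dom C c) W"
    unfolding is_hom_obj_def
  proof (intro conjI ballI allI impI)
    show "Dom C c \<in> Obj C" using D by simp
    show "hom_pt C Z (horn m j) (Dom C c) W" by (rule WP)
    fix T z assume "T \<in> Obj C" and z: "hom_pt C Z (horn m j) T z"
    note ZD = hom_ptD[OF z]
    show "\<exists>!h. h \<in> hom C T (Dom C c) \<and> (\<forall>\<sigma>\<in>horn m j. W \<sigma> \<cdot> h = z \<sigma>)"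
    proof -
      note True = vertex_horn[OF m j]
      define \<beta> where "\<beta> = b 0 \<cdot> z [j]"
      have d0: "dim [j] = 0" by simp
      have \<beta>: "\<beta> \<in> Arr C" "Dom C \<beta> = T" "Cod C \<beta> = Ob B 0"
        unfolding \<beta>_def using ZD(1-3)[OF True] d0 by simp_all
      have zb: "b (dim \<sigma>) \<cdot> z \<sigma> = \<beta>" if "\<sigma> \<in> horn m j" for \<sigma>
        unfolding \<beta>_def by (rule horn_base_constant[OF z j that])
      obtain y where y: "pt (k + m) (horn (k + m) (k + j)) T y (v0 m \<cdot> \<beta>)"
        "\<And>\<sigma>. \<sigma> \<in> bdry_part k m \<Longrightarrow> y \<sigma> = u0 m \<sigma> \<cdot> \<beta>"
        "\<And>\<sigma> \<gamma>. \<sigma> \<in> horn m j \<Longrightarrow> \<gamma> \<in> simplex (k + dim \<sigma>) \<Longrightarrow>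
           y (mcomp (id_join k \<sigma>) \<gamma>) = Op X (k + dim \<sigma>) \<gamma> \<cdot> i (dim \<sigma>) \<cdot> z \<sigma>"
        using horn_point[OF z j \<beta> zb] by blast
      have yj: "y (id_join k \<sigma>) = i (dim \<sigma>) \<cdot> z \<sigma>" if s: "\<sigma> \<in> horn m j" for \<sigma>
      proof -
        have "mcomp (id_join k \<sigma>) [0..<Suc (k + dim \<sigma>)] = id_join k \<sigma>"
          using mcomp_id_right[OF id_join_simplex[OF hs[OF s]], of k] hs[OF s] by (simp del: upt_Suc)
        then show ?thesis using y(3)[OF s id_simplex] ZD(1-3)[OF s] by (simp del: upt_Suc)
      qed
      obtain h where h: "h \<in> Arr C" "Dom C h = T" "Cod C h = Dom C c" "c \<cdot> h = \<beta>"
         "\<And>\<sigma>. \<sigma> \<in> horn (k + m) (k + j) \<Longrightarrow> x \<sigma> \<cdot> h = y \<sigma>"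
        using universal_ext_lift[OF U \<beta>(1), of y] y(1,2) \<beta> by auto
      show ?thesis
      proof (rule ex1I[of _ h])
        have "W \<sigma> \<cdot> h = z \<sigma>" if s: "\<sigma> \<in> horn m j" for \<sigma>
        proof (rule Z_eq[of _ _ "dim \<sigma>"])
          show "i (dim \<sigma>) \<cdot> W \<sigma> \<cdot> h = i (dim \<sigma>) \<cdot> z \<sigma>"
            using W(1-3)[OF s] h(1-3) h(5)[OF id_join_horn[OF s]] yj[OF s] by (simp add: comp_reduce[OF W(4)[OF s]])
          show "b (dim \<sigma>) \<cdot> W \<sigma> \<cdot> h = b (dim \<sigma>) \<cdot> z \<sigma>"
            using W(1-3)[OF s] h(1-4) zb[OF s] by (simp add: comp_reduce[OF W(5)[OF s]])
        qed (use W(1-3)[OF s] h(1-3) ZD(1-3)[OF s] in simp_all)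
        then show "h \<in> hom C T (Dom C c) \<and> (\<forall>\<sigma>\<in>horn m j. W \<sigma> \<cdot> h = z \<sigma>)" using h(1-3) by simp
        fix h' assume "h' \<in> hom C T (Dom C c) \<and> (\<forall>\<sigma>\<in>horn m j. W \<sigma> \<cdot> h' = z \<sigma>)"
        then have h': "h' \<in> Arr C" "Dom C h' = T" "Cod C h' = Dom C c" "\<And>\<sigma>. \<sigma> \<in> horn m j \<Longrightarrow> W \<sigma> \<cdot> h' = z \<sigma>" by simp_all
        show "h' = h"
        proof (rule universal_ext_eq[OF U])
          have "c \<cdot> h' = b 0 \<cdot> W [j] \<cdot> h'" using W(1-3)[OF True] W(5)[OF True] h'(1-3) d0 by (simp add: comp_reduce)
          then show ch: "c \<cdot> h' = c \<cdot> h" using h'(4)[OF True] h(4) by (simp add: \<beta>_def)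
          fix \<tau> assume t: "\<tau> \<in> horn (k + m) (k + j)"
          have "x \<tau> \<cdot> h' = y \<tau>"
          proof (cases "\<tau> \<in> bdry_part k m")
            case True
            have "x \<tau> \<cdot> h' = u0 m \<tau> \<cdot> c \<cdot> h'" using D(5)[OF True] uv0(1-3)[OF True] D(2) cB h'(1-3) by simp
            then show ?thesis using y(2)[OF True] ch h(4) by simp
          next
            case False
            note d = horn_decompose[OF t False j]
            obtain s \<alpha> where s: "s \<in> horn m j" "\<alpha> \<in> simplex (k + dim s)" "\<tau> = mcomp (id_join k s) \<alpha>"
              using d by metis
            have "x \<tau> = Op X (k + dim s) \<alpha> \<cdot> x (id_join k s)"
              unfolding s(3) using P(4)[OF id_join_horn[OF s(1)], of \<alpha>] s(2) hs[OF s(1)] by simp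
            also have "\<dots> = Op X (k + dim s) \<alpha> \<cdot> i (dim s) \<cdot> W s" using W(4)[OF s(1)] by simp
            finally have "x \<tau> \<cdot> h' = Op X (k + dim s) \<alpha> \<cdot> i (dim s) \<cdot> W s \<cdot> h'"
              using W(1-3)[OF s(1)] s(2) h'(1-3) by simp
            then show ?thesis unfolding h'(4)[OF s(1)] s(3) y(3)[OF s(1,2)] .
          qed
          then show "x \<tau> \<cdot> h' = x \<tau> \<cdot> h" using h(5)[OF t] by simp
        qed (use h h' in simp_all)
      qed
    qed
  qed
  with W(4,5) that show ?thesis by blast
qed

end

context covers
begin

lemma hom_obj_eq:
  assumes "is_hom_obj C Z S L W" "simplicial_object C Z" "h \<in> Arr C" "h' \<in> Arr C" "Dom C h = Dom C h'" "Cod C h = L" "Cod C h' = L"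
    "\<And>\<sigma>. \<sigma> \<in> S \<Longrightarrow> W \<sigma> \<cdot> h = W \<sigma> \<cdot> h'"
  shows "h = h'"
proof -
  have W: "hom_pt C Z S L W" using assms(1) by (simp add: is_hom_obj_def)
  have "hom_pt C Z S (Dom C h) (\<lambda>\<sigma>. W \<sigma> \<cdot> h)"
    using W assms(2,3,6) unfolding hom_pt_iff by simp
  then have "\<exists>!k. k \<in> hom C (Dom C h) L \<and> (\<forall>\<sigma>\<in>S. W \<sigma> \<cdot> k = W \<sigma> \<cdot> h)"
    using assms(1,3) unfolding is_hom_obj_def by simp
  moreover have "h \<in> hom C (Dom C h) L \<and> (\<forall>\<sigma>\<in>S. W \<sigma> \<cdot> h = W \<sigma> \<cdot> h)"
    "h' \<in> hom C (Dom C h) L \<and> (\<forall>\<sigma>\<in>S. W \<sigma> \<cdot> h' = W \<sigma> \<cdot> h)"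
    using assms(3-8) by simp_all
  ultimately show ?thesis by blast
qed

lemma hom_pt_Op:
  assumes "simplicial_object C Z" "S \<subseteq> simplex m"
  shows "hom_pt C Z S (Ob Z m) (Op Z m)"
proof -
  have "\<sigma> \<in> simplex m" if "\<sigma> \<in> S" for \<sigma> using assms(2) that by blast
  then show ?thesis unfolding hom_pt_iff using assms(1) by (simp add: Op_Op)
qed

end

context mor_space
begin

text \<open>Both \<open>Z\<^sub>m\<close> and the universal filler of the horn \<open>(x, v0 m \<cdot> c)\<close> represent simplices of \<open>X\<^sub>k\<^sub>+\<^sub>m\<close> that restrict
  to \<open>(u0, v0)\<close>, so the map from \<open>Z\<^sub>m\<close> to its horn object is isomorphic to the cover \<open>c2\<close>.\<close>

lemma horn_restriction_cover:
  assumes m: "0 < m" and j: "j \<le> m"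
  shows "\<exists>L W h. is_hom_obj C Z (horn m j) L W \<and> h \<in> hom C (Ob Z m) L \<and>
      (\<forall>\<sigma>\<in>horn m j. W \<sigma> \<cdot> h = Op Z m \<sigma>) \<and> h \<in> Cov C"
proof -
  let ?H = "horn (k + m) (k + j)"
  have hs: "\<sigma> \<in> simplex m" if "\<sigma> \<in> horn m j" for \<sigma> using that by (simp add: horn_def)
  obtain c x where U: "universal_ext (k + m) (bdry_part k m) ?H (u0 m) (v0 m) c x"
    using extends_bdry_horn[OF fib j] pt0[of m] unfolding extends_def by blast
  note D = universal_extD[OF U]
  have cB: "Cod C c = Ob B 0" using D(3) by simp
  note P = ptD[OF D(4)]
  obtain W where W: "is_hom_obj C Z (horn m j) (Dom C c) W"
    and iW: "\<And>\<sigma>. \<sigma> \<in> horn m j \<Longrightarrow> i (dim \<sigma>) \<cdot> W \<sigma> = x (id_join k \<sigma>)"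
    and bW: "\<And>\<sigma>. \<sigma> \<in> horn m j \<Longrightarrow> b (dim \<sigma>) \<cdot> W \<sigma> = c"
    using horn_object[OF m j U] by blast
  have Wp: "hom_pt C Z (horn m j) (Dom C c) W" using W by (simp add: is_hom_obj_def)
  note WD = hom_ptD[OF Wp]
  have "\<exists>!h. h \<in> hom C (Ob Z m) (Dom C c) \<and> (\<forall>\<sigma>\<in>horn m j. W \<sigma> \<cdot> h = Op Z m \<sigma>)"
    using W hom_pt_Op[OF Z_obj horn_subset, of m j] Ob_Obj[OF Z_obj] unfolding is_hom_obj_def by blast
  then obtain h where h: "h \<in> Arr C" "Dom C h = Ob Z m" "Cod C h = Dom C c" "\<And>\<sigma>. \<sigma> \<in> horn m j \<Longrightarrow> W \<sigma> \<cdot> h = Op Z m \<sigma>"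
    by auto
  note hj = vertex_horn[OF m j]
  have ch: "c \<cdot> h = b m"
  proof -
    have d0: "dim [j] = 0" by simp
    have "c \<cdot> h = b 0 \<cdot> W [j] \<cdot> h" using WD(1-3)[OF hj] bW[OF hj] h(1-3) d0 by (simp add: comp_reduce)
    also have "\<dots> = b m" unfolding h(4)[OF hj] using b_Op[OF hs[OF hj]] d0 by simp
    finally show ?thesis .
  qed
  have xh: "x \<tau> \<cdot> h = Op X (k + m) \<tau> \<cdot> i m" if t: "\<tau> \<in> ?H" for \<tau>
  proof (cases "\<tau> \<in> bdry_part k m")
    case True
    have "x \<tau> \<cdot> h = u0 m \<tau> \<cdot> b m" using D(2) D(5)[OF True] uv0(1-3)[OF True] cB h(1-3) ch by simp
    also have "\<dots> = Op X (k + m) \<tau> \<cdot> i m" using Z_pt(1)[of "Id C (Ob Z m)" m \<tau>] True by simp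
    finally show ?thesis .
  next
    case False
    obtain s \<alpha> where s: "s \<in> horn m j" "\<alpha> \<in> simplex (k + dim s)" "\<tau> = mcomp (id_join k s) \<alpha>"
      using horn_decompose[OF t False j] by metis
    have "x \<tau> = Op X (k + dim s) \<alpha> \<cdot> x (id_join k s)"
      unfolding s(3) using P(4)[OF id_join_horn[OF s(1)], of \<alpha>] s(2) hs[OF s(1)] by simp
    also have "\<dots> = Op X (k + dim s) \<alpha> \<cdot> i (dim s) \<cdot> W s" using iW[OF s(1)] by simp
    finally have "x \<tau> \<cdot> h = Op X (k + dim s) \<alpha> \<cdot> i (dim s) \<cdot> W s \<cdot> h"
      using WD(1-3)[OF s(1)] s(2) h(1-3) by simp
    also have "\<dots> = Op X (k + dim s) \<alpha> \<cdot> Op X (k + m) (id_join k s) \<cdot> i m"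
      unfolding h(4)[OF s(1)] i_Op[OF hs[OF s(1)]] ..
    also have "\<dots> = Op X (k + m) \<tau> \<cdot> i m" unfolding s(3) using s(2) hs[OF s(1)] by (simp add: Op_Op_comp)
    finally show ?thesis .
  qed
  have "extends (k + m) ?H (simplex (k + m))" using fib j by (simp add: fibration_def)
  then obtain c2 e where F: "universal_fill (k + m) ?H x (v0 m \<cdot> c) c2 e"
    using extends_simplexD[OF _ horn_subset D(4)] by blast
  note F' = universal_fillD[OF F]
  have c2: "Cod C c2 = Dom C c" using F'(3) D(2) cB by simp
  obtain s where s: "s \<in> Arr C" "Dom C s = Dom C h" "Cod C s = Dom C c2" "c2 \<cdot> s = h" "e \<cdot> s = i m"
  proof (rule universal_fill_lift[OF F h(1), of "i m"])
    show "f (k + m) \<cdot> i m = (v0 m \<cdot> c) \<cdot> h" using Z_pt(2)[of "Id C (Ob Z m)" m] D(2) cB h(1-3) ch by simp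
  qed (use h(1-3) D(2) cB xh that in simp_all)
  obtain w where w: "w \<in> Arr C" "Dom C w = Dom C e" "Cod C w = Ob Z m" "i m \<cdot> w = e" "b m \<cdot> w = c \<cdot> c2"
  proof (rule Z_lift[of e m "c \<cdot> c2"])
    fix \<sigma> assume t: "\<sigma> \<in> bdry_part k m"
    then have "\<sigma> \<in> ?H" using bdry_part_horn by blast
    then show "Op X (k + m) \<sigma> \<cdot> e = u0 m \<sigma> \<cdot> c \<cdot> c2"
      using F'(8)[of \<sigma>] D(5)[OF t] uv0(1-3)[OF t] D(2) F'(2) c2 cB by simp
  qed (use F' D(2) c2 cB that in simp_all)
  have hw: "h \<cdot> w = c2"
  proof (rule hom_obj_eq[OF W Z_obj])
    fix \<sigma> assume t: "\<sigma> \<in> horn m j"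
    note ts = hs[OF t]
    have "i (dim \<sigma>) \<cdot> Op Z m \<sigma> \<cdot> w = Op X (k + m) (id_join k \<sigma>) \<cdot> e"
      using ts w by (simp add: comp_reduce[OF i_Op[OF ts]])
    also have "\<dots> = i (dim \<sigma>) \<cdot> W \<sigma> \<cdot> c2"
      using F'(8)[OF id_join_horn[OF t]] WD(1-3)[OF t] F'(2) c2 by (simp add: comp_reduce[OF iW[OF t]])
    finally have 1: "i (dim \<sigma>) \<cdot> Op Z m \<sigma> \<cdot> w = i (dim \<sigma>) \<cdot> W \<sigma> \<cdot> c2" .
    have 2: "b (dim \<sigma>) \<cdot> Op Z m \<sigma> \<cdot> w = b (dim \<sigma>) \<cdot> W \<sigma> \<cdot> c2"
      using ts w WD(1-3)[OF t] F'(2) c2 by (simp add: comp_reduce[OF b_Op[OF ts]] comp_reduce[OF bW[OF t]])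
    have "Op Z m \<sigma> \<cdot> w = W \<sigma> \<cdot> c2"
      by (rule Z_eq[of _ _ "dim \<sigma>"]) (use 1 2 ts w(1-3) WD(1-3)[OF t] F'(2,5) c2 in simp_all)
    then show "W \<sigma> \<cdot> h \<cdot> w = W \<sigma> \<cdot> c2"
      using WD(1-3)[OF t] h(1-3) w(1-3) by (simp add: comp_reduce[OF h(4)[OF t]])
  qed (use h(1-3) w(1-3) F' c2 in simp_all)
  have "s \<cdot> w = Id C (Dom C c2)"
  proof (rule universal_fill_eq[OF F])
    show "c2 \<cdot> s \<cdot> w = c2 \<cdot> Id C (Dom C c2)"
      using s(1-3) h(1-3) w(1-3) F'(2) hw by (simp add: comp_reduce[OF s(4)])
    show "e \<cdot> s \<cdot> w = e \<cdot> Id C (Dom C c2)"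
      using s(1-3) h(1-3) w(1-4) F'(4-6) F'(2) by (simp add: comp_reduce[OF s(5)])
  qed (use s(1-3) h(1-3) w(1-3) F' in simp_all)
  moreover have "w \<cdot> s = Id C (Ob Z m)"
  proof (rule Z_eq[of _ _ m])
    show "i m \<cdot> w \<cdot> s = i m \<cdot> Id C (Ob Z m)"
      using s h(1-3) w(1-3) F'(4-6) F'(2) by (simp add: comp_reduce[OF w(4)])
    show "b m \<cdot> w \<cdot> s = b m \<cdot> Id C (Ob Z m)"
      using s(1-4) h(1-3) w(1-3) F'(2,5) D(2) c2 ch by (simp add: comp_reduce[OF w(5)])
  qed (use s(1-3) h(1-3) w(1-3) F' in simp_all)
  ultimately have "s \<in> Cov C" using iso_Cov[of s w] s(1-3) h(1-3) w(1-3) F'(5) by simp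
  then have "h \<in> Cov C" using comp_Cov[of s c2] s(3,4) F'(1) by simp
  then show ?thesis using W h by (intro exI conjI ballI) simp_all
qed

lemma Z_lie: "lie_groupoid C \<infinity> Z"
  unfolding lie_groupoid_def
proof (intro conjI allI impI)
  fix m j :: nat assume "0 < m" "j \<le> m"
  then obtain L W h where "is_hom_obj C Z (horn m j) L W" "h \<in> hom C (Ob Z m) L"
      "\<forall>\<sigma>\<in>horn m j. W \<sigma> \<cdot> h = Op Z m \<sigma>" "h \<in> Cov C"
    using horn_restriction_cover by blast
  then show "\<exists>L u h. is_hom_obj C Z (horn m j) L u \<and> h \<in> hom C (Ob Z m) L \<and>
      (\<forall>\<sigma>\<in>horn m j. u \<sigma> \<cdot> h = Op Z m \<sigma>) \<and> h \<in> Cov C \<and> (\<infinity> < enat m \<longrightarrow> is_iso C h)"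
    by (intro exI[of _ L] exI[of _ W] exI[of _ h] conjI) simp_all
qed (rule Z_obj)

end

section \<open>Regular embeddings from pullbacks of a product\<close>

context covers
begin

lemma product_sym: "is_product C a b P p q \<Longrightarrow> is_product C b a P q p"
  unfolding is_product_def by (metis (no_types, lifting))

lemma pullback_sym:
  assumes "is_pullback C f g p q"
  shows "is_pullback C g f q p"
proof -
  note D = pullbackD[OF assms]
  show ?thesis
  proof (rule pullbackI)
    fix x y assume a: "x \<in> Arr C" "y \<in> Arr C" "Dom C x = Dom C y" "Cod C x = Dom C g" "Cod C y = Dom C f" "g \<cdot> x = f \<cdot> y"
    obtain h where "h \<in> Arr C" "Dom C h = Dom C y" "Cod C h = Dom C p" "p \<cdot> h = y" "q \<cdot> h = x"
      using pullback_lift[OF assms a(2,1,5,4) a(3)[symmetric] a(6)[symmetric]] .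
    then show "\<exists>h. h \<in> Arr C \<and> Dom C h = Dom C y \<and> Cod C h = Dom C q \<and> q \<cdot> h = x \<and> p \<cdot> h = y"
      using D(6) by (intro exI[of _ h]) simp
  next
    fix h h' assume a: "h \<in> Arr C" "h' \<in> Arr C" "Dom C h = Dom C h'" "Cod C h = Dom C q" "Cod C h' = Dom C q"
      "q \<cdot> h = q \<cdot> h'" "p \<cdot> h = p \<cdot> h'"
    show "h = h'" by (rule pullback_eq[OF assms]) (use a(1-5) D(6) in simp_all, use a(6,7) in auto)
  qed (use D in simp_all)
qed

text \<open>The map \<open>f \<times> id\<close> is the pullback of \<open>f\<close> along the projection \<open>p'\<close>.\<close>

lemma product_map_cover_left:
  assumes P: "is_product C a b P p q" and P': "is_product C a' b P' p' q'" and f: "f \<in> Cov C" "Dom C f = a" "Cod C f = a'"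
    and \<pi>: "\<pi> \<in> Arr C" "Dom C \<pi> = P" "Cod C \<pi> = P'" "p' \<cdot> \<pi> = f \<cdot> p" "q' \<cdot> \<pi> = q"
  shows "\<pi> \<in> Cov C"
proof -
  note D = productD[OF P] and D' = productD[OF P']
  have "is_pullback C f p' p \<pi>"
  proof (rule pullbackI)
    fix x y assume a: "x \<in> Arr C" "y \<in> Arr C" "Dom C x = Dom C y" "Cod C x = Dom C f" "Cod C y = Dom C p'" "f \<cdot> x = p' \<cdot> y"
    obtain h where h: "h \<in> Arr C" "Dom C h = Dom C x" "Cod C h = P" "p \<cdot> h = x" "q \<cdot> h = q' \<cdot> y"
      by (rule product_lift[OF P, of x "q' \<cdot> y"]) (use a(1-5) D' f in simp_all)
    have "\<pi> \<cdot> h = y"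
    proof (rule product_eq[OF P'])
      show "p' \<cdot> \<pi> \<cdot> h = p' \<cdot> y" using h(1-4) \<pi>(1-3) D D' f a(6) by (simp add: comp_reduce[OF \<pi>(4)])
      show "q' \<cdot> \<pi> \<cdot> h = q' \<cdot> y" using h(1-3,5) \<pi>(1-3) D D' by (simp add: comp_reduce[OF \<pi>(5)])
    qed (use h(1-3) \<pi>(1-3) a(1-5) D' in simp_all)
    then show "\<exists>h. h \<in> Arr C \<and> Dom C h = Dom C y \<and> Cod C h = Dom C p \<and> p \<cdot> h = x \<and> \<pi> \<cdot> h = y"
      using h a(3) D by (intro exI[of _ h]) simp
  next
    fix h h' assume a: "h \<in> Arr C" "h' \<in> Arr C" "Dom C h = Dom C h'" "Cod C h = Dom C p" "Cod C h' = Dom C p"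
      "p \<cdot> h = p \<cdot> h'" "\<pi> \<cdot> h = \<pi> \<cdot> h'"
    have "q' \<cdot> \<pi> \<cdot> h = q' \<cdot> \<pi> \<cdot> h'" using a(7) by simp
    then have "q \<cdot> h = q \<cdot> h'" using a(1-5) \<pi>(1-3) D D' by (simp add: comp_reduce[OF \<pi>(5)])
    with a(6) show "h = h'" by - (rule product_eq[OF P], use a(1-5) D in simp_all)
  qed (use D D' f \<pi> in simp_all)
  then show ?thesis using pullback_Cov f by blast
qed

lemma product_map_cover:
  assumes P: "is_product C a b P p q" and P': "is_product C a' b' P' p' q'"
    and f: "f \<in> Cov C" "Dom C f = a" "Cod C f = a'" and g: "g \<in> Cov C" "Dom C g = b" "Cod C g = b'"
    and \<pi>: "\<pi> \<in> Arr C" "Dom C \<pi> = P" "Cod C \<pi> = P'" "p' \<cdot> \<pi> = f \<cdot> p" "q' \<cdot> \<pi> = g \<cdot> q"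
  shows "\<pi> \<in> Cov C"
proof -
  note D = productD[OF P] and D' = productD[OF P']
  obtain R s t where R: "is_product C a' b R s t" using product_ex D' D by metis
  note DR = productD[OF R]
  obtain \<pi>1 where \<pi>1: "\<pi>1 \<in> Arr C" "Dom C \<pi>1 = Dom C (f \<cdot> p)" "Cod C \<pi>1 = R" "s \<cdot> \<pi>1 = f \<cdot> p" "t \<cdot> \<pi>1 = q"
    by (rule product_lift[OF R, of "f \<cdot> p" q]) (use D f in simp_all)
  have d1: "Dom C \<pi>1 = P" using \<pi>1(2) D f by simp
  obtain \<pi>2 where \<pi>2: "\<pi>2 \<in> Arr C" "Dom C \<pi>2 = Dom C s" "Cod C \<pi>2 = P'" "p' \<cdot> \<pi>2 = s" "q' \<cdot> \<pi>2 = g \<cdot> t"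
    by (rule product_lift[OF P', of s "g \<cdot> t"]) (use DR g in simp_all)
  have c1: "\<pi>1 \<in> Cov C"
    using product_map_cover_left[OF P R f \<pi>1(1) d1 \<pi>1(3-5)] .
  have c2: "\<pi>2 \<in> Cov C"
    by (rule product_map_cover_left[OF product_sym[OF R] product_sym[OF P'] g]) (use \<pi>2 DR in simp_all)
  have "\<pi> = \<pi>2 \<cdot> \<pi>1"
  proof (rule product_eq[OF P'])
    show "p' \<cdot> \<pi> = p' \<cdot> \<pi>2 \<cdot> \<pi>1"
      using \<pi>(4) \<pi>1(1,3,4) \<pi>2(1-3) d1 DR D' by (simp add: comp_reduce[OF \<pi>2(4)])
    show "q' \<cdot> \<pi> = q' \<cdot> \<pi>2 \<cdot> \<pi>1"
      using \<pi>(5) \<pi>1(1,3,5) \<pi>2(1-3) d1 DR D' g by (simp add: comp_reduce[OF \<pi>2(5)])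
  qed (use \<pi> \<pi>1(1-3) \<pi>2(1-3) d1 DR in simp_all)
  then show ?thesis using comp_Cov[OF c1 c2] \<pi>1(3) \<pi>2(2) DR by simp
qed

text \<open>Think of \<open>R\<close> as the pairs \<open>(w, x)\<close> in \<open>W \<times> V\<close> with equal image in \<open>M\<close>, where \<open>w = d1\<close> and \<open>x = p1 d0\<close>. Then
  \<open>\<delta> = (p1 d0, d1) : R \<rightarrow> V \<times> W\<close> is the pullback of the diagonal of \<open>M\<close> along the cover \<open>V \<times> W \<rightarrow> M \<times> M\<close>. The
  cover \<open>p1 \<times> id : W \<times> W \<rightarrow> V \<times> W\<close> pulls \<open>\<delta>\<close> back to a regular embedding \<open>\<epsilon> : R \<times> F \<rightarrow> W \<times> W\<close>, and \<open>\<mu>\<close> is \<open>\<epsilon>\<close>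
  after the graph of the component \<open>p2 d0 : R \<rightarrow> F\<close> of \<open>d0\<close>.\<close>

lemma regular_embedding_of_pullback:
  assumes h: "h \<in> Cov C" "Dom C h = V" "Cod C h = M"
    and W: "is_product C V F W p1 p2"
    and d: "d0 \<in> hom C R W" "d1 \<in> hom C R W"
    and pb: "is_pullback C (h \<cdot> p1) h d1 (p1 \<cdot> d0)"
    and P: "is_product C W W P p q" and \<mu>: "\<mu> \<in> hom C R P" "p \<cdot> \<mu> = d0" "q \<cdot> \<mu> = d1"
  shows "regular_embedding C \<mu>"
proof -
  note WD = productD[OF W] and PD = productD[OF P]
  note [simp] = h(2,3) WD(1-6) PD(1-6)
  have hA [simp]: "h \<in> Arr C" using h by simp
  have d' [simp]: "d0 \<in> Arr C" "Dom C d0 = R" "Cod C d0 = W" "d1 \<in> Arr C" "Dom C d1 = R" "Cod C d1 = W"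
    "\<mu> \<in> Arr C" "Dom C \<mu> = R" "Cod C \<mu> = P" using d \<mu> by simp_all
  have RO [simp]: "R \<in> Obj C" using Dom_Obj[OF d'(1)] by simp
  have MO: "M \<in> Obj C" using Cod_Obj[OF hA] by simp
  have hp: "h \<cdot> p1 \<cdot> d1 = h \<cdot> p1 \<cdot> d0" using pullbackD(9)[OF pb] by simp
  have p1c: "p1 \<in> Cov C" by (rule product_proj_Cov[OF W])
  obtain MM m1 m2 where MM: "is_product C M M MM m1 m2" using product_ex[OF MO MO] .
  note MD = productD[OF MM]
  note [simp] = MD(1-6)
  obtain \<Delta> where \<Delta>: "\<Delta> \<in> Arr C" "Dom C \<Delta> = M" "Cod C \<Delta> = MM" "m1 \<cdot> \<Delta> = Id C M" "m2 \<cdot> \<Delta> = Id C M"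
    using product_lift[OF MM, of "Id C M" "Id C M"] MO by auto
  have \<Delta>r: "regular_embedding C \<Delta>"
    by (rule regular_embedding.graph[of "Id C M" C M M MM m1 m2]) (use \<Delta> MM MO in simp_all)
  obtain Q s t where Q: "is_product C V W Q s t" using product_ex[OF WD(7) PD(7)] .
  note QD = productD[OF Q]
  note [simp] = QD(1-6)
  obtain \<pi> where \<pi>: "\<pi> \<in> Arr C" "Dom C \<pi> = Q" "Cod C \<pi> = MM" "m1 \<cdot> \<pi> = h \<cdot> s" "m2 \<cdot> \<pi> = (h \<cdot> p1) \<cdot> t"
    using product_lift[OF MM, of "h \<cdot> s" "(h \<cdot> p1) \<cdot> t"] by auto
  have hpc: "h \<cdot> p1 \<in> Cov C" using comp_Cov[OF p1c h(1)] by simp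
  have \<pi>c: "\<pi> \<in> Cov C"
    by (rule product_map_cover[OF Q MM h hpc _ _ \<pi>]) simp_all
  obtain \<delta> where \<delta>: "\<delta> \<in> Arr C" "Dom C \<delta> = R" "Cod C \<delta> = Q" "s \<cdot> \<delta> = p1 \<cdot> d0" "t \<cdot> \<delta> = d1"
    using product_lift[OF Q, of "p1 \<cdot> d0" d1] by auto
  have "is_pullback C \<Delta> \<pi> (h \<cdot> p1 \<cdot> d0) \<delta>"
  proof (rule pullbackI)
    show "\<Delta> \<cdot> h \<cdot> p1 \<cdot> d0 = \<pi> \<cdot> \<delta>"
    proof (rule product_eq[OF MM])
      show "m1 \<cdot> \<Delta> \<cdot> h \<cdot> p1 \<cdot> d0 = m1 \<cdot> \<pi> \<cdot> \<delta>"
        using \<Delta>(1-3) \<pi>(1-3) \<delta>(1-4) by (simp add: comp_reduce[OF \<Delta>(4)] comp_reduce[OF \<pi>(4)])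
      show "m2 \<cdot> \<Delta> \<cdot> h \<cdot> p1 \<cdot> d0 = m2 \<cdot> \<pi> \<cdot> \<delta>"
        using \<Delta>(1-3) \<pi>(1-3) \<delta>(1-3,5) hp by (simp add: comp_reduce[OF \<Delta>(5)] comp_reduce[OF \<pi>(5)])
    qed (use \<Delta>(1-3) \<pi>(1-3) \<delta>(1-3) in simp_all)
  next
    fix x y assume a: "x \<in> Arr C" "y \<in> Arr C" "Dom C x = Dom C y" "Cod C x = Dom C \<Delta>" "Cod C y = Dom C \<pi>"
      "\<Delta> \<cdot> x = \<pi> \<cdot> y"
    have yQ: "Cod C y = Q" and xM: "Cod C x = M" using a \<Delta> \<pi> by simp_all
    have 1: "x = h \<cdot> s \<cdot> y"
    proof -
      have "m1 \<cdot> \<Delta> \<cdot> x = m1 \<cdot> \<pi> \<cdot> y" using a(6) by simp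
      then show ?thesis using a(1-3) xM yQ \<Delta>(1-3) \<pi>(1-3) by (simp add: comp_reduce[OF \<Delta>(4)] comp_reduce[OF \<pi>(4)])
    qed
    have 2: "x = h \<cdot> p1 \<cdot> t \<cdot> y"
    proof -
      have "m2 \<cdot> \<Delta> \<cdot> x = m2 \<cdot> \<pi> \<cdot> y" using a(6) by simp
      then show ?thesis using a(1-3) xM yQ \<Delta>(1-3) \<pi>(1-3) by (simp add: comp_reduce[OF \<Delta>(5)] comp_reduce[OF \<pi>(5)])
    qed
    obtain z where z: "z \<in> Arr C" "Dom C z = Dom C (t \<cdot> y)" "Cod C z = Dom C d1" "d1 \<cdot> z = t \<cdot> y" "(p1 \<cdot> d0) \<cdot> z = s \<cdot> y"
      by (rule pullback_lift[OF pb, of "t \<cdot> y" "s \<cdot> y"]) (use a(2) yQ 1 2 in simp_all)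
    have z': "Dom C z = Dom C y" "Cod C z = R" using z(2,3) a(2) yQ by simp_all
    have "\<delta> \<cdot> z = y"
    proof (rule product_eq[OF Q])
      show "s \<cdot> \<delta> \<cdot> z = s \<cdot> y" using z(1,5) z' \<delta>(1-3) by (simp add: comp_reduce[OF \<delta>(4)])
      show "t \<cdot> \<delta> \<cdot> z = t \<cdot> y" using z(1,4) z' \<delta>(1-3) by (simp add: comp_reduce[OF \<delta>(5)])
    qed (use z(1) z' \<delta>(1-3) a(2) yQ in simp_all)
    moreover have "(h \<cdot> p1 \<cdot> d0) \<cdot> z = x"
    proof -
      have "(h \<cdot> p1 \<cdot> d0) \<cdot> z = h \<cdot> (p1 \<cdot> d0) \<cdot> z" using z(1) z' by simp
      then show ?thesis unfolding z(5) using 1 by simp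
    qed
    ultimately show "\<exists>z. z \<in> Arr C \<and> Dom C z = Dom C y \<and> Cod C z = Dom C (h \<cdot> p1 \<cdot> d0) \<and> (h \<cdot> p1 \<cdot> d0) \<cdot> z = x \<and> \<delta> \<cdot> z = y"
      using z(1) z' by (intro exI[of _ z]) simp
  next
    fix z z' assume a: "z \<in> Arr C" "z' \<in> Arr C" "Dom C z = Dom C z'" "Cod C z = Dom C (h \<cdot> p1 \<cdot> d0)"
      "Cod C z' = Dom C (h \<cdot> p1 \<cdot> d0)" "\<delta> \<cdot> z = \<delta> \<cdot> z'"
    have zR: "Cod C z = R" "Cod C z' = R" using a(4,5) by simp_all
    have "s \<cdot> \<delta> \<cdot> z = s \<cdot> \<delta> \<cdot> z'" "t \<cdot> \<delta> \<cdot> z = t \<cdot> \<delta> \<cdot> z'" using a(6) by simp_all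
    then have "(p1 \<cdot> d0) \<cdot> z = (p1 \<cdot> d0) \<cdot> z'" "d1 \<cdot> z = d1 \<cdot> z'"
      using a(1-3) zR \<delta>(1-3) by (simp_all add: comp_reduce[OF \<delta>(4)] comp_reduce[OF \<delta>(5)])
    then show "z = z'" by - (rule pullback_eq[OF pb], use a(1-3) zR in simp_all)
  qed (use \<Delta> \<pi> \<delta> in simp_all)
  then have \<delta>r: "regular_embedding C \<delta>" using regular_embedding.pullback[OF \<Delta>r \<pi>c] by blast
  obtain \<pi>' where \<pi>': "\<pi>' \<in> Arr C" "Dom C \<pi>' = P" "Cod C \<pi>' = Q" "s \<cdot> \<pi>' = p1 \<cdot> p" "t \<cdot> \<pi>' = q"
    using product_lift[OF Q, of "p1 \<cdot> p" q] by auto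
  have \<pi>'c: "\<pi>' \<in> Cov C"
    by (rule product_map_cover_left[OF P Q p1c _ _ \<pi>']) simp_all
  obtain \<epsilon> a where pb': "is_pullback C \<pi>' \<delta> \<epsilon> a" using pullback_ex[OF \<pi>'c \<delta>(1)] \<delta>(3) \<pi>'(3) by auto
  have \<epsilon>r: "regular_embedding C \<epsilon>" using regular_embedding.pullback[OF \<delta>r \<pi>'c pullback_sym[OF pb']] .
  note E = pullbackD[OF pb']
  have E' [simp]: "\<epsilon> \<in> Arr C" "a \<in> Arr C" "Dom C a = Dom C \<epsilon>" "Cod C \<epsilon> = P" "Cod C a = R"
    using E \<pi>' \<delta> by simp_all
  have sa: "p1 \<cdot> p \<cdot> \<epsilon> = p1 \<cdot> d0 \<cdot> a" and ta: "q \<cdot> \<epsilon> = d1 \<cdot> a"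
  proof -
    have "s \<cdot> \<pi>' \<cdot> \<epsilon> = s \<cdot> \<delta> \<cdot> a" "t \<cdot> \<pi>' \<cdot> \<epsilon> = t \<cdot> \<delta> \<cdot> a" using E(9) by simp_all
    then show "p1 \<cdot> p \<cdot> \<epsilon> = p1 \<cdot> d0 \<cdot> a" "q \<cdot> \<epsilon> = d1 \<cdot> a" using \<pi>'(1-3) \<delta>(1-3)
      by (simp_all add: comp_reduce[OF \<delta>(4)] comp_reduce[OF \<delta>(5)] comp_reduce[OF \<pi>'(4)] comp_reduce[OF \<pi>'(5)])
  qed
  have prod: "is_product C R F (Dom C \<epsilon>) a (p2 \<cdot> p \<cdot> \<epsilon>)"
  proof (rule productI)
    fix x y assume b: "x \<in> Arr C" "y \<in> Arr C" "Dom C x = Dom C y" "Cod C x = R" "Cod C y = F"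
    obtain w where w: "w \<in> Arr C" "Dom C w = Dom C (p1 \<cdot> d0 \<cdot> x)" "Cod C w = W" "p1 \<cdot> w = p1 \<cdot> d0 \<cdot> x" "p2 \<cdot> w = y"
      by (rule product_lift[OF W, of "p1 \<cdot> d0 \<cdot> x" y]) (use b in simp_all)
    have wx: "Dom C w = Dom C x" using w(2) b by simp
    obtain e where e: "e \<in> Arr C" "Dom C e = Dom C w" "Cod C e = P" "p \<cdot> e = w" "q \<cdot> e = d1 \<cdot> x"
      by (rule product_lift[OF P, of w "d1 \<cdot> x"]) (use b w wx in simp_all)
    have "\<pi>' \<cdot> e = \<delta> \<cdot> x"
    proof (rule product_eq[OF Q])
      show "s \<cdot> \<pi>' \<cdot> e = s \<cdot> \<delta> \<cdot> x" using b(1-4) w(4) e(1-4) wx \<pi>'(1-3) \<delta>(1-3)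
        by (simp add: comp_reduce[OF \<delta>(4)] comp_reduce[OF \<pi>'(4)])
      show "t \<cdot> \<pi>' \<cdot> e = t \<cdot> \<delta> \<cdot> x" using b(1-4) e(1-3,5) wx \<pi>'(1-3) \<delta>(1-3)
        by (simp add: comp_reduce[OF \<delta>(5)] comp_reduce[OF \<pi>'(5)])
    qed (use b(1-4) e(1-3) wx \<pi>'(1-3) \<delta>(1-3) in simp_all)
    then obtain z where z: "z \<in> Arr C" "Dom C z = Dom C e" "Cod C z = Dom C \<epsilon>" "\<epsilon> \<cdot> z = e" "a \<cdot> z = x"
      using pullback_lift[OF pb' e(1) b(1)] e(2,3) b(4) wx \<pi>'(2) \<delta>(2) by metis
    have "(p2 \<cdot> p \<cdot> \<epsilon>) \<cdot> z = y" using z(1-4) e(1-4) w(5) by simp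
    then show "\<exists>z. z \<in> Arr C \<and> Dom C z = Dom C y \<and> Cod C z = Dom C \<epsilon> \<and> a \<cdot> z = x \<and> (p2 \<cdot> p \<cdot> \<epsilon>) \<cdot> z = y"
      using z e(2) wx b(3) by (intro exI[of _ z]) simp
  next
    fix z z' assume b: "z \<in> Arr C" "z' \<in> Arr C" "Dom C z = Dom C z'" "Cod C z = Dom C \<epsilon>" "Cod C z' = Dom C \<epsilon>"
      "a \<cdot> z = a \<cdot> z'" "(p2 \<cdot> p \<cdot> \<epsilon>) \<cdot> z = (p2 \<cdot> p \<cdot> \<epsilon>) \<cdot> z'"
    have 1: "(p1 \<cdot> p \<cdot> \<epsilon>) \<cdot> z = (p1 \<cdot> p \<cdot> \<epsilon>) \<cdot> z'" unfolding sa using b(1-6) by simp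
    have 2: "(q \<cdot> \<epsilon>) \<cdot> z = (q \<cdot> \<epsilon>) \<cdot> z'" unfolding ta using b(1-6) by simp
    have "p \<cdot> \<epsilon> \<cdot> z = p \<cdot> \<epsilon> \<cdot> z'" by (rule product_eq[OF W]) (use b(1-5,7) 1 in simp_all)
    then have "\<epsilon> \<cdot> z = \<epsilon> \<cdot> z'" by - (rule product_eq[OF P], use b(1-5) 2 in simp_all)
    then show "z = z'" using pullback_eq[OF pb' b(1,2)] b(3-6) by simp
  qed simp_all
  have "\<pi>' \<cdot> \<mu> = \<delta> \<cdot> Id C R"
  proof (rule product_eq[OF Q])
    show "s \<cdot> \<pi>' \<cdot> \<mu> = s \<cdot> \<delta> \<cdot> Id C R" using \<mu>(2) \<pi>'(1-3) \<delta>(1-4) by (simp add: comp_reduce[OF \<pi>'(4)])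
    show "t \<cdot> \<pi>' \<cdot> \<mu> = t \<cdot> \<delta> \<cdot> Id C R" using \<mu>(3) \<pi>'(1-3) \<delta>(1-3,5) by (simp add: comp_reduce[OF \<pi>'(5)])
  qed (use \<pi>'(1-3) \<delta>(1-3) in simp_all)
  then obtain \<gamma> where \<gamma>: "\<gamma> \<in> Arr C" "Dom C \<gamma> = Dom C \<mu>" "Cod C \<gamma> = Dom C \<epsilon>" "\<epsilon> \<cdot> \<gamma> = \<mu>" "a \<cdot> \<gamma> = Id C R"
    using pullback_lift[OF pb', of \<mu> "Id C R"] \<pi>'(2) \<delta>(2) by auto
  have "regular_embedding C \<gamma>"
  proof (rule regular_embedding.graph[of "p2 \<cdot> d0" C R F "Dom C \<epsilon>" a "p2 \<cdot> p \<cdot> \<epsilon>"])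
    show "(p2 \<cdot> p \<cdot> \<epsilon>) \<cdot> \<gamma> = p2 \<cdot> d0" using \<gamma>(1-4) \<mu>(2) by simp
  qed (use prod \<gamma> in simp_all)
  then have "regular_embedding C (\<epsilon> \<cdot> \<gamma>)" using regular_embedding.comp[OF _ \<epsilon>r] \<gamma>(3) by simp
  then show ?thesis using \<gamma>(4) by simp
qed

end

section \<open>Regularity of the higher morphism space\<close>

text \<open>The list \<open>id_join n [0, 0]\<close> is the degeneracy operator \<open>[n + 1] \<rightarrow> [n]\<close> that repeats \<open>n\<close>. It has the two
  sections \<open>id_join n [0]\<close> and \<open>id_join n [1]\<close>, the last two coface operators.\<close>

lemma nth_squash: "a \<le> n + 1 \<Longrightarrow> id_join n [0, 0] ! a = (if a < n then a else n)"
  by (subst nth_id_join) (auto simp: nth_Cons' less_Suc_eq_le)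

lemma squash_simplex: "[0, 0] \<in> simplex 0" "dim [0 :: nat, 0] = 1" "id_join n [0, 0] \<in> simplex n"
proof -
  show 1: "[0, 0] \<in> simplex 0" by (simp add: simplex_iff)
  show "dim [0 :: nat, 0] = 1" by (simp add: One_nat_def)
  show "id_join n [0, 0] \<in> simplex n" using id_join_simplex[OF 1, of n] by simp
qed

text \<open>A face that misses \<open>n\<close> and a further vertex is mapped injectively by the degeneracy, and the image of that
  further vertex is missed as well.\<close>

lemma squash_boundary:
  assumes "\<sigma> \<in> horn (n + 1) n" "n \<notin> set \<sigma>"
  shows "mcomp (id_join n [0, 0]) \<sigma> \<in> boundary n"
proof -
  have \<sigma>: "\<sigma> \<in> simplex (n + 1)" "\<not> {0..n + 1} - {n} \<subseteq> set \<sigma>" using assms(1) unfolding horn_def by blast+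
  then obtain a where "a \<in> {0..n + 1} - {n}" and a': "a \<notin> set \<sigma>" by blast
  then have a: "a < n \<or> a = n + 1" by auto
  have sc: "c \<le> n + 1" if "c \<in> set \<sigma>" for c using that \<sigma>(1) by (auto simp: simplex_iff)
  have "(if a < n then a else n) \<notin> (!) (id_join n [0, 0]) ` set \<sigma>"
  proof
    assume "(if a < n then a else n) \<in> (!) (id_join n [0, 0]) ` set \<sigma>"
    then obtain c where c: "c \<in> set \<sigma>" "(if a < n then a else n) = id_join n [0, 0] ! c" by blast
    have "c \<noteq> n" "c \<noteq> a" using c(1) assms(2) a' by blast+
    then show False using c(2) a sc[OF c(1)] unfolding nth_squash[OF sc[OF c(1)]] by (simp split: if_splits)
  qed
  moreover have "(if a < n then a else n) \<in> {0..n}" by simp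
  ultimately have "\<not> {0..n} \<subseteq> set (mcomp (id_join n [0, 0]) \<sigma>)" unfolding set_mcomp by blast
  moreover have "mcomp (id_join n [0, 0]) \<sigma> \<in> simplex n"
  proof (rule mcomp_simplex[OF squash_simplex(3)])
    have "dim (id_join n [0, 0]) = n + 1" by (simp add: One_nat_def)
    with \<sigma>(1) show "\<sigma> \<in> simplex (dim (id_join n [0, 0]))" by metis
  qed
  ultimately show ?thesis by (simp add: boundary_def)
qed

lemma id_join_0: "id_join n [0] = [0..<Suc n]"
  using id_join_id[of n 0] by simp

lemma squash_id_join:
  assumes "c \<le> 1"
  shows "mcomp (id_join n [0, 0]) (id_join n [c]) = [0..<Suc n]"
proof -
  have "[c] \<in> simplex (dim [0 :: nat, 0])" using assms by (simp add: simplex_iff One_nat_def)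
  from id_join_mcomp[OF this squash_simplex(1), of n, symmetric]
  have "mcomp (id_join n [0, 0]) (id_join n [c]) = id_join n (mcomp [0, 0] [c])" .
  moreover have "mcomp [0, 0] [c] = [0 :: nat]" using assms by (simp add: mcomp_def nth_Cons')
  ultimately show ?thesis using id_join_0 by simp
qed

lemma vertex_simplex: "c \<le> m \<Longrightarrow> [c] \<in> simplex m"
  by (simp add: simplex_iff)

lemma boundary_horn_or_face:
  assumes "\<sigma> \<in> boundary (n + 1)" "\<sigma> \<notin> horn (n + 1) n"
  shows "n \<notin> set \<sigma>" "set \<sigma> \<subseteq> set (id_join n [1])"
proof -
  have \<sigma>: "\<sigma> \<in> simplex (n + 1)" "\<not> {0..n + 1} \<subseteq> set \<sigma>" "{0..n + 1} - {n} \<subseteq> set \<sigma>"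
    using assms unfolding boundary_def horn_def by blast+
  then show n: "n \<notin> set \<sigma>" by blast
  have "set (id_join n [1]) = {0..<n} \<union> {n + 1}" by (simp add: set_id_join)
  moreover have "set \<sigma> \<subseteq> {0..n + 1}" using \<sigma>(1) by (simp add: simplex_iff)
  moreover have "{0..n + 1} - {n} \<subseteq> {0..<n} \<union> {n + 1}" by auto
  ultimately show "set \<sigma> \<subseteq> set (id_join n [1])" using n by blast
qed

lemma horn_bdry_or_face:
  assumes "\<sigma> \<in> horn (n + 1) n" "\<sigma> \<notin> bdry_part n 1"
  shows "set \<sigma> \<subseteq> set (id_join n [0])"
proof -
  have \<sigma>: "\<sigma> \<in> simplex (n + 1)" "\<not> {0..n + 1} - {n} \<subseteq> set \<sigma>" "{0..<n} \<subseteq> set \<sigma>"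
    using assms unfolding bdry_part_def horn_def by blast+
  have "{0..n + 1} - {n} \<subseteq> {0..<n} \<union> {n + 1}" by auto
  then have "n + 1 \<notin> set \<sigma>" using \<sigma> by blast
  moreover have "set \<sigma> \<subseteq> {0..n + 1}" using \<sigma>(1) by (simp add: simplex_iff)
  moreover have "{0..n + 1} - {n + 1} \<subseteq> set (id_join n [0])" by (auto simp: id_join_0)
  ultimately show ?thesis by blast
qed

lemma id_join_0_horn: "id_join n [0] \<in> horn (n + 1) n"
  and id_join_1_boundary: "id_join n [1] \<in> boundary (n + 1)"
  and id_join_1_not_horn: "id_join n [1] \<notin> horn (n + 1) n"
proof -
  have s: "id_join n [c] \<in> simplex (n + 1)" if "c \<le> 1" for c
    using id_join_simplex[OF vertex_simplex[OF that]] .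
  have 0: "set (id_join n [0]) = {0..<n} \<union> {n}" and 1: "set (id_join n [1]) = {0..<n} \<union> {n + 1}"
    by (simp_all add: set_id_join)
  have "n + 1 \<in> {0..n + 1} - {n}" "n + 1 \<notin> {0..<n} \<union> {n}" by simp_all
  then have "\<not> {0..n + 1} - {n} \<subseteq> set (id_join n [0])" unfolding 0 by blast
  then show "id_join n [0] \<in> horn (n + 1) n" using s[of 0] by (simp add: horn_def)
  have "n \<in> {0..n + 1}" "n \<notin> {0..<n} \<union> {n + 1}" by simp_all
  then have "\<not> {0..n + 1} \<subseteq> set (id_join n [1])" unfolding 1 by blast
  then show "id_join n [1] \<in> boundary (n + 1)" using s[of 1] by (simp add: boundary_def)
  have "{0..n + 1} - {n} \<subseteq> set (id_join n [1])" unfolding 1 by auto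
  then show "id_join n [1] \<notin> horn (n + 1) n" by (simp add: horn_def)
qed

lemma boundary_bdry_or_fixed:
  assumes "\<sigma> \<in> boundary n" "\<sigma> \<notin> bdry_part n 0"
  shows "mcomp (id_join n [c]) \<sigma> = \<sigma>"
proof -
  have \<sigma>: "\<sigma> \<in> simplex n" "\<not> {0..n} \<subseteq> set \<sigma>" "{0..<n} \<subseteq> set \<sigma>"
    using assms unfolding boundary_def bdry_part_def by auto
  have "{0..n} \<subseteq> insert n {0..<n}" by auto
  then have "n \<notin> set \<sigma>" using \<sigma>(2,3) by blast
  then have "a < n" if "a \<in> set \<sigma>" for a
    using that \<sigma>(1) by (metis atLeastAtMost_iff le_neq_implies_less simplex_iff subsetD)
  moreover have "id_join n [c] ! a = a" if "a < n" for a using that by (simp add: nth_id_join)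
  ultimately show ?thesis unfolding mcomp_def by (intro map_idI) blast
qed

lemma coface_1: "coface 1 0 = [1]" "coface 1 1 = [0]"
  by (simp_all add: coface_def One_nat_def)

context simplicial_morphism
begin

lemma iso_fill:
  assumes L: "is_rel_hom_obj C X Y f N A L u v" and r: "is_rel_restr C X f N A L u v h" and iso: "is_iso C h"
    and p: "pt N A T x y"
  obtains e where "e \<in> Arr C" "Dom C e = T" "Cod C e = Ob X N" "\<And>\<sigma>. \<sigma> \<in> A \<Longrightarrow> Op X N \<sigma> \<cdot> e = x \<sigma>" "f N \<cdot> e = y"
proof -
  note V = ptD[OF rel_hom_objD(2)[OF L]]
  have H: "h \<in> Arr C" "Dom C h = Ob X N" "Cod C h = L" "\<And>\<sigma>. \<sigma> \<in> A \<Longrightarrow> u \<sigma> \<cdot> h = Op X N \<sigma>" "v \<cdot> h = f N"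
    using r by (auto simp: is_rel_restr_def)
  obtain g where g: "g \<in> Arr C" "Dom C g = L" "Cod C g = Ob X N" "h \<cdot> g = Id C L"
    using iso H(2,3) unfolding is_iso_def by auto
  obtain t where t: "t \<in> Arr C" "Dom C t = T" "Cod C t = L" "\<And>\<sigma>. \<sigma> \<in> A \<Longrightarrow> u \<sigma> \<cdot> t = x \<sigma>" "v \<cdot> t = y"
    using rel_hom_obj_lift[OF L p] by metis
  have hg: "h \<cdot> g \<cdot> t = t" using H(1-3) g(1-3) t(1-3) by (simp add: comp_reduce[OF g(4)])
  show ?thesis
  proof (rule that[of "g \<cdot> t"])
    fix \<sigma> assume s: "\<sigma> \<in> A"
    have "Op X N \<sigma> \<cdot> g \<cdot> t = u \<sigma> \<cdot> h \<cdot> g \<cdot> t" using H(1-3) g(1-3) t(1-3) V(1-3)[OF s] by (simp add: comp_reduce[OF H(4)[OF s]])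
    then show "Op X N \<sigma> \<cdot> g \<cdot> t = x \<sigma>" unfolding hg t(4)[OF s] .
  next
    have "f N \<cdot> g \<cdot> t = v \<cdot> h \<cdot> g \<cdot> t" using H(1-3) g(1-3) t(1-3) V(5-7) by (simp add: comp_reduce[OF H(5)])
    then show "f N \<cdot> g \<cdot> t = y" unfolding hg t(5) .
  qed (use g(1-3) t(1-3) in simp_all)
qed

lemma iso_fill_eq:
  assumes L: "is_rel_hom_obj C X Y f N A L u v" and r: "is_rel_restr C X f N A L u v h" and iso: "is_iso C h"
    and A: "A \<subseteq> simplex N" and e: "e \<in> Arr C" "e' \<in> Arr C" "Dom C e = Dom C e'" "Cod C e = Ob X N" "Cod C e' = Ob X N"
    and eq: "\<And>\<sigma>. \<sigma> \<in> A \<Longrightarrow> Op X N \<sigma> \<cdot> e = Op X N \<sigma> \<cdot> e'" "f N \<cdot> e = f N \<cdot> e'"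
  shows "e = e'"
proof -
  note V = ptD[OF rel_hom_objD(2)[OF L]]
  have H: "h \<in> Arr C" "Dom C h = Ob X N" "Cod C h = L" "\<And>\<sigma>. \<sigma> \<in> A \<Longrightarrow> u \<sigma> \<cdot> h = Op X N \<sigma>" "v \<cdot> h = f N"
    using r by (auto simp: is_rel_restr_def)
  obtain g where g: "g \<in> Arr C" "Dom C g = L" "Cod C g = Ob X N" "g \<cdot> h = Id C (Ob X N)"
    using iso H(2,3) unfolding is_iso_def by auto
  have "h \<cdot> e = h \<cdot> e'"
  proof (rule rel_hom_obj_eq[OF L A])
    fix \<sigma> assume s: "\<sigma> \<in> A"
    show "u \<sigma> \<cdot> h \<cdot> e = u \<sigma> \<cdot> h \<cdot> e'" using eq(1)[OF s] e H(1-3) V(1-3)[OF s] by (simp add: comp_reduce[OF H(4)[OF s]])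
  next
    show "v \<cdot> h \<cdot> e = v \<cdot> h \<cdot> e'" using eq(2) e H(1-3) V(5-7) by (simp add: comp_reduce[OF H(5)])
  qed (use e H(1-3) in simp_all)
  then have "g \<cdot> h \<cdot> e = g \<cdot> h \<cdot> e'" by simp
  then show ?thesis using e H(1-3) g(1-3) by (simp add: comp_reduce[OF g(4)])
qed

end

context mor_space
begin

lemma v_id: "vertex_incl B 0 = Id C (Ob B 0)"
  using Op_id[OF B_obj, of 0] by (simp add: vertex_incl_def)

lemma b0: "b 0 = r 0 \<cdot> i 0"
  using pullbackD(9)[OF pb, of 0] v_id by simp

text \<open>The restriction \<open>r 0\<close> is pulled back along \<open>vertex_incl B 0\<close>, an identity.\<close>

lemma i0_iso: "is_iso C (i 0)"
proof -
  obtain z where z: "z \<in> Arr C" "Dom C z = Dom C (Id C (Ob X (k + 0)))" "Cod C z = Ob Z 0" "i 0 \<cdot> z = Id C (Ob X (k + 0))"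
      "b 0 \<cdot> z = r 0"
  proof (rule Z_lift[of "Id C (Ob X (k + 0))" 0 "r 0"])
    fix \<sigma> assume s: "\<sigma> \<in> bdry_part k 0"
    then have "\<sigma> \<in> simplex (k + 0)" using bdry_part_subset by blast
    then show "Op X (k + 0) \<sigma> \<cdot> Id C (Ob X (k + 0)) = u0 0 \<sigma> \<cdot> r 0"
      using u_r[OF s] uv(1-3)[OF s] by (simp add: u0_def v_id)
  next
    show "f (k + 0) \<cdot> Id C (Ob X (k + 0)) = v0 0 \<cdot> r 0"
      using v_r[of 0] by (simp add: v0_def v_id)
  qed (use that in simp_all)
  have "z \<cdot> i 0 = Id C (Ob Z 0)"
  proof (rule Z_eq[of _ _ 0])
    show "i 0 \<cdot> z \<cdot> i 0 = i 0 \<cdot> Id C (Ob Z 0)" using z(1-4) by (simp add: comp_reduce[OF z(4)])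
    have "b 0 \<cdot> z \<cdot> i 0 = r 0 \<cdot> i 0" using z(1-3) by (simp add: comp_reduce[OF z(5)])
    then show "b 0 \<cdot> z \<cdot> i 0 = b 0 \<cdot> Id C (Ob Z 0)" using b0 by simp
  qed (use z in simp_all)
  then show ?thesis using z unfolding is_iso_def by (intro conjI bexI[of _ z]) simp_all
qed

lemma face_simps [simp]:
  "face Z 1 0 \<in> Arr C" "Dom C (face Z 1 0) = Ob Z 1" "Cod C (face Z 1 0) = Ob Z 0"
  "face Z 1 1 \<in> Arr C" "Dom C (face Z 1 1) = Ob Z 1" "Cod C (face Z 1 1) = Ob Z 0"
  unfolding face_def coface_1 using Op_simps[OF Z_obj vertex_simplex[of 1 1]] Op_simps[OF Z_obj vertex_simplex[of 0 1]]
  by simp_all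

lemma i_face: "i 0 \<cdot> face Z 1 0 = Op X (k + 1) (id_join k [1]) \<cdot> i 1"
    "i 0 \<cdot> face Z 1 1 = Op X (k + 1) (id_join k [0]) \<cdot> i 1"
  and b_face: "b 0 \<cdot> face Z 1 0 = b 1" "b 0 \<cdot> face Z 1 1 = b 1"
  unfolding face_def coface_1
  using i_Op[OF vertex_simplex[of 1 1]] i_Op[OF vertex_simplex[of 0 1]] b_Op[OF vertex_simplex[of 1 1]] b_Op[OF vertex_simplex[of 0 1]]
  by simp_all

lemma u0_squash:
  assumes "\<sigma> \<in> bdry_part k 1" "x \<in> Arr C" "Cod C x = Ob Z 0"
  shows "u0 1 \<sigma> \<cdot> b 0 \<cdot> x = Op X k (mcomp (id_join k [0, 0]) \<sigma>) \<cdot> i 0 \<cdot> x"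
proof -
  have s: "\<sigma> \<in> simplex (k + 1)" using assms(1) bdry_part_subset by blast
  have vi: "vertex_incl B 1 = Op B 0 [0, 0]" by (simp add: vertex_incl_def One_nat_def)
  have m: "mcomp (id_join k [0, 0]) \<sigma> \<in> bdry_part k 0"
    using mcomp_id_join_bdry[OF squash_simplex(1), of \<sigma> k, unfolded squash_simplex(2)] s assms(1) by blast
  have "u0 1 \<sigma> = u 0 (mcomp (id_join k [0, 0]) \<sigma>)"
    using u_Op[OF squash_simplex(1), of \<sigma>] assms(1) unfolding u0_def vi squash_simplex(2) by simp
  then have "u0 1 \<sigma> \<cdot> b 0 \<cdot> x = u 0 (mcomp (id_join k [0, 0]) \<sigma>) \<cdot> r 0 \<cdot> i 0 \<cdot> x"
    unfolding b0 using assms(2,3) by simp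
  then show ?thesis using assms(2,3) uv(1-3)[OF m] by (simp add: comp_reduce[OF u_r[OF m]])
qed

lemma v0_squash:
  assumes "x \<in> Arr C" "Cod C x = Ob Z 0"
  shows "v0 1 \<cdot> b 0 \<cdot> x = Op Y k (id_join k [0, 0]) \<cdot> f k \<cdot> i 0 \<cdot> x"
proof -
  have vi: "vertex_incl B 1 = Op B 0 [0, 0]" by (simp add: vertex_incl_def One_nat_def)
  have "v0 1 = Op Y k (id_join k [0, 0]) \<cdot> v 0"
    using v_Op[OF squash_simplex(1)] unfolding v0_def vi squash_simplex(2) by simp
  then have "v0 1 \<cdot> b 0 \<cdot> x = Op Y k (id_join k [0, 0]) \<cdot> v 0 \<cdot> r 0 \<cdot> i 0 \<cdot> x"
    unfolding b0 using assms squash_simplex(3)[of k] by simp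
  then show ?thesis using assms squash_simplex(3)[of k] comp_reduce[OF v_r[of 0], of "i 0 \<cdot> x"] by simp
qed

end

context covers
begin

text \<open>An element of \<open>Z\<^sub>1\<close> is determined by its face \<open>d\<^sub>1\<close> and the image in \<open>U\<^sub>n\<close> of its face \<open>d\<^sub>0\<close>, which can be any
  pair \<open>x, y\<close> with the same image in \<open>M = M\<^sub>n(f)\<close>. The simplex \<open>e\<close> of \<open>E\<^sub>n\<^sub>+\<^sub>1\<close> belonging to \<open>x, y\<close> is found as
  follows. Put \<open>e1 = i 0 \<cdot> x\<close> and \<open>w1 = p n \<cdot> e1\<close>. The boundary of the degenerate simplex on \<open>w1\<close> remains a
  boundary if the face opposite to \<open>n\<close> is replaced by \<open>y\<close>, since \<open>w1\<close> and \<open>y\<close> have the same boundary. By the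
  hypercover condition it bounds a unique simplex \<open>t\<close> of \<open>U\<^sub>n\<^sub>+\<^sub>1\<close> over the degenerate simplex on
  \<open>f n \<cdot> w1\<close>. By the stack condition there is a unique \<open>e\<close> over \<open>t\<close> whose horn is that of the degenerate
  simplex on \<open>e1\<close>.\<close>

lemma mor_space_pullback:
  assumes pm: "simplicial_map C E U p" and fm: "simplicial_map C U X f"
    and pL: "is_rel_hom_obj C E U p (n + 1) (horn (n + 1) n) L1 u1 v1" "is_rel_restr C E p (n + 1) (horn (n + 1) n) L1 u1 v1 h1" "is_iso C h1"
    and fL: "is_rel_hom_obj C U X f (n + 1) (boundary (n + 1)) L2 u2 v2" "is_rel_restr C U f (n + 1) (boundary (n + 1)) L2 u2 v2 h2" "is_iso C h2"
    and fM: "is_rel_hom_obj C U X f n (boundary n) M uM vM" "is_rel_restr C U f n (boundary n) M uM vM h"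
    and Z: "mor_space C E X (\<lambda>k. f k \<cdot> p k) n B u v r Z i b"
  shows "is_pullback C (h \<cdot> p n \<cdot> i 0) h (face Z 1 1) ((p n \<cdot> i 0) \<cdot> face Z 1 0)"
proof -
  interpret p: simplicial_morphism C E U p by unfold_locales (rule pm)
  interpret f: simplicial_morphism C U X f by unfold_locales (rule fm)
  interpret g: mor_space C E X "\<lambda>k. f k \<cdot> p k" n B u v r Z i b by (rule Z)
  let ?N = "n + 1" and ?s = "id_join n [0, 0]"
  have h: "h \<in> Arr C" "Dom C h = Ob U n" "Cod C h = M" "\<And>\<sigma>. \<sigma> \<in> boundary n \<Longrightarrow> uM \<sigma> \<cdot> h = Op U n \<sigma>" "vM \<cdot> h = f n"
    using fM(2) by (simp_all add: is_rel_restr_def)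
  note MD = f.ptD[OF f.rel_hom_objD(2)[OF fM(1)]]
  have i0 [simp]: "Cod C (i 0) = Ob E n" using g.i_simps(3)[of 0] by simp
  have js: "id_join n [0] \<in> simplex ?N" "id_join n [1] \<in> simplex ?N"
    using id_join_simplex[OF vertex_simplex[of 0 1], of n] id_join_simplex[OF vertex_simplex[of 1 1], of n] by simp_all
  have jd: "dim (id_join n [0]) = n" "dim (id_join n [1]) = n" by simp_all
  have ss: "?s \<in> simplex n" "dim ?s = ?N" using squash_simplex(3)[of n] by (simp_all add: One_nat_def)
  have bs: "\<sigma> \<in> simplex n" if "\<sigma> \<in> boundary n" for \<sigma> using that by (simp add: boundary_def)
  have hs: "\<sigma> \<in> simplex ?N" "\<sigma> \<in> boundary ?N" if "\<sigma> \<in> horn ?N n" for \<sigma>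
    using that by (auto simp: horn_def boundary_def)
  have bN: "\<sigma> \<in> simplex ?N" if "\<sigma> \<in> boundary ?N" for \<sigma> using that by (simp add: boundary_def)
  have fi: "i 0 \<cdot> face Z 1 0 \<cdot> z = Op E ?N (id_join n [1]) \<cdot> i 1 \<cdot> z" "i 0 \<cdot> face Z 1 1 \<cdot> z = Op E ?N (id_join n [0]) \<cdot> i 1 \<cdot> z"
      "b 0 \<cdot> face Z 1 0 \<cdot> z = b 1 \<cdot> z" "b 0 \<cdot> face Z 1 1 \<cdot> z = b 1 \<cdot> z"
    if "z \<in> Arr C" "Cod C z = Ob Z 1" for z
    using that js by (simp_all add: comp_reduce[OF g.i_face(1)] comp_reduce[OF g.i_face(2)] comp_reduce[OF g.b_face(1)] comp_reduce[OF g.b_face(2)])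
  have M_eq: "Op U n \<sigma> \<cdot> x = Op U n \<sigma> \<cdot> y" if "h \<cdot> x = h \<cdot> y" "x \<in> Arr C" "y \<in> Arr C" "Cod C x = Ob U n" "Cod C y = Ob U n"
      "\<sigma> \<in> boundary n" for x y \<sigma>
  proof -
    have "uM \<sigma> \<cdot> h \<cdot> x = uM \<sigma> \<cdot> h \<cdot> y" using that(1) by simp
    then show ?thesis
      using that(2-5) h(1-3) MD(1-3)[OF that(6)] by (simp add: comp_reduce[OF h(4)[OF that(6)]])
  qed
  have fM_eq: "f n \<cdot> x = f n \<cdot> y" if "h \<cdot> x = h \<cdot> y" "x \<in> Arr C" "y \<in> Arr C" "Cod C x = Ob U n" "Cod C y = Ob U n" for x y
  proof -
    have "vM \<cdot> h \<cdot> x = vM \<cdot> h \<cdot> y" using that(1) by simp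
    then show ?thesis using that(2-5) h(1-3) MD(5-7) by (simp add: comp_reduce[OF h(5)])
  qed
  have comm: "h \<cdot> p n \<cdot> i 0 \<cdot> face Z 1 1 = h \<cdot> p n \<cdot> i 0 \<cdot> face Z 1 0"
  proof (rule f.rel_hom_obj_eq[OF fM(1) boundary_subset])
    fix \<sigma> assume s: "\<sigma> \<in> boundary n"
    note sb = bs[OF s]
\<comment> \<open>The last two faces of an element of \<open>Z\<^sub>1\<close> have the same boundary: on a boundary simplex containing all
  vertices below \<open>n\<close> both coface operators are the identity, and elsewhere the value is prescribed by \<open>b 1\<close>.\<close>
    have key: "Op E n \<sigma> \<cdot> Op E ?N (id_join n [0]) \<cdot> i 1 = Op E n \<sigma> \<cdot> Op E ?N (id_join n [1]) \<cdot> i 1"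
    proof (cases "\<sigma> \<in> bdry_part n 0")
      case True
      have "Op E n \<sigma> \<cdot> Op E ?N (id_join n [c]) \<cdot> i 1 = u0' \<cdot> b 1"
        if c: "c \<le> 1" and u0': "u0' = g.u0 0 \<sigma>" for c u0'
      proof -
        have cs: "[c] \<in> simplex 1" "dim [c] = 0" using vertex_simplex[OF c] by simp_all
        have m: "mcomp (id_join n [c]) \<sigma> \<in> bdry_part n 1" using mcomp_id_join_bdry[OF cs(1), of \<sigma> n] sb True by simp
        have "Op E n \<sigma> \<cdot> Op E ?N (id_join n [c]) \<cdot> i 1 = Op E ?N (mcomp (id_join n [c]) \<sigma>) \<cdot> i 1"
          using id_join_simplex[OF cs(1), of n] sb by (simp add: Op_Op_comp)
        also have "\<dots> = g.u0 1 (mcomp (id_join n [c]) \<sigma>) \<cdot> b 1"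
          using g.Z_pt(1)[of "Id C (Ob Z 1)" 1, OF _ _ m] by simp
        also have "\<dots> = u0' \<cdot> b 1" using g.u0_join[OF cs(1), of \<sigma>] True u0' cs(2) by simp
        finally show ?thesis .
      qed
      from this[of 0] this[of 1] show ?thesis by simp
    next
      case False
      then show ?thesis using boundary_bdry_or_fixed[OF s False] js sb by (simp add: Op_Op_comp)
    qed
    show "uM \<sigma> \<cdot> h \<cdot> p n \<cdot> i 0 \<cdot> face Z 1 1 = uM \<sigma> \<cdot> h \<cdot> p n \<cdot> i 0 \<cdot> face Z 1 0"
      using h(1-3) MD(1-3)[OF s] sb js key
      by (simp add: comp_reduce[OF h(4)[OF s]] g.i_face p.natural_comp[symmetric])
  next
    have key: "f n \<cdot> p n \<cdot> Op E ?N (id_join n [c]) \<cdot> i 1 = g.v0 0 \<cdot> b 1" if c: "c \<le> 1" for c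
    proof -
      have cs: "[c] \<in> simplex 1" "dim [c] = 0" using vertex_simplex[OF c] by simp_all
      have js: "id_join n [c] \<in> simplex ?N" using id_join_simplex[OF cs(1)] .
      have "f n \<cdot> p n \<cdot> Op E ?N (id_join n [c]) \<cdot> i 1 = Op X ?N (id_join n [c]) \<cdot> f ?N \<cdot> p ?N \<cdot> i 1"
        using js by (simp add: p.natural_comp f.natural_comp)
      also have "f ?N \<cdot> p ?N \<cdot> i 1 = g.v0 1 \<cdot> b 1" using g.Z_pt(2)[of "Id C (Ob Z 1)" 1] by simp
      also have "Op X ?N (id_join n [c]) \<cdot> g.v0 1 \<cdot> b 1 = g.v0 0 \<cdot> b 1"
        using js cs(2) comp_reduce[OF g.v0_join[OF cs(1)]] by simp
      finally show ?thesis .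
    qed
    show "vM \<cdot> h \<cdot> p n \<cdot> i 0 \<cdot> face Z 1 1 = vM \<cdot> h \<cdot> p n \<cdot> i 0 \<cdot> face Z 1 0"
      using h(1-3) MD(5-7) js key[of 0] key[of 1] by (simp add: comp_reduce[OF h(5)] g.i_face)
  qed (use h in simp_all)
  show ?thesis
  proof (rule pullbackI)
    show "(h \<cdot> p n \<cdot> i 0) \<cdot> face Z 1 1 = h \<cdot> (p n \<cdot> i 0) \<cdot> face Z 1 0" using comm h(1,2) by simp
  next
    fix x y assume a: "x \<in> Arr C" "y \<in> Arr C" "Dom C x = Dom C y" "Cod C x = Dom C (h \<cdot> p n \<cdot> i 0)" "Cod C y = Dom C h"
      "(h \<cdot> p n \<cdot> i 0) \<cdot> x = h \<cdot> y"
    have xy: "Cod C x = Ob Z 0" "Cod C y = Ob U n" using a(4,5) h(1,2) by simp_all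
    define e1 where "e1 = i 0 \<cdot> x"
    define w1 where "w1 = p n \<cdot> e1"
    have e1: "e1 \<in> Arr C" "Dom C e1 = Dom C y" "Cod C e1 = Ob E n" unfolding e1_def using a(1,3) xy by simp_all
    have w1: "w1 \<in> Arr C" "Dom C w1 = Dom C y" "Cod C w1 = Ob U n" unfolding w1_def using e1 by simp_all
    have hwy: "h \<cdot> w1 = h \<cdot> y" unfolding w1_def e1_def using a(1,6) xy h(1,2) by simp
    note agree = M_eq[OF hwy w1(1) a(2) w1(3) xy(2)]
    have fagree: "f n \<cdot> y = f n \<cdot> w1" using fM_eq[OF hwy w1(1) a(2) w1(3) xy(2)] by simp
    define w where "w \<sigma> = Op U n (mcomp ?s \<sigma>) \<cdot> (if \<sigma> \<in> horn ?N n then w1 else y)" for \<sigma>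
    have sq: "mcomp ?s \<sigma> \<in> simplex n" if "\<sigma> \<in> simplex ?N" for \<sigma>
      using mcomp_simplex[OF ss(1), unfolded ss(2)] that .
    have sa: "mcomp ?s (mcomp \<sigma> \<alpha>) = mcomp (mcomp ?s \<sigma>) \<alpha>" if "\<sigma> \<in> simplex ?N" "\<alpha> \<in> simplex (dim \<sigma>)" for \<sigma> \<alpha>
      using mcomp_assoc[of \<sigma> ?s \<alpha>, unfolded ss(2), OF that] by simp
    have "f.pt ?N (boundary ?N) (Dom C y) w (Op X n ?s \<cdot> f n \<cdot> w1)"
      unfolding f.pt_iff
    proof (intro conjI ballI)
      fix \<sigma> assume s: "\<sigma> \<in> boundary ?N"
      note sN = bN[OF s]
      note sn = sq[OF sN]
      show "w \<sigma> \<in> Arr C" "Dom C (w \<sigma>) = Dom C y" "Cod C (w \<sigma>) = Ob U (dim \<sigma>)"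
        unfolding w_def using sn w1 a(2) xy(2) by simp_all
      have "f (dim \<sigma>) \<cdot> w \<sigma> = Op X n (mcomp ?s \<sigma>) \<cdot> f n \<cdot> w1"
        unfolding w_def using sn w1 a(2) xy(2) fagree by (simp add: f.natural_comp)
      then show "f (dim \<sigma>) \<cdot> w \<sigma> = Op X ?N \<sigma> \<cdot> Op X n ?s \<cdot> f n \<cdot> w1"
        using sN ss w1 by (simp add: Op_Op_comp)
      fix \<alpha> assume al: "\<alpha> \<in> simplex (dim \<sigma>)"
      have as: "mcomp ?s (mcomp \<sigma> \<alpha>) = mcomp (mcomp ?s \<sigma>) \<alpha>" using sa[OF sN al] .
      have step: "Op U n (mcomp ?s (mcomp \<sigma> \<alpha>)) \<cdot> t = Op U (dim \<sigma>) \<alpha> \<cdot> Op U n (mcomp ?s \<sigma>) \<cdot> t"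
        if "t \<in> Arr C" "Cod C t = Ob U n" for t
        unfolding as using sn al that by (simp add: Op_Op_comp)
      show "w (mcomp \<sigma> \<alpha>) = Op U (dim \<sigma>) \<alpha> \<cdot> w \<sigma>"
      proof (cases "\<sigma> \<in> horn ?N n")
        case True
        then have "mcomp \<sigma> \<alpha> \<in> horn ?N n" using sub_sset_horn[of ?N n] al by (simp add: sub_sset_def)
        then show ?thesis unfolding w_def using True step[OF w1(1,3)] by simp
      next
        case False
        have "Op U n (mcomp ?s (mcomp \<sigma> \<alpha>)) \<cdot> w1 = Op U n (mcomp ?s (mcomp \<sigma> \<alpha>)) \<cdot> y" if t: "mcomp \<sigma> \<alpha> \<in> horn ?N n"
        proof -
          have "n \<notin> set (mcomp \<sigma> \<alpha>)" using boundary_horn_or_face(1)[OF s False] set_mcomp_subset[OF sN al] by blast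
          then show ?thesis using agree squash_boundary[OF t] by blast
        qed
        then show ?thesis unfolding w_def using False step[OF a(2) xy(2)] by simp
      qed
    qed (use w1 ss in \<open>simp_all add: Suc_eq_plus1\<close>)
    then obtain t where t: "t \<in> Arr C" "Dom C t = Dom C y" "Cod C t = Ob U ?N" "\<And>\<sigma>. \<sigma> \<in> boundary ?N \<Longrightarrow> Op U ?N \<sigma> \<cdot> t = w \<sigma>"
        "f ?N \<cdot> t = Op X n ?s \<cdot> f n \<cdot> w1"
      using f.iso_fill[OF fL] by blast
    have "p.pt ?N (horn ?N n) (Dom C y) (\<lambda>\<sigma>. Op E n (mcomp ?s \<sigma>) \<cdot> e1) t"
      unfolding p.pt_iff
    proof (intro conjI ballI)
      fix \<sigma> assume s: "\<sigma> \<in> horn ?N n"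
      note sN = hs(1)[OF s]
      note sn = sq[OF sN]
      show "Op E n (mcomp ?s \<sigma>) \<cdot> e1 \<in> Arr C" "Dom C (Op E n (mcomp ?s \<sigma>) \<cdot> e1) = Dom C y"
        "Cod C (Op E n (mcomp ?s \<sigma>) \<cdot> e1) = Ob E (dim \<sigma>)" using sn e1 by simp_all
      show "p (dim \<sigma>) \<cdot> Op E n (mcomp ?s \<sigma>) \<cdot> e1 = Op U ?N \<sigma> \<cdot> t"
        unfolding t(4)[OF hs(2)[OF s]] w_def using sn e1 s by (simp add: p.natural_comp w1_def)
      fix \<alpha> assume al: "\<alpha> \<in> simplex (dim \<sigma>)"
      have "mcomp ?s (mcomp \<sigma> \<alpha>) = mcomp (mcomp ?s \<sigma>) \<alpha>" using sa[OF sN al] .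
      then show "Op E n (mcomp ?s (mcomp \<sigma> \<alpha>)) \<cdot> e1 = Op E (dim \<sigma>) \<alpha> \<cdot> Op E n (mcomp ?s \<sigma>) \<cdot> e1"
        using sn al e1 by (simp add: Op_Op_comp)
    qed (use t in simp_all)
    then obtain e where e: "e \<in> Arr C" "Dom C e = Dom C y" "Cod C e = Ob E ?N"
        "\<And>\<sigma>. \<sigma> \<in> horn ?N n \<Longrightarrow> Op E ?N \<sigma> \<cdot> e = Op E n (mcomp ?s \<sigma>) \<cdot> e1" "p ?N \<cdot> e = t"
      using p.iso_fill[OF pL] by blast
    obtain z where z: "z \<in> Arr C" "Dom C z = Dom C e" "Cod C z = Ob Z 1" "i 1 \<cdot> z = e" "b 1 \<cdot> z = b 0 \<cdot> x"
    proof (rule g.Z_lift[of e 1 "b 0 \<cdot> x"])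
      fix \<sigma> assume s: "\<sigma> \<in> bdry_part n 1"
      then have "\<sigma> \<in> horn ?N n" using bdry_part_horn[of n 1 0] by auto
      then show "Op E ?N \<sigma> \<cdot> e = g.u0 1 \<sigma> \<cdot> b 0 \<cdot> x"
        using e(4) g.u0_squash[OF s a(1) xy(1)] by (simp add: e1_def)
    next
      have "(f ?N \<cdot> p ?N) \<cdot> e = Op X n ?s \<cdot> f n \<cdot> w1" using e t by simp
      also have "\<dots> = g.v0 1 \<cdot> b 0 \<cdot> x"
        using g.v0_squash[OF a(1) xy(1)] a(1) xy(1) by (simp add: w1_def e1_def)
      finally show "(f ?N \<cdot> p ?N) \<cdot> e = g.v0 1 \<cdot> b 0 \<cdot> x" .
    qed (use e a xy that in simp_all)
    have zy: "Dom C z = Dom C y" using z(2) e(2) by simp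
    have sj: "Op E n (mcomp ?s (id_join n [0])) = Id C (Ob E n)" "Op U n (mcomp ?s (id_join n [1])) = Id C (Ob U n)"
      unfolding squash_id_join[OF zero_le_one] squash_id_join[OF order_refl] by (simp_all del: upt_Suc)
    have "face Z 1 1 \<cdot> z = x"
    proof (rule g.Z_eq[of _ _ 0])
      show "i 0 \<cdot> face Z 1 1 \<cdot> z = i 0 \<cdot> x"
        using fi(2)[OF z(1,3)] e(4)[OF id_join_0_horn] e1 unfolding z(4) sj by (simp add: e1_def)
      show "b 0 \<cdot> face Z 1 1 \<cdot> z = b 0 \<cdot> x" using fi(4)[OF z(1,3)] z(5) by simp
    qed (use z zy a xy in simp_all)
    moreover have "((p n \<cdot> i 0) \<cdot> face Z 1 0) \<cdot> z = y"
    proof -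
      have "((p n \<cdot> i 0) \<cdot> face Z 1 0) \<cdot> z = p n \<cdot> i 0 \<cdot> face Z 1 0 \<cdot> z" using z by simp
      also have "\<dots> = p n \<cdot> Op E ?N (id_join n [1]) \<cdot> e" unfolding fi(1)[OF z(1,3)] z(4) ..
      also have "\<dots> = Op U ?N (id_join n [1]) \<cdot> t" using js(2) jd(2) e by (simp add: p.natural_comp)
      also have "\<dots> = Op U n (mcomp ?s (id_join n [1])) \<cdot> y"
        unfolding t(4)[OF id_join_1_boundary] w_def using id_join_1_not_horn[of n] by simp
      also have "\<dots> = y" unfolding sj using a(2) xy by simp
      finally show ?thesis .
    qed
    ultimately show "\<exists>z. z \<in> Arr C \<and> Dom C z = Dom C y \<and> Cod C z = Dom C (face Z 1 1) \<and> face Z 1 1 \<cdot> z = x \<and>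
        ((p n \<cdot> i 0) \<cdot> face Z 1 0) \<cdot> z = y"
      using z(1,3) zy by (intro exI[of _ z]) simp
  next
    fix z z' assume "z \<in> Arr C" "z' \<in> Arr C" and zz: "Dom C z = Dom C z'" and "Cod C z = Dom C (face Z 1 1)" "Cod C z' = Dom C (face Z 1 1)"
      and d1: "face Z 1 1 \<cdot> z = face Z 1 1 \<cdot> z'" and d0: "((p n \<cdot> i 0) \<cdot> face Z 1 0) \<cdot> z = ((p n \<cdot> i 0) \<cdot> face Z 1 0) \<cdot> z'"
    then have z: "z \<in> Arr C" "Cod C z = Ob Z 1" and z': "z' \<in> Arr C" "Cod C z' = Ob Z 1" by simp_all
    have beq: "b 1 \<cdot> z = b 1 \<cdot> z'" using fi(4)[OF z] fi(4)[OF z'] d1 by simp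
    have e: "i 1 \<cdot> z \<in> Arr C" "i 1 \<cdot> z' \<in> Arr C" "Dom C (i 1 \<cdot> z) = Dom C (i 1 \<cdot> z')" "Cod C (i 1 \<cdot> z) = Ob E ?N" "Cod C (i 1 \<cdot> z') = Ob E ?N"
      using z z' zz by simp_all
    have last: "Op E ?N (id_join n [0]) \<cdot> i 1 \<cdot> z = Op E ?N (id_join n [0]) \<cdot> i 1 \<cdot> z'"
      using fi(2)[OF z] fi(2)[OF z'] d1 by simp
    have horn: "Op E ?N \<sigma> \<cdot> i 1 \<cdot> z = Op E ?N \<sigma> \<cdot> i 1 \<cdot> z'" if s: "\<sigma> \<in> horn ?N n" for \<sigma>
    proof (cases "\<sigma> \<in> bdry_part n 1")
      case True
      then show ?thesis using g.Z_pt(1)[OF z True] g.Z_pt(1)[OF z' True] beq by simp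
    next
      case False
      have "distinct (id_join n [0])" by (rule distinct_id_join) simp
      then obtain \<gamma> where \<gamma>: "\<gamma> \<in> simplex n" "mcomp (id_join n [0]) \<gamma> = \<sigma>"
        using factor_ex[OF _ js(1) hs(1)[OF s] horn_bdry_or_face[OF s False]] jd by metis
      have "Op E ?N \<sigma> \<cdot> i 1 \<cdot> x = Op E n \<gamma> \<cdot> Op E ?N (id_join n [0]) \<cdot> i 1 \<cdot> x" if "x \<in> Arr C" "Cod C x = Ob Z 1" for x
        unfolding \<gamma>(2)[symmetric] using \<gamma>(1) js jd that by (simp add: Op_Op_comp)
      then show ?thesis using last z z' by simp
    qed
    have pd: "p n \<cdot> i 0 \<cdot> face Z 1 0 \<cdot> z = p n \<cdot> i 0 \<cdot> face Z 1 0 \<cdot> z'" using d0 z z' by simp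
    have pj: "Op U ?N (id_join n [1]) \<cdot> p ?N \<cdot> i 1 \<cdot> z = Op U ?N (id_join n [1]) \<cdot> p ?N \<cdot> i 1 \<cdot> z'"
    proof -
      have "p n \<cdot> Op E ?N (id_join n [1]) \<cdot> i 1 \<cdot> x = Op U ?N (id_join n [1]) \<cdot> p ?N \<cdot> i 1 \<cdot> x" if "x \<in> Arr C" "Cod C x = Ob Z 1" for x
        using js(2) jd(2) that by (simp add: p.natural_comp)
      then show ?thesis using pd fi(1)[OF z] fi(1)[OF z'] z z' by metis
    qed
    have pe: "p ?N \<cdot> i 1 \<cdot> z = p ?N \<cdot> i 1 \<cdot> z'"
    proof (rule f.iso_fill_eq[OF fL boundary_subset])
      fix \<sigma> assume s: "\<sigma> \<in> boundary ?N"
      show "Op U ?N \<sigma> \<cdot> p ?N \<cdot> i 1 \<cdot> z = Op U ?N \<sigma> \<cdot> p ?N \<cdot> i 1 \<cdot> z'"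
      proof (cases "\<sigma> \<in> horn ?N n")
        case True
        then show ?thesis using horn[OF True] hs(1)[OF True] e p.natural_comp[OF hs(1)[OF True] refl] by metis
      next
        case False
        have "distinct (id_join n [1])" by (rule distinct_id_join) simp
        then obtain \<gamma> where \<gamma>: "\<gamma> \<in> simplex n" "mcomp (id_join n [1]) \<gamma> = \<sigma>"
          using factor_ex[OF _ js(2) bN[OF s] boundary_horn_or_face(2)[OF s False]] jd by metis
        have "Op U ?N \<sigma> \<cdot> x = Op U n \<gamma> \<cdot> Op U ?N (id_join n [1]) \<cdot> x" if "x \<in> Arr C" "Cod C x = Ob U ?N" for x
          unfolding \<gamma>(2)[symmetric] using \<gamma>(1) js jd that by (simp add: Op_Op_comp)
        then show ?thesis using pj e by simp
      qed
    next
      show "f ?N \<cdot> p ?N \<cdot> i 1 \<cdot> z = f ?N \<cdot> p ?N \<cdot> i 1 \<cdot> z'"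
        using g.Z_pt(2)[OF z] g.Z_pt(2)[OF z'] beq z z' by simp
    qed (use e in simp_all)
    have "i 1 \<cdot> z = i 1 \<cdot> z'"
      by (rule p.iso_fill_eq[OF pL horn_subset e horn pe])
    then show "z = z'" using g.Z_eq[OF z(1) z'(1) z(2) z'(2) zz] beq by blast
  qed (use h in simp_all)
qed

lemma mor_space_regular:
  assumes bun: "local_bundle C n E U p" and hyp: "hypercover C (enat (n + 1)) U X f"
    and Z: "mor_space C E X (\<lambda>k. f k \<cdot> p k) n B u v r Z i b"
  shows "regular C Z"
proof -
  interpret g: mor_space C E X "\<lambda>k. f k \<cdot> p k" n B u v r Z i b by (rule Z)
  have tcp: "twisted_cartesian_product C E U p" and st: "stack C (enat n) E U p"
    using bun by (simp_all add: local_bundle_def)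
  have pm: "simplicial_map C E U p" using st by (simp add: stack_def)
  have fm: "simplicial_map C U X f" using hyp by (simp add: hypercover_def)
  have "\<exists>L u v h. is_rel_hom_obj C E U p (n + 1) (horn (n + 1) n) L u v \<and>
        is_rel_restr C E p (n + 1) (horn (n + 1) n) L u v h \<and> h \<in> Cov C \<and> (enat (n + 1) > enat n \<longrightarrow> is_iso C h)"
    using st unfolding stack_def by (elim conjE allE[of _ "n + 1"]) simp
  then obtain L1 u1 v1 h1 where pL: "is_rel_hom_obj C E U p (n + 1) (horn (n + 1) n) L1 u1 v1"
    "is_rel_restr C E p (n + 1) (horn (n + 1) n) L1 u1 v1 h1" "is_iso C h1" by auto
  have hk: "\<exists>L u v h. is_rel_hom_obj C U X f k (boundary k) L u v \<and> is_rel_restr C U f k (boundary k) L u v h \<and>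
        h \<in> Cov C \<and> (enat k \<ge> enat (n + 1) \<longrightarrow> is_iso C h)" for k
    using hyp unfolding hypercover_def by blast
  obtain L2 u2 v2 h2 where fL: "is_rel_hom_obj C U X f (n + 1) (boundary (n + 1)) L2 u2 v2"
    "is_rel_restr C U f (n + 1) (boundary (n + 1)) L2 u2 v2 h2" "is_iso C h2"
    using hk[of "n + 1"] by auto
  obtain M uM vM h where fM: "is_rel_hom_obj C U X f n (boundary n) M uM vM"
    "is_rel_restr C U f n (boundary n) M uM vM h" and hc: "h \<in> Cov C"
    using hk[of n] by blast
  note pb = mor_space_pullback[OF pm fm pL fL fM Z]
  have h: "Dom C h = Ob U n" "Cod C h = M" using fM(2) by (simp_all add: is_rel_restr_def)
  obtain F \<psi> where "is_product C (Ob U n) F (Ob E n) (p n) \<psi>" using tcp_product[OF tcp] .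
  from product_iso[OF this g.i_simps(1) g.i0_iso] have W: "is_product C (Ob U n) F (Ob Z 0) (p n \<cdot> i 0) (\<psi> \<cdot> i 0)"
    using g.i_simps(2,3)[of 0] by simp
  obtain P q1 q2 where P: "is_product C (Ob Z 0) (Ob Z 0) P q1 q2" using product_ex[OF Ob_Obj[OF g.Z_obj] Ob_Obj[OF g.Z_obj]] .
  obtain \<mu> where \<mu>: "\<mu> \<in> Arr C" "Dom C \<mu> = Dom C (face Z 1 0)" "Cod C \<mu> = P" "q1 \<cdot> \<mu> = face Z 1 0" "q2 \<cdot> \<mu> = face Z 1 1"
    by (rule product_lift[OF P, of "face Z 1 0" "face Z 1 1"]) simp_all
  have "regular_embedding C \<mu>"
    by (rule regular_embedding_of_pullback[OF hc h W _ _ pb P]) (use \<mu> in simp_all)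
  then show ?thesis unfolding regular_def using P \<mu> by (intro exI conjI) simp_all
qed

end

section \<open>Existence of the strictification\<close>

theorem theorem5p7:
  fixes C :: "('o, 'm) cov_cat"
    and n :: nat
    and E U X :: "('o, 'm) sobj"
    and p f :: "nat \<Rightarrow> 'm"
  assumes "category_with_covers C"
    and "godement C"
    and "local_bundle C n E U p"
    and "hypercover C (enat (n + 1)) U X f"
  shows "strictification_exists C n E X (\<lambda>k. f k \<cdot>\<^bsub>C\<^esub> p k)"
proof -
  interpret covers C by unfold_locales (rule assms)
  have pm: "simplicial_map C E U p" and lE: "lie_groupoid C \<infinity> E"
    using assms(3) by (simp_all add: local_bundle_def stack_def)
  have fm: "simplicial_map C U X f" and lX: "lie_groupoid C \<infinity> X"
    using assms(4) by (simp_all add: hypercover_def)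
  interpret g: simplicial_morphism C E X "\<lambda>k. f k \<cdot>\<^bsub>C\<^esub> p k" by unfold_locales (rule simplicial_map_comp[OF pm fm])
  have fib: g.fibration
    by (rule fibration_comp[OF pm fm local_bundle_fibration[OF assms(3)] hypercover_fibration[OF assms(4)]])
  obtain B u v r Z i b where Z: "g.is_mor_space n B u v r Z i b" "is_higher_mor C n E X (\<lambda>k. f k \<cdot>\<^bsub>C\<^esub> p k) Z"
    using g.mor_space_exists[OF fib] .
  interpret m: mor_space C E X "\<lambda>k. f k \<cdot>\<^bsub>C\<^esub> p k" n B u v r Z i b by unfold_locales (rule fib, rule Z)
  have "regular C Z" by (rule mor_space_regular[OF assms(3,4) m.mor_space_axioms])
  then obtain q where "is_orbit_space C Z q" using assms(2) m.Z_lie unfolding godement_def by blast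
  then show ?thesis unfolding strictification_exists_def using g.fibration_stack[OF fib lE lX] Z(2) by blast
qed

end
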